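(* Let $\mathcal A=A_{-1}\oplus A_{-2}$ be a graded vector bundle over $M$, and suppose $\mathcal A$ and $\mathcal A^*[3]$ are split Lie $2$-algebroids with structure functions $\mu$ and $\gamma$ respectively, such that $\mu^{(2,1,1)}=\gamma^{(2,1,1)}$. Then $(\mathcal A,\mathcal A^*[3])$ is a split Lie $2$-bialgebroid if and only if the following two conditions hold: $$\delta_*[X,Y]_S=-[\delta_*(X),Y]_S+(-1)^{|X|}[X,\delta_*(Y)]_S,\qquad\forall\,X,Y\in\Gamma(\mathcal A[-3]),$$ $$\delta[\alpha,\beta]_S=-[\delta(\alpha),\beta]_S+(-1)^{|\alpha|}[\alpha,\delta(\beta)]_S,\qquad\forall\,\alpha,\beta\in\Gamma(\mathcal A^* ).$$ Here $\delta_*=\{\gamma,\cdot\}$ and $\delta=\{\mu,\cdot\}$ are the coboundary operators associated to the split Lie $2$-algebroids $\mathcal A^*[3]$ and $\mathcal A$ respectively, the bracket in the first identity is the binary bracket on $\mathrm{Sym}(\mathcal A[-3])$ induced by $\mathcal A$, and the bracket in the second identity is the binary bracket on $\mathrm{Sym}(\mathcal A^* )$ induced by $\mathcal A^*[3]$.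
   Context: **Lie 2-algebra.** A Lie $2$-algebra $(V_{-2},V_{-1},\mathrm{d},l_2,l_3)$ is a 2-term $L_\infty[1]$-algebra: a linear map $\mathrm{d}:V_{-2}\to V_{-1}$, graded symmetric bilinear $l_2:V_i\times V_j\to V_{i+j+1}$, $-3\le i+j\le -2$ (skew on $V_{-1}\times V_{-1}$, and $l_2(x,m)=l_2(m,x)$ for $x\in V_{-1},m\in V_{-2}$), and a totally skew trilinear $l_3:V_{-1}^{\times 3}\to V_{-2}$, with, for $x,y,z,w\in V_{-1}$, $m,n\in V_{-2}$: $\mathrm{d}l_2(x,m)=l_2(x,\mathrm{d}m)$; $l_2(\mathrm{d}m,n)=-l_2(m,\mathrm{d}n)$; $\mathrm{d}l_3(x,y,z)=l_2(x,l_2(y,z))-l_2(l_2(x,y),z)-l_2(y,l_2(x,z))$; $l_3(x,y,\mathrm{d}m)=l_2(x,l_2(y,m))-l_2(l_2(x,y),m)-l_2(y,l_2(x,m))$; and $l_2(x,l_3(y,z,w))-l_2(y,l_3(x,z,w))+l_2(z,l_3(x,y,w))-l_2(l_3(x,y,z),w)-l_3(l_2(x,y),z,w)-l_3(y,l_2(x,z),w)-l_3(y,z,l_2(x,w))+l_3(x,l_2(y,z),w)+l_3(x,z,l_2(y,w))-l_3(x,y,l_2(z,w))=0$. **Split Lie 2-algebroid.** A graded vector bundle $\mathcal{A}=A_{-1}\oplus A_{-2}$ over $M$ with a bundle map $a:A_{-1}\to TM$ and brackets $l_1,l_2,l_3$ such that $(\Gamma(A_{-2}),\Gamma(A_{-1}),l_1,l_2,l_3)$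 is a Lie 2-algebra, $l_2(X^1,fY)=fl_2(X^1,Y)+a(X^1)(f)Y$ for $X^1\in\Gamma(A_{-1})$, $Y\in\Gamma(\mathcal A)$, $f\in C^\infty(M)$, and $l_1,l_3$ are $C^\infty(M)$-linear. On $\mathcal A^*[3]$ the degree $-1$ part is $A_{-2}^*$ and the degree $-2$ part is $A_{-1}^*$. **Big bracket.** $\mathcal M=T^*[3](A_{-1}\oplus A_{-2})$ has local Darboux coordinates $(x^i,\xi^j,\theta^k,p_i,\xi_j,\theta_k)$ of degrees $(0,1,2,3,2,1)$; $\xi^j,\theta^k$ are fibre-linear coordinates on $A_{-1},A_{-2}$ (local frames of $A_{-1}^*,A_{-2}^*$) and $\xi_j,\theta_k$ are identified with the dual frames of $A_{-1},A_{-2}$. The Poisson bracket has degree $-3$: $\{F,G\}=-(-1)^{(|F|-3)(|G|-3)}\{G,F\}$, $\{F,GH\}=\{F,G\}H+(-1)^{(|F|-3)|G|}G\{F,H\}$, graded Jacobi, with nonzero coordinate brackets $\{x^i,p_j\}=\delta^i_j$, $\{\xi^i,\xi_j\}=\delta^i_j$, $\{\theta_j,\theta^i\}=\delta^i_j$. The coordinates $(x^i,\xi^j,\theta^k,p_i,\xi_j,\theta_k)$ have tridegrees $(0,0,0),(0,1,0),(1,1,0),(1,1,1),(1,0,1),(0,0,1)$; $F^{(i,j,k)}$ denotes the tridegree $(i,j,k)$ component of $F$. A split Lie 2-algebroid structure $(l_1,l_2,l_3,a)$ on $\mathcal A$ is equivalent to a degree $4$ function $\mu=\mu^{(2,1,1)}+\mu^{(1,2,1)}+\mu^{(0,3,1)}$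 on $\mathcal M$ with $\{\mu,\mu\}=0$ (its structure function), via $l_1(X^2)=-\{\mu^{(2,1,1)},X^2\}$, $l_2(X^1,Y)=-\{\{\mu^{(1,2,1)},X^1\},Y\}$, $l_3(X^1,Y^1,Z^1)=-\{\{\{\mu^{(0,3,1)},X^1\},Y^1\},Z^1\}$, $a(X^1)(f)=-\{\{\mu^{(1,2,1)},X^1\},f\}$. Likewise (by the Legendre isomorphism $T^*[3](\mathcal A)\cong T^*[3](\mathcal A^*[3])$) a split Lie 2-algebroid structure $(\mathfrak l_1,\mathfrak l_2,\mathfrak l_3,\mathfrak a)$ on $\mathcal A^*[3]$ is equivalent to a degree $4$ function $\gamma=\gamma^{(2,1,1)}+\gamma^{(1,1,2)}+\gamma^{(0,1,3)}$ on $\mathcal M$ with $\{\gamma,\gamma\}=0$, via $\mathfrak l_1(\alpha^1)=-\{\gamma^{(2,1,1)},\alpha^1\}$, $\mathfrak l_2(\alpha^2,\beta)=-\{\{\gamma^{(1,1,2)},\alpha^2\},\beta\}$, $\mathfrak l_3(\alpha^2,\beta^2,\gamma^2)=-\{\{\{\gamma^{(0,1,3)},\alpha^2\},\beta^2\},\gamma^2\}$, $\mathfrak a(\alpha^2)(f)=-\{\{\gamma^{(1,1,2)},\alpha^2\},f\}$. (Superscript $i$ on $X^i$, $\alpha^i$ means a section of $A_{-i}$, $A_{-i}^*$.) **Split Lie 2-bialgebroid.** $(\mathcal A,\mathcal A^*[3])$ is a split Lie 2-bialgebroid if $\mu^{(2,1,1)}=\gamma^{(2,1,1)}$ and $\{\mu+\gamma-\mu^{(2,1,1)},\mu+\gamma-\mu^{(2,1,1)}\}=0$.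 **Symmetric algebras and brackets.** $\mathrm{Sym}(\mathcal A[-3])$ is the graded commutative algebra over $C^\infty(M)$ generated by $\Gamma(A_{-2})$ in degree $1$ and $\Gamma(A_{-1})$ in degree $2$; $\mathrm{Sym}(\mathcal A^* )$ is generated by $\Gamma(A_{-1}^* )$ in degree $1$ and $\Gamma(A_{-2}^* )$ in degree $2$. Both are subalgebras of $C^\infty(\mathcal M)$, and $|\cdot|$ denotes these degrees. On $\mathrm{Sym}(\mathcal A[-3])$: $[P,Q]_S=-\{\{\mu^{(1,2,1)},P\},Q\}$; on $\mathrm{Sym}(\mathcal A^* )$: $[\phi,\psi]_S=-\{\{\gamma^{(1,1,2)},\phi\},\psi\}$. The operator $\delta_*=\{\gamma,\cdot\}$ acts on $\mathrm{Sym}(\mathcal A[-3])$ and $\delta=\{\mu,\cdot\}$ acts on $\mathrm{Sym}(\mathcal A^* )$. *)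

theory Defs
  imports
    "HOL-Analysis.Analysis"
    "HOL-Library.Multiset"
    "HOL-Library.Function_Algebras"
    "HOL-Library.Product_Plus"
begin

section \<open>Smooth functions on open subsets of Euclidean space\<close>

definition partial :: "nat \<Rightarrow> ((nat \<Rightarrow> real) \<Rightarrow> real) \<Rightarrow> (nat \<Rightarrow> real) \<Rightarrow> real" where
  "partial i f x = deriv (\<lambda>t. f (x(i := t))) (x i)"

text \<open>All iterated partial derivatives exist and are continuous on the open subset \<open>V\<close> of
  \<open>Euclidean_space n\<close>. The dimension is a natural number (not a type), so that \<open>n = 0\<close> is allowed.\<close>

definition C_infinity_on :: "nat \<Rightarrow> (nat \<Rightarrow> real) set \<Rightarrow> ((nat \<Rightarrow> real) \<Rightarrow> real) \<Rightarrow> bool" where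
  "C_infinity_on n V f \<longleftrightarrow>
     (\<forall>is. set is \<subseteq> {..<n} \<longrightarrow>
        continuous_map (subtopology (Euclidean_space n) V) euclideanreal (foldr partial is f) \<and>
        (\<forall>x\<in>V. \<forall>i<n. (\<lambda>t. foldr partial is f (x(i := t))) differentiable (at (x i))))"


section \<open>Graded vector bundles over smooth manifolds\<close>

text \<open>A manifold \<open>base\<close> of dimension \<open>bdim\<close> with an atlas (index set \<open>idx\<close>, domains \<open>cdom\<close>) over
  whose charts both \<open>A\<^sub>-\<^sub>1\<close> and \<open>A\<^sub>-\<^sub>2\<close> are trivialised. The bundle \<open>A\<^sub>-\<^sub>k\<close> has rank \<open>rk\<^sub>k\<close> and transition
  matrices \<open>tr\<^sub>k\<close>: fibre coordinates \<open>v\<^sub>\<beta>\<close> over chart \<open>\<beta>\<close> correspond to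
  \<open>v\<^sub>\<alpha> = tr\<^sub>k \<alpha> \<beta> m v\<^sub>\<beta>\<close> over chart \<open>\<alpha>\<close>.\<close>

record ('i, 'm) graded_bundle =
  base :: "'m topology"
  bdim :: nat
  idx :: "'i set"
  cdom :: "'i \<Rightarrow> 'm set"
  chart :: "'i \<Rightarrow> 'm \<Rightarrow> nat \<Rightarrow> real"
  rk\<^sub>1 :: nat
  tr\<^sub>1 :: "'i \<Rightarrow> 'i \<Rightarrow> 'm \<Rightarrow> nat \<Rightarrow> nat \<Rightarrow> real"
  rk\<^sub>2 :: nat
  tr\<^sub>2 :: "'i \<Rightarrow> 'i \<Rightarrow> 'm \<Rightarrow> nat \<Rightarrow> nat \<Rightarrow> real"

definition chart_inv :: "('i, 'm) graded_bundle \<Rightarrow> 'i \<Rightarrow> (nat \<Rightarrow> real) \<Rightarrow> 'm" where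
  "chart_inv \<A> \<alpha> = inv_into (cdom \<A> \<alpha>) (chart \<A> \<alpha>)"

definition smooth_in :: "('i, 'm) graded_bundle \<Rightarrow> 'i \<Rightarrow> 'm set \<Rightarrow> ('m \<Rightarrow> real) \<Rightarrow> bool" where
  "smooth_in \<A> \<alpha> W f \<longleftrightarrow> C_infinity_on (bdim \<A>) (chart \<A> \<alpha> ` W) (f \<circ> chart_inv \<A> \<alpha>)"

text \<open>The derivation \<open>\<partial>/\<partial>x\<^sup>i\<close> of chart \<open>\<alpha>\<close>, extended by \<open>0\<close> outside the chart domain.\<close>

definition pd :: "('i, 'm) graded_bundle \<Rightarrow> 'i \<Rightarrow> nat \<Rightarrow> ('m \<Rightarrow> real) \<Rightarrow> 'm \<Rightarrow> real" where
  "pd \<A> \<alpha> i f m = (if m \<in> cdom \<A> \<alpha> then partial i (f \<circ> chart_inv \<A> \<alpha>) (chart \<A> \<alpha> m) else 0)"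

definition smooth_manifold :: "('i, 'm) graded_bundle \<Rightarrow> bool" where
  "smooth_manifold \<A> \<longleftrightarrow>
     Hausdorff_space (base \<A>) \<and> second_countable (base \<A>) \<and>
     (\<Union>\<alpha>\<in>idx \<A>. cdom \<A> \<alpha>) = topspace (base \<A>) \<and>
     (\<forall>\<alpha>\<in>idx \<A>.
        openin (base \<A>) (cdom \<A> \<alpha>) \<and>
        openin (Euclidean_space (bdim \<A>)) (chart \<A> \<alpha> ` cdom \<A> \<alpha>) \<and>
        homeomorphic_map (subtopology (base \<A>) (cdom \<A> \<alpha>))
          (subtopology (Euclidean_space (bdim \<A>)) (chart \<A> \<alpha> ` cdom \<A> \<alpha>)) (chart \<A> \<alpha>)) \<and>
     (\<forall>\<alpha>\<in>idx \<A>. \<forall>\<beta>\<in>idx \<A>. \<forall>j<bdim \<A>.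
        smooth_in \<A> \<alpha> (cdom \<A> \<alpha> \<inter> cdom \<A> \<beta>) (\<lambda>m. chart \<A> \<beta> m j))"

definition vector_bundle_cocycle ::
    "('i, 'm) graded_bundle \<Rightarrow> nat \<Rightarrow> ('i \<Rightarrow> 'i \<Rightarrow> 'm \<Rightarrow> nat \<Rightarrow> nat \<Rightarrow> real) \<Rightarrow> bool" where
  "vector_bundle_cocycle \<A> r g \<longleftrightarrow>
     (\<forall>\<alpha>\<in>idx \<A>. \<forall>m\<in>cdom \<A> \<alpha>. \<forall>j<r. \<forall>k<r. g \<alpha> \<alpha> m j k = (if j = k then 1 else 0)) \<and>
     (\<forall>\<alpha>\<in>idx \<A>. \<forall>\<beta>\<in>idx \<A>. \<forall>\<gamma>\<in>idx \<A>. \<forall>m\<in>cdom \<A> \<alpha> \<inter> cdom \<A> \<beta> \<inter> cdom \<A> \<gamma>. \<forall>j<r. \<forall>k<r.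
        g \<alpha> \<gamma> m j k = (\<Sum>l<r. g \<alpha> \<beta> m j l * g \<beta> \<gamma> m l k)) \<and>
     (\<forall>\<alpha>\<in>idx \<A>. \<forall>\<beta>\<in>idx \<A>. \<forall>j<r. \<forall>k<r.
        smooth_in \<A> \<alpha> (cdom \<A> \<alpha> \<inter> cdom \<A> \<beta>) (\<lambda>m. g \<alpha> \<beta> m j k))"

definition graded_vector_bundle :: "('i, 'm) graded_bundle \<Rightarrow> bool" where
  "graded_vector_bundle \<A> \<longleftrightarrow>
     smooth_manifold \<A> \<and>
     vector_bundle_cocycle \<A> (rk\<^sub>1 \<A>) (tr\<^sub>1 \<A>) \<and>
     vector_bundle_cocycle \<A> (rk\<^sub>2 \<A>) (tr\<^sub>2 \<A>)"


section \<open>Local functions on \<open>T\<^sup>*[3](A\<^sub>-\<^sub>1 \<oplus> A\<^sub>-\<^sub>2)\<close>\<close>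

text \<open>Fibre coordinates: \<open>Xi j\<close>, \<open>Th k\<close>, \<open>P i\<close>, \<open>Xid j\<close>, \<open>Thd k\<close> stand for
  \<open>\<xi>\<^sup>j\<close>, \<open>\<theta>\<^sup>k\<close>, \<open>p\<^sub>i\<close>, \<open>\<xi>\<^sub>j\<close>, \<open>\<theta>\<^sub>k\<close>.\<close>

datatype gen = Xi nat | Th nat | P nat | Xid nat | Thd nat

primrec deg :: "gen \<Rightarrow> nat" where
  "deg (Xi _) = 1"
| "deg (Th _) = 2"
| "deg (P _) = 3"
| "deg (Xid _) = 2"
| "deg (Thd _) = 1"

primrec tdeg :: "gen \<Rightarrow> nat \<times> nat \<times> nat" where
  "tdeg (Xi _) = (0, 1, 0)"
| "tdeg (Th _) = (1, 1, 0)"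
| "tdeg (P _) = (1, 1, 1)"
| "tdeg (Xid _) = (1, 0, 1)"
| "tdeg (Thd _) = (0, 0, 1)"

text \<open>An arbitrary linear order on the coordinates, fixing the normal form of monomials.\<close>

primrec gen_code :: "gen \<Rightarrow> nat" where
  "gen_code (Xi j) = 5 * j"
| "gen_code (Th k) = 5 * k + 1"
| "gen_code (P i) = 5 * i + 2"
| "gen_code (Xid j) = 5 * j + 3"
| "gen_code (Thd k) = 5 * k + 4"

lemma gen_code_inject: "gen_code x = gen_code y \<Longrightarrow> x = y"
  by (cases x; cases y; simp; presburger)

instantiation gen :: linorder
begin

definition less_eq_gen :: "gen \<Rightarrow> gen \<Rightarrow> bool" where
  "less_eq_gen x y \<longleftrightarrow> gen_code x \<le> gen_code y"

definition less_gen :: "gen \<Rightarrow> gen \<Rightarrow> bool" where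
  "less_gen x y \<longleftrightarrow> gen_code x < gen_code y"

instance
  by standard (auto simp: less_eq_gen_def less_gen_def intro: gen_code_inject)

end

text \<open>A multiset of coordinates stands for the product of its elements in increasing order;
  coordinates of odd degree square to zero. A local function maps a monomial to its coefficient.\<close>

type_synonym 'm lfun = "gen multiset \<Rightarrow> 'm \<Rightarrow> real"

definition admissible :: "gen multiset \<Rightarrow> bool" where
  "admissible A \<longleftrightarrow> (\<forall>z. odd (deg z) \<longrightarrow> count A z \<le> 1)"

text \<open>Koszul sign of reordering the concatenation of the monomials \<open>B\<close> and \<open>C\<close>.\<close>

definition koszul :: "gen multiset \<Rightarrow> gen multiset \<Rightarrow> real" where
  "koszul B C = (-1) ^ (\<Sum>b\<in>#B. size {#c \<in># C. odd (deg b) \<and> odd (deg c) \<and> c < b#})"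

definition lprod :: "'m lfun \<Rightarrow> 'm lfun \<Rightarrow> 'm lfun" where
  "lprod F G = (\<lambda>A m. if admissible A
      then (\<Sum>B | B \<subseteq># A. koszul B (A - B) * F B m * G (A - B) m) else 0)"

definition lone :: "'m lfun" where
  "lone = (\<lambda>A m. if A = {#} then 1 else 0)"

definition var :: "gen \<Rightarrow> 'm lfun" where
  "var z = (\<lambda>A m. if A = {#z#} then 1 else 0)"

definition fmul :: "('m \<Rightarrow> real) \<Rightarrow> 'm lfun \<Rightarrow> 'm lfun" where
  "fmul f F = (\<lambda>A m. f m * F A m)"

text \<open>Left and right partial derivatives, for functions supported on admissible monomials.\<close>

definition lderiv :: "gen \<Rightarrow> 'm lfun \<Rightarrow> 'm lfun" where
  "lderiv z F = (\<lambda>A m. koszul {#z#} A * real (count A z + 1) * F (add_mset z A) m)"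

definition rderiv :: "gen \<Rightarrow> 'm lfun \<Rightarrow> 'm lfun" where
  "rderiv z F = (\<lambda>A m. koszul A {#z#} * real (count A z + 1) * F (add_mset z A) m)"

definition xderiv :: "('i, 'm) graded_bundle \<Rightarrow> 'i \<Rightarrow> nat \<Rightarrow> 'm lfun \<Rightarrow> 'm lfun" where
  "xderiv \<A> \<alpha> i F = (\<lambda>A. pd \<A> \<alpha> i (F A))"

text \<open>The sum over pairs of coordinates of (right derivative of \<open>F\<close>) \<open>\<cdot>\<close> (coordinate bracket)
  \<open>\<cdot>\<close> (left derivative of \<open>G\<close>): the biderivation with the Leibniz rule
  \<open>{F,GH} = {F,G}H + (-1)^((|F|-3)|G|) G{F,H}\<close> and the coordinate brackets
  \<open>{x\<^sup>i,p\<^sub>i} = {\<xi>\<^sup>j,\<xi>\<^sub>j} = {\<theta>\<^sub>k,\<theta>\<^sup>k} = 1\<close>, \<open>{p\<^sub>i,x\<^sup>i} = {\<xi>\<^sub>j,\<xi>\<^sup>j} = {\<theta>\<^sup>k,\<theta>\<^sub>k} = -1\<close>.\<close>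

definition lbracket :: "('i, 'm) graded_bundle \<Rightarrow> 'i \<Rightarrow> 'm lfun \<Rightarrow> 'm lfun \<Rightarrow> 'm lfun" where
  "lbracket \<A> \<alpha> F G =
     (\<Sum>i<bdim \<A>. lprod (xderiv \<A> \<alpha> i F) (lderiv (P i) G)
                 - lprod (rderiv (P i) F) (xderiv \<A> \<alpha> i G))
   + (\<Sum>j<rk\<^sub>1 \<A>. lprod (rderiv (Xi j) F) (lderiv (Xid j) G)
                 - lprod (rderiv (Xid j) F) (lderiv (Xi j) G))
   + (\<Sum>k<rk\<^sub>2 \<A>. lprod (rderiv (Thd k) F) (lderiv (Th k) G)
                 - lprod (rderiv (Th k) F) (lderiv (Thd k) G))"


section \<open>Global functions and the big bracket\<close>

text \<open>The coordinates over chart \<open>\<beta>\<close> expressed in those over chart \<open>\<alpha>\<close>. The law for \<open>p\<^sub>i\<close> is the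
  cotangent lift: the quadratic terms are forced by \<open>{p\<^sub>i,\<xi>\<^sup>j} = {p\<^sub>i,\<theta>\<^sup>k} = 0\<close> over chart \<open>\<beta>\<close>.\<close>

definition Xid_change :: "('i, 'm) graded_bundle \<Rightarrow> 'i \<Rightarrow> 'i \<Rightarrow> nat \<Rightarrow> 'm lfun" where
  "Xid_change \<A> \<alpha> \<beta> j = (\<Sum>k<rk\<^sub>1 \<A>. fmul (\<lambda>m. tr\<^sub>1 \<A> \<alpha> \<beta> m k j) (var (Xid k)))"

definition Thd_change :: "('i, 'm) graded_bundle \<Rightarrow> 'i \<Rightarrow> 'i \<Rightarrow> nat \<Rightarrow> 'm lfun" where
  "Thd_change \<A> \<alpha> \<beta> j = (\<Sum>k<rk\<^sub>2 \<A>. fmul (\<lambda>m. tr\<^sub>2 \<A> \<alpha> \<beta> m k j) (var (Thd k)))"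

primrec coord_change :: "('i, 'm) graded_bundle \<Rightarrow> 'i \<Rightarrow> 'i \<Rightarrow> gen \<Rightarrow> 'm lfun" where
  "coord_change \<A> \<alpha> \<beta> (Xi j) = (\<Sum>k<rk\<^sub>1 \<A>. fmul (\<lambda>m. tr\<^sub>1 \<A> \<beta> \<alpha> m j k) (var (Xi k)))"
| "coord_change \<A> \<alpha> \<beta> (Th j) = (\<Sum>k<rk\<^sub>2 \<A>. fmul (\<lambda>m. tr\<^sub>2 \<A> \<beta> \<alpha> m j k) (var (Th k)))"
| "coord_change \<A> \<alpha> \<beta> (Xid j) = Xid_change \<A> \<alpha> \<beta> j"
| "coord_change \<A> \<alpha> \<beta> (Thd j) = Thd_change \<A> \<alpha> \<beta> j"
| "coord_change \<A> \<alpha> \<beta> (P i) =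
     (\<Sum>j<bdim \<A>. fmul (pd \<A> \<beta> i (\<lambda>m. chart \<A> \<alpha> m j)) (var (P j)))
   - (\<Sum>j<rk\<^sub>1 \<A>. \<Sum>k<rk\<^sub>1 \<A>. fmul (pd \<A> \<beta> i (\<lambda>m. tr\<^sub>1 \<A> \<beta> \<alpha> m j k))
        (lprod (var (Xi k)) (Xid_change \<A> \<alpha> \<beta> j)))
   + (\<Sum>j<rk\<^sub>2 \<A>. \<Sum>k<rk\<^sub>2 \<A>. fmul (pd \<A> \<beta> i (\<lambda>m. tr\<^sub>2 \<A> \<beta> \<alpha> m j k))
        (lprod (var (Th k)) (Thd_change \<A> \<alpha> \<beta> j)))"

definition pull :: "('i, 'm) graded_bundle \<Rightarrow> 'i \<Rightarrow> 'i \<Rightarrow> 'm lfun \<Rightarrow> 'm lfun" where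
  "pull \<A> \<alpha> \<beta> F = (\<lambda>A m. \<Sum>B | F B m \<noteq> 0.
      F B m * foldr lprod (map (coord_change \<A> \<alpha> \<beta>) (sorted_list_of_multiset B)) lone A m)"

type_synonym ('i, 'm) gfun = "'i \<Rightarrow> 'm lfun"

definition gens :: "('i, 'm) graded_bundle \<Rightarrow> gen set" where
  "gens \<A> = Xi ` {..<rk\<^sub>1 \<A>} \<union> Th ` {..<rk\<^sub>2 \<A>} \<union> P ` {..<bdim \<A>}
          \<union> Xid ` {..<rk\<^sub>1 \<A>} \<union> Thd ` {..<rk\<^sub>2 \<A>}"

text \<open>The algebra of functions on \<open>T\<^sup>*[3](A\<^sub>-\<^sub>1 \<oplus> A\<^sub>-\<^sub>2)\<close>: families of local functions, polynomial in the
  fibre coordinates with smooth coefficients, which agree on overlaps of charts. They are extended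
  by \<open>0\<close> outside the chart domains, so equality of functions is equality in HOL.\<close>

definition gfuns :: "('i, 'm) graded_bundle \<Rightarrow> ('i, 'm) gfun set" where
  "gfuns \<A> = {F.
     (\<forall>\<alpha> A m. F \<alpha> A m \<noteq> 0 \<longrightarrow>
        \<alpha> \<in> idx \<A> \<and> m \<in> cdom \<A> \<alpha> \<and> set_mset A \<subseteq> gens \<A> \<and> admissible A) \<and>
     (\<exists>N. \<forall>\<alpha> A m. F \<alpha> A m \<noteq> 0 \<longrightarrow> (\<Sum>z\<in>#A. deg z) \<le> N) \<and>
     (\<forall>\<alpha>\<in>idx \<A>. \<forall>A. smooth_in \<A> \<alpha> (cdom \<A> \<alpha>) (F \<alpha> A)) \<and>
     (\<forall>\<alpha>\<in>idx \<A>. \<forall>\<beta>\<in>idx \<A>. \<forall>m\<in>cdom \<A> \<alpha> \<inter> cdom \<A> \<beta>. \<forall>A. F \<alpha> A m = pull \<A> \<alpha> \<beta> (F \<beta>) A m)}"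

definition gprod :: "('i, 'm) gfun \<Rightarrow> ('i, 'm) gfun \<Rightarrow> ('i, 'm) gfun" (infixl "\<odot>" 70) where
  "F \<odot> G = (\<lambda>\<alpha>. lprod (F \<alpha>) (G \<alpha>))"

definition gscale :: "real \<Rightarrow> ('i, 'm) gfun \<Rightarrow> ('i, 'm) gfun" where
  "gscale c F = (\<lambda>\<alpha> A m. c * F \<alpha> A m)"

definition big_bracket ::
    "('i, 'm) graded_bundle \<Rightarrow> ('i, 'm) gfun \<Rightarrow> ('i, 'm) gfun \<Rightarrow> ('i, 'm) gfun" where
  "big_bracket \<A> F G = (\<lambda>\<alpha>. lbracket \<A> \<alpha> (F \<alpha>) (G \<alpha>))"

text \<open>The component of tridegree \<open>t\<close>.\<close>

definition tcomp :: "nat \<times> nat \<times> nat \<Rightarrow> ('i, 'm) gfun \<Rightarrow> ('i, 'm) gfun" where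
  "tcomp t F = (\<lambda>\<alpha> A m. if (\<Sum>z\<in>#A. tdeg z) = t then F \<alpha> A m else 0)"

definition homogeneous :: "nat \<Rightarrow> ('i, 'm) gfun \<Rightarrow> bool" where
  "homogeneous d F \<longleftrightarrow> (\<forall>\<alpha> A m. F \<alpha> A m \<noteq> 0 \<longrightarrow> (\<Sum>z\<in>#A. deg z) = d)"

definition base_funs :: "('i, 'm) graded_bundle \<Rightarrow> ('i, 'm) gfun set" where
  "base_funs \<A> = {F \<in> gfuns \<A>. \<forall>\<alpha> A m. F \<alpha> A m \<noteq> 0 \<longrightarrow> A = {#}}"

definition linear_funs :: "('i, 'm) graded_bundle \<Rightarrow> gen set \<Rightarrow> ('i, 'm) gfun set" where
  "linear_funs \<A> K = {F \<in> gfuns \<A>. \<forall>\<alpha> A m. F \<alpha> A m \<noteq> 0 \<longrightarrow> (\<exists>z\<in>K. A = {#z#})}"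

text \<open>Sections of the bundles, as functions on \<open>T\<^sup>*[3](A\<^sub>-\<^sub>1 \<oplus> A\<^sub>-\<^sub>2)\<close>: \<open>\<xi>\<^sub>j\<close>, \<open>\<theta>\<^sub>k\<close>, \<open>\<xi>\<^sup>j\<close>, \<open>\<theta>\<^sup>k\<close> are the
  local frames of \<open>A\<^sub>-\<^sub>1\<close>, \<open>A\<^sub>-\<^sub>2\<close>, \<open>A\<^sub>-\<^sub>1\<^sup>*\<close>, \<open>A\<^sub>-\<^sub>2\<^sup>*\<close>. The last two are \<open>\<Gamma>(\<A>[-3])\<close> and \<open>\<Gamma>(\<A>\<^sup>*)\<close>.\<close>

definition \<Gamma>A\<^sub>1 where "\<Gamma>A\<^sub>1 \<A> = linear_funs \<A> (range Xid)"
definition \<Gamma>A\<^sub>2 where "\<Gamma>A\<^sub>2 \<A> = linear_funs \<A> (range Thd)"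
definition \<Gamma>A\<^sub>1_dual where "\<Gamma>A\<^sub>1_dual \<A> = linear_funs \<A> (range Xi)"
definition \<Gamma>A\<^sub>2_dual where "\<Gamma>A\<^sub>2_dual \<A> = linear_funs \<A> (range Th)"
definition \<Gamma>A where "\<Gamma>A \<A> = linear_funs \<A> (range Xid \<union> range Thd)"
definition \<Gamma>A_dual where "\<Gamma>A_dual \<A> = linear_funs \<A> (range Xi \<union> range Th)"


section \<open>Split Lie 2-algebroids\<close>

definition lin_map ::
    "('i, 'm) gfun set \<Rightarrow> ('i, 'm) gfun set \<Rightarrow> (('i, 'm) gfun \<Rightarrow> ('i, 'm) gfun) \<Rightarrow> bool" where
  "lin_map V W f \<longleftrightarrow>
     (\<forall>x\<in>V. f x \<in> W) \<and>
     (\<forall>x\<in>V. \<forall>y\<in>V. f (x + y) = f x + f y) \<and>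
     (\<forall>c. \<forall>x\<in>V. f (gscale c x) = gscale c (f x))"

definition bilin_map where
  "bilin_map U V W f \<longleftrightarrow>
     (\<forall>x\<in>U. lin_map V W (\<lambda>y. f x y)) \<and> (\<forall>y\<in>V. lin_map U W (\<lambda>x. f x y))"

definition trilin_map where
  "trilin_map V W f \<longleftrightarrow>
     (\<forall>x\<in>V. bilin_map V V W (\<lambda>y z. f x y z)) \<and>
     (\<forall>y\<in>V. \<forall>z\<in>V. lin_map V W (\<lambda>x. f x y z))"

definition Lie_2_algebra ::
    "('i, 'm) gfun set \<Rightarrow> ('i, 'm) gfun set \<Rightarrow> (('i, 'm) gfun \<Rightarrow> ('i, 'm) gfun) \<Rightarrow>
     (('i, 'm) gfun \<Rightarrow> ('i, 'm) gfun \<Rightarrow> ('i, 'm) gfun) \<Rightarrow>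
     (('i, 'm) gfun \<Rightarrow> ('i, 'm) gfun \<Rightarrow> ('i, 'm) gfun \<Rightarrow> ('i, 'm) gfun) \<Rightarrow> bool" where
  "Lie_2_algebra V\<^sub>2 V\<^sub>1 d l\<^sub>2 l\<^sub>3 \<longleftrightarrow>
     lin_map V\<^sub>2 V\<^sub>1 d \<and>
     bilin_map V\<^sub>1 V\<^sub>1 V\<^sub>1 l\<^sub>2 \<and> bilin_map V\<^sub>1 V\<^sub>2 V\<^sub>2 l\<^sub>2 \<and> bilin_map V\<^sub>2 V\<^sub>1 V\<^sub>2 l\<^sub>2 \<and>
     trilin_map V\<^sub>1 V\<^sub>2 l\<^sub>3 \<and>
     (\<forall>x\<in>V\<^sub>1. \<forall>y\<in>V\<^sub>1. l\<^sub>2 x y = - l\<^sub>2 y x) \<and>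
     (\<forall>x\<in>V\<^sub>1. \<forall>m\<in>V\<^sub>2. l\<^sub>2 x m = l\<^sub>2 m x) \<and>
     (\<forall>x\<in>V\<^sub>1. \<forall>y\<in>V\<^sub>1. \<forall>z\<in>V\<^sub>1. l\<^sub>3 x y z = - l\<^sub>3 y x z \<and> l\<^sub>3 x y z = - l\<^sub>3 x z y) \<and>
     (\<forall>x\<in>V\<^sub>1. \<forall>m\<in>V\<^sub>2. d (l\<^sub>2 x m) = l\<^sub>2 x (d m)) \<and>
     (\<forall>m\<in>V\<^sub>2. \<forall>n\<in>V\<^sub>2. l\<^sub>2 (d m) n = - l\<^sub>2 m (d n)) \<and>
     (\<forall>x\<in>V\<^sub>1. \<forall>y\<in>V\<^sub>1. \<forall>z\<in>V\<^sub>1.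
        d (l\<^sub>3 x y z) = l\<^sub>2 x (l\<^sub>2 y z) - l\<^sub>2 (l\<^sub>2 x y) z - l\<^sub>2 y (l\<^sub>2 x z)) \<and>
     (\<forall>x\<in>V\<^sub>1. \<forall>y\<in>V\<^sub>1. \<forall>m\<in>V\<^sub>2.
        l\<^sub>3 x y (d m) = l\<^sub>2 x (l\<^sub>2 y m) - l\<^sub>2 (l\<^sub>2 x y) m - l\<^sub>2 y (l\<^sub>2 x m)) \<and>
     (\<forall>x\<in>V\<^sub>1. \<forall>y\<in>V\<^sub>1. \<forall>z\<in>V\<^sub>1. \<forall>w\<in>V\<^sub>1.
        l\<^sub>2 x (l\<^sub>3 y z w) - l\<^sub>2 y (l\<^sub>3 x z w) + l\<^sub>2 z (l\<^sub>3 x y w) - l\<^sub>2 (l\<^sub>3 x y z) w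
        - l\<^sub>3 (l\<^sub>2 x y) z w - l\<^sub>3 y (l\<^sub>2 x z) w - l\<^sub>3 y z (l\<^sub>2 x w)
        + l\<^sub>3 x (l\<^sub>2 y z) w + l\<^sub>3 x z (l\<^sub>2 y w) - l\<^sub>3 x y (l\<^sub>2 z w) = 0)"

text \<open>A bundle map to \<open>TM\<close>, given on sections as a \<open>C\<^sup>\<infinity>(M)\<close>-linear map into the derivations of
  \<open>C\<^sup>\<infinity>(M)\<close>.\<close>

definition anchor_map where
  "anchor_map \<A> V a \<longleftrightarrow>
     bilin_map V (base_funs \<A>) (base_funs \<A>) a \<and>
     (\<forall>X\<in>V. \<forall>f\<in>base_funs \<A>. \<forall>g\<in>base_funs \<A>. a X (f \<odot> g) = a X f \<odot> g + f \<odot> a X g) \<and>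
     (\<forall>X\<in>V. \<forall>f\<in>base_funs \<A>. \<forall>g\<in>base_funs \<A>. a (f \<odot> X) g = f \<odot> a X g)"

text \<open>Here \<open>V\<^sub>1\<close> and \<open>V\<^sub>2\<close> are the sections of the parts of degree \<open>-1\<close> and \<open>-2\<close>.\<close>

definition split_Lie_2_algebroid where
  "split_Lie_2_algebroid \<A> V\<^sub>1 V\<^sub>2 l\<^sub>1 l\<^sub>2 l\<^sub>3 a \<longleftrightarrow>
     Lie_2_algebra V\<^sub>2 V\<^sub>1 l\<^sub>1 l\<^sub>2 l\<^sub>3 \<and>
     anchor_map \<A> V\<^sub>1 a \<and>
     (\<forall>X\<in>V\<^sub>1. \<forall>Y\<in>V\<^sub>1 \<union> V\<^sub>2. \<forall>f\<in>base_funs \<A>. l\<^sub>2 X (f \<odot> Y) = f \<odot> l\<^sub>2 X Y + a X f \<odot> Y) \<and>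
     (\<forall>m\<in>V\<^sub>2. \<forall>f\<in>base_funs \<A>. l\<^sub>1 (f \<odot> m) = f \<odot> l\<^sub>1 m) \<and>
     (\<forall>x\<in>V\<^sub>1. \<forall>y\<in>V\<^sub>1. \<forall>z\<in>V\<^sub>1. \<forall>f\<in>base_funs \<A>. l\<^sub>3 (f \<odot> x) y z = f \<odot> l\<^sub>3 x y z)"

text \<open>\<open>t\<^sub>1\<close>, \<open>t\<^sub>2\<close>, \<open>t\<^sub>3\<close> are the tridegrees of the components of \<open>\<mu>\<close> generating \<open>l\<^sub>1\<close>, \<open>l\<^sub>2\<close>, \<open>l\<^sub>3\<close>.\<close>

definition structure_function where
  "structure_function \<A> V\<^sub>1 V\<^sub>2 t\<^sub>1 t\<^sub>2 t\<^sub>3 l\<^sub>1 l\<^sub>2 l\<^sub>3 a \<mu> \<longleftrightarrow>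
     \<mu> \<in> gfuns \<A> \<and>
     \<mu> = tcomp t\<^sub>1 \<mu> + tcomp t\<^sub>2 \<mu> + tcomp t\<^sub>3 \<mu> \<and>
     big_bracket \<A> \<mu> \<mu> = 0 \<and>
     (\<forall>Y\<in>V\<^sub>2. l\<^sub>1 Y = - big_bracket \<A> (tcomp t\<^sub>1 \<mu>) Y) \<and>
     (\<forall>X\<in>V\<^sub>1. \<forall>Y\<in>V\<^sub>1 \<union> V\<^sub>2. l\<^sub>2 X Y = - big_bracket \<A> (big_bracket \<A> (tcomp t\<^sub>2 \<mu>) X) Y) \<and>
     (\<forall>X\<in>V\<^sub>1. \<forall>Y\<in>V\<^sub>1. \<forall>Z\<in>V\<^sub>1. l\<^sub>3 X Y Z =
        - big_bracket \<A> (big_bracket \<A> (big_bracket \<A> (tcomp t\<^sub>3 \<mu>) X) Y) Z) \<and>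
     (\<forall>X\<in>V\<^sub>1. \<forall>f\<in>base_funs \<A>. a X f = - big_bracket \<A> (big_bracket \<A> (tcomp t\<^sub>2 \<mu>) X) f)"

definition Lie_2_algebroid_on_A where
  "Lie_2_algebroid_on_A \<A> l\<^sub>1 l\<^sub>2 l\<^sub>3 a \<mu> \<longleftrightarrow>
     split_Lie_2_algebroid \<A> (\<Gamma>A\<^sub>1 \<A>) (\<Gamma>A\<^sub>2 \<A>) l\<^sub>1 l\<^sub>2 l\<^sub>3 a \<and>
     structure_function \<A> (\<Gamma>A\<^sub>1 \<A>) (\<Gamma>A\<^sub>2 \<A>) (2, 1, 1) (1, 2, 1) (0, 3, 1) l\<^sub>1 l\<^sub>2 l\<^sub>3 a \<mu>"

text \<open>On \<open>\<A>\<^sup>*[3]\<close> the part of degree \<open>-1\<close> is \<open>A\<^sub>-\<^sub>2\<^sup>*\<close> and the part of degree \<open>-2\<close> is \<open>A\<^sub>-\<^sub>1\<^sup>*\<close>.\<close>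

definition Lie_2_algebroid_on_dual where
  "Lie_2_algebroid_on_dual \<A> l\<^sub>1 l\<^sub>2 l\<^sub>3 a \<gamma> \<longleftrightarrow>
     split_Lie_2_algebroid \<A> (\<Gamma>A\<^sub>2_dual \<A>) (\<Gamma>A\<^sub>1_dual \<A>) l\<^sub>1 l\<^sub>2 l\<^sub>3 a \<and>
     structure_function \<A> (\<Gamma>A\<^sub>2_dual \<A>) (\<Gamma>A\<^sub>1_dual \<A>) (2, 1, 1) (1, 1, 2) (0, 1, 3) l\<^sub>1 l\<^sub>2 l\<^sub>3 a \<gamma>"

definition split_Lie_2_bialgebroid ::
    "('i, 'm) graded_bundle \<Rightarrow> ('i, 'm) gfun \<Rightarrow> ('i, 'm) gfun \<Rightarrow> bool" where
  "split_Lie_2_bialgebroid \<A> \<mu> \<gamma> \<longleftrightarrow>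
     tcomp (2, 1, 1) \<mu> = tcomp (2, 1, 1) \<gamma> \<and>
     big_bracket \<A> (\<mu> + \<gamma> - tcomp (2, 1, 1) \<mu>) (\<mu> + \<gamma> - tcomp (2, 1, 1) \<mu>) = 0"

definition bracket_S ::
    "('i, 'm) graded_bundle \<Rightarrow> ('i, 'm) gfun \<Rightarrow> ('i, 'm) gfun \<Rightarrow> ('i, 'm) gfun \<Rightarrow> ('i, 'm) gfun" where
  "bracket_S \<A> \<mu> F G = - big_bracket \<A> (big_bracket \<A> (tcomp (1, 2, 1) \<mu>) F) G"

definition bracket_S_dual ::
    "('i, 'm) graded_bundle \<Rightarrow> ('i, 'm) gfun \<Rightarrow> ('i, 'm) gfun \<Rightarrow> ('i, 'm) gfun \<Rightarrow> ('i, 'm) gfun" where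
  "bracket_S_dual \<A> \<gamma> F G = - big_bracket \<A> (big_bracket \<A> (tcomp (1, 1, 2) \<gamma>) F) G"

end

theory Submission
  imports Defs "HOL-Computational_Algebra.Polynomial"
begin

text \<open>
  Write \<open>\<mu> = \<mu>\<^sub>1 + \<mu>\<^sub>2 + \<mu>\<^sub>3\<close> and \<open>\<gamma> = \<mu>\<^sub>1 + \<gamma>\<^sub>2 + \<gamma>\<^sub>3\<close> for the decompositions into tridegrees. By \<open>{\<mu>,\<mu>} = {\<gamma>,\<gamma>} = 0\<close>
  and tridegree reasons, \<open>{\<mu>\<^sub>1,\<mu>\<^sub>1}\<close>, \<open>{\<mu>\<^sub>1,\<mu>\<^sub>2}\<close> and \<open>{\<mu>\<^sub>1,\<gamma>\<^sub>2}\<close> vanish, and the bialgebroid equation says that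
  \<open>{\<mu>\<^sub>2,\<gamma>\<^sub>2}\<close>, \<open>{\<mu>\<^sub>2,\<gamma>\<^sub>3}\<close> and \<open>{\<mu>\<^sub>3,\<gamma>\<^sub>2}\<close>, which have different tridegrees, are all zero; equivalently
  \<open>H = {\<gamma>,\<mu>\<^sub>2}\<close> and \<open>K = {\<mu>,\<gamma>\<^sub>2}\<close> are zero. Two applications of the Jacobi identity show that the failure of
  the first derivation identity on \<open>X, Y\<close> is \<open>{{H,X},Y}\<close>, and that of the second one is \<open>{{K,\<alpha>},\<beta>}\<close>.
  It remains to see that \<open>H\<close> vanishes if all \<open>{{H,X},Y}\<close> do (and likewise for \<open>K\<close>): its monomials either contain
  two coordinates dual to the frames of \<open>\<A>\<close>, and are detected by frame sections, or are of the form \<open>p\<^sub>i \<xi>\<^sup>j \<theta>\<^sub>k\<close>,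
  and are detected by taking for \<open>Y\<close> a frame section multiplied by a coordinate which vanishes at the given point.
  The sections have to be global, so the local ones are cut off by bump functions.
\<close>

section \<open>Smooth functions on open subsets of Euclidean space\<close>

text \<open>The Jacobi identity enters with a section as innermost second argument. On a local
  section \<open>fmul f (var z)\<close> the bracket is an explicit operator,
  \<open>linear_ad\<close>, and the identity becomes a statement on its commutators with products
  and with coordinate derivatives, instead of an expansion in three arbitrary functions. Second
  derivatives of f appear there and cancel by symmetry, which is one purpose of the smoothness
  calculus below. Signs depend on parities alone, so local functions are graded modulo 2; the shift
  by 3 turns a parity p into p + 1. Identities are verified in one chart at a time, and the
  transition functions come in when test sections are made global. The coefficients of H are
  recovered at a single point. \<open>linear_ad\<close> differentiates f but not the coefficients of
  the function it acts on, so both brackets can be evaluated at that point alone. The bump function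
  is built to have zero derivative there, which leaves a pure derivative in the dual
  coordinate.\<close>

lemma Euclidean_space_top_of_set: "Euclidean_space n = top_of_set {x. \<forall>i\<ge>n. x i = 0}"
  by (simp add: Euclidean_space_def euclidean_product_topology)

lemma continuous_map_Euclidean_subtopology_iff:
  assumes "V \<subseteq> topspace (Euclidean_space n)"
  shows "continuous_map (subtopology (Euclidean_space n) V) euclideanreal f \<longleftrightarrow> continuous_on V f"
proof -
  have "{x. \<forall>i\<ge>n. x i = (0::real)} \<inter> V = V"
    using assms by (auto simp: topspace_Euclidean_space)
  then show ?thesis
    by (simp add: Euclidean_space_top_of_set subtopology_subtopology)
qed

lemma continuous_on_fun_upd_line: "continuous_on UNIV (\<lambda>t::real. (x::nat \<Rightarrow> real)(i := t))"
proof (rule continuous_on_coordinatewise_then_product)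
  show "continuous_on UNIV (\<lambda>t::real. (x(i := t)) k)" for k
    by (cases "k = i") (auto intro: continuous_intros)
qed

text \<open>The hypothesis \<open>i < n\<close> keeps the line inside the subspace on which all
  coordinates from \<open>n\<close> on vanish; \<open>V\<close> is open only relative to that
  subspace.\<close>

lemma eventually_line_in_open:
  assumes "openin (Euclidean_space n) V" "x \<in> V" "i < n"
  shows "\<forall>\<^sub>F t in nhds (x i). x(i := t) \<in> V"
proof -
  obtain T where T: "open T" "V = {x. \<forall>i\<ge>n. x i = 0} \<inter> T"
    using assms(1) unfolding Euclidean_space_top_of_set openin_open by auto
  have "open ((\<lambda>t. x(i := t)) -` T)"
    using T(1) by (intro open_vimage continuous_on_fun_upd_line)
  moreover have "(\<lambda>t. x(i := t)) -` T = {t. x(i := t) \<in> V}"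
    using assms(2,3) T(2) by auto
  ultimately show ?thesis
    using assms(2) by (auto simp: eventually_nhds intro!: exI[of _ "{t. x(i := t) \<in> V}"])
qed

section \<open>Smoothness as an iterated condition along coordinate lines\<close>

text \<open>One level of the condition that \<open>C_infinity_on\<close> imposes on all iterated
  derivatives. Continuity is a separate clause because derivatives along coordinate lines do not
  imply it.\<close>

definition line_differentiable_on :: "nat \<Rightarrow> (nat \<Rightarrow> real) set \<Rightarrow> ((nat \<Rightarrow> real) \<Rightarrow> real) \<Rightarrow> bool" where
  "line_differentiable_on n V f \<longleftrightarrow> continuous_on V f \<and>
     (\<forall>x\<in>V. \<forall>i<n. (\<lambda>t. f (x(i := t))) differentiable (at (x i)))"

lemma C_infinity_on_iff:
  assumes "openin (Euclidean_space n) V"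
  shows "C_infinity_on n V f \<longleftrightarrow>
    (\<forall>is. set is \<subseteq> {..<n} \<longrightarrow> line_differentiable_on n V (foldr partial is f))"
  using continuous_map_Euclidean_subtopology_iff[OF openin_subset[OF assms]]
  unfolding C_infinity_on_def line_differentiable_on_def by simp

lemma line_differentiable_onD:
  assumes "line_differentiable_on n V f" "x \<in> V" "i < n"
  shows "((\<lambda>t. f (x(i := t))) has_real_derivative partial i f x) (at (x i))"
proof -
  obtain D where "((\<lambda>t. f (x(i := t))) has_real_derivative D) (at (x i))"
    using assms unfolding line_differentiable_on_def by (metis real_differentiable_def)
  then show ?thesis
    unfolding partial_def by (simp add: DERIV_imp_deriv)
qed

lemma line_differentiable_onI:
  assumes "continuous_on V f"
    and "\<And>x i. x \<in> V \<Longrightarrow> i < n \<Longrightarrow> ((\<lambda>t. f (x(i := t))) has_real_derivative D i x) (at (x i))"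
  shows "line_differentiable_on n V f" "\<And>x i. x \<in> V \<Longrightarrow> i < n \<Longrightarrow> partial i f x = D i x"
  using assms unfolding line_differentiable_on_def partial_def
  by (auto simp: real_differentiable_def DERIV_imp_deriv)

lemma partial_cong_open:
  assumes "openin (Euclidean_space n) V" "\<And>x. x \<in> V \<Longrightarrow> f x = g x" "x \<in> V" "i < n"
  shows "partial i f x = partial i g x"
  unfolding partial_def
  using eventually_line_in_open[OF assms(1,3,4)] assms(2)
  by (intro deriv_cong_ev) (auto elim: eventually_mono)

lemma line_differentiable_on_cong:
  assumes V: "openin (Euclidean_space n) V" and eq: "\<And>x. x \<in> V \<Longrightarrow> f x = g x"
    and g: "line_differentiable_on n V g"
  shows "line_differentiable_on n V f"
proof (rule line_differentiable_onI(1))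
  show "continuous_on V f"
    using g eq unfolding line_differentiable_on_def by (metis continuous_on_cong)
  fix x i assume xi: "x \<in> V" "i < n"
  have "\<forall>\<^sub>F t in nhds (x i). g (x(i := t)) = f (x(i := t))"
    using eventually_line_in_open[OF V xi] by eventually_elim (simp add: eq)
  then show "((\<lambda>t. f (x(i := t))) has_real_derivative partial i g x) (at (x i))"
    using line_differentiable_onD[OF g xi] by (subst (asm) DERIV_cong_ev) auto
qed

section \<open>Criteria for smoothness and closure properties\<close>

text \<open>Iterated derivatives never have to be computed: it suffices to exhibit a set that
  contains \<open>f\<close> and is stable under each single derivative. Agreement on
  \<open>V\<close> is enough for stability, because a derivative at a point of the open set
  \<open>V\<close> depends on nearby values only.\<close>

lemma C_infinity_on_coinduct:
  assumes V: "openin (Euclidean_space n) V" and f: "f \<in> S"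
    and diff: "\<And>g. g \<in> S \<Longrightarrow> line_differentiable_on n V g"
    and closed: "\<And>g i. g \<in> S \<Longrightarrow> i < n \<Longrightarrow> \<exists>h\<in>S. \<forall>x\<in>V. partial i g x = h x"
  shows "C_infinity_on n V f"
proof -
  have ex: "\<exists>h\<in>S. \<forall>x\<in>V. foldr partial is f x = h x" if "set is \<subseteq> {..<n}" for "is"
    using that
  proof (induction "is")
    case Nil
    then show ?case using f by auto
  next
    case (Cons i "is")
    then obtain h where h: "h \<in> S" "\<forall>x\<in>V. foldr partial is f x = h x" by auto
    obtain k where "k \<in> S" "\<forall>x\<in>V. partial i h x = k x" using closed[OF h(1), of i] Cons.prems by auto
    then show ?case
      using partial_cong_open[OF V, of "foldr partial is f" h] h(2) Cons.prems by auto
  qed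
  show ?thesis
    unfolding C_infinity_on_iff[OF V]
  proof (intro allI impI)
    fix "is" assume "set is \<subseteq> {..<n}"
    then obtain h where "h \<in> S" "\<forall>x\<in>V. foldr partial is f x = h x" using ex by blast
    then show "line_differentiable_on n V (foldr partial is f)"
      using line_differentiable_on_cong[OF V] diff by simp
  qed
qed

lemma C_infinity_on_imp_line_differentiable:
  assumes "openin (Euclidean_space n) V" "C_infinity_on n V f"
  shows "line_differentiable_on n V f"
  using assms(2) unfolding C_infinity_on_iff[OF assms(1)] by (auto dest: spec[of _ "[]"])

lemma C_infinity_on_partial:
  assumes "C_infinity_on n V f" "i < n"
  shows "C_infinity_on n V (partial i f)"
  unfolding C_infinity_on_def
proof (intro allI impI)
  fix "is" assume "set is \<subseteq> {..<n}"
  then have "set (is @ [i]) \<subseteq> {..<n}" using assms(2) by auto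
  then show "continuous_map (subtopology (Euclidean_space n) V) euclideanreal (foldr partial is (partial i f)) \<and>
    (\<forall>x\<in>V. \<forall>j<n. (\<lambda>t. foldr partial is (partial i f) (x(j := t))) differentiable (at (x j)))"
    using assms(1)[unfolded C_infinity_on_def, rule_format, of "is @ [i]"] by simp
qed

inductive_set algebra_gen :: "('a \<Rightarrow> real) set \<Rightarrow> ('a \<Rightarrow> real) set" for G where
  gen: "f \<in> G \<Longrightarrow> f \<in> algebra_gen G"
| const: "(\<lambda>_. c) \<in> algebra_gen G"
| add: "f \<in> algebra_gen G \<Longrightarrow> g \<in> algebra_gen G \<Longrightarrow> (\<lambda>x. f x + g x) \<in> algebra_gen G"
| mult: "f \<in> algebra_gen G \<Longrightarrow> g \<in> algebra_gen G \<Longrightarrow> (\<lambda>x. f x * g x) \<in> algebra_gen G"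

lemma algebra_gen_sum:
  "finite I \<Longrightarrow> (\<And>i. i \<in> I \<Longrightarrow> f i \<in> algebra_gen G) \<Longrightarrow> (\<lambda>x. \<Sum>i\<in>I. f i x) \<in> algebra_gen G"
proof (induction I rule: finite_induct)
  case empty
  show ?case using algebra_gen.const[of 0] by simp
next
  case (insert i I)
  then have "(\<lambda>x. f i x + (\<Sum>i\<in>I. f i x)) \<in> algebra_gen G"
    by (intro algebra_gen.add) auto
  then show ?case using insert.hyps by simp
qed

text \<open>By the sum and Leibniz rules only the generators have to be differentiated by hand.
  Their derivatives may lie anywhere in the algebra, so \<open>G\<close> itself does not have to be
  stable.\<close>

lemma algebra_gen_C_infinity_on:
  assumes V: "openin (Euclidean_space n) V" and f: "f \<in> algebra_gen G"
    and diff: "\<And>g. g \<in> G \<Longrightarrow> line_differentiable_on n V g"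
    and closed: "\<And>g i. g \<in> G \<Longrightarrow> i < n \<Longrightarrow> \<exists>h\<in>algebra_gen G. \<forall>x\<in>V. partial i g x = h x"
  shows "C_infinity_on n V f"
proof -
  have *: "line_differentiable_on n V g \<and> (\<forall>i<n. \<exists>h\<in>algebra_gen G. \<forall>x\<in>V. partial i g x = h x)"
    if "g \<in> algebra_gen G" for g
    using that
  proof induction
    case (gen f)
    then show ?case using diff closed by auto
  next
    case (const c)
    have l: "line_differentiable_on n V (\<lambda>_. c)" "\<And>x i. x \<in> V \<Longrightarrow> i < n \<Longrightarrow> partial i (\<lambda>_. c) x = 0"
      by (rule line_differentiable_onI[where D = "\<lambda>_ _. 0"]; simp)+
    show ?case
      using l by (intro conjI allI impI bexI[of _ "\<lambda>_. 0"]) (auto intro: algebra_gen.const)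
  next
    case (add f g)
    have c: "continuous_on V (\<lambda>x. f x + g x)"
      using add.IH unfolding line_differentiable_on_def by (auto intro: continuous_intros)
    have d: "((\<lambda>t. f (x(i := t)) + g (x(i := t))) has_real_derivative partial i f x + partial i g x) (at (x i))"
      if "x \<in> V" "i < n" for x i
      using add.IH that line_differentiable_onD by (intro DERIV_add) blast+
    note l = line_differentiable_onI[OF c d]
    show ?case
    proof (intro conjI allI impI)
      fix i assume i: "i < n"
      obtain h k where "h \<in> algebra_gen G" "\<forall>x\<in>V. partial i f x = h x"
         "k \<in> algebra_gen G" "\<forall>x\<in>V. partial i g x = k x" using add.IH i by metis
      then show "\<exists>h\<in>algebra_gen G. \<forall>x\<in>V. partial i (\<lambda>x. f x + g x) x = h x"
        using l(2) i by (intro bexI[of _ "\<lambda>x. h x + k x"]) (auto intro: algebra_gen.intros)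
    qed (use l(1) in simp)
  next
    case (mult f g)
    have c: "continuous_on V (\<lambda>x. f x * g x)"
      using mult.IH unfolding line_differentiable_on_def by (auto intro: continuous_intros)
    have d: "((\<lambda>t. f (x(i := t)) * g (x(i := t))) has_real_derivative
        f x * partial i g x + partial i f x * g x) (at (x i))"
      if "x \<in> V" "i < n" for x i
    proof -
      have "((\<lambda>t. f (x(i := t))) has_real_derivative partial i f x) (at (x i))"
        "((\<lambda>t. g (x(i := t))) has_real_derivative partial i g x) (at (x i))"
        using mult.IH that line_differentiable_onD by blast+
      from DERIV_mult[OF this] show ?thesis by (simp add: algebra_simps)
    qed
    note l = line_differentiable_onI[OF c d]
    show ?case
    proof (intro conjI allI impI)
      fix i assume i: "i < n"
      obtain h k where "h \<in> algebra_gen G" "\<forall>x\<in>V. partial i f x = h x"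
         "k \<in> algebra_gen G" "\<forall>x\<in>V. partial i g x = k x" using mult.IH i by metis
      then show "\<exists>h\<in>algebra_gen G. \<forall>x\<in>V. partial i (\<lambda>x. f x * g x) x = h x"
        using l(2) i mult.hyps
        by (intro bexI[of _ "\<lambda>x. f x * k x + h x * g x"])
          (auto intro: algebra_gen.mult intro!: algebra_gen.add)
    qed (use l(1) in simp)
  qed
  show ?thesis
    using C_infinity_on_coinduct[OF V f] * by blast
qed

lemma C_infinity_on_algebra:
  assumes V: "openin (Euclidean_space n) V" and "f \<in> algebra_gen {f. C_infinity_on n V f}"
  shows "C_infinity_on n V f"
  using assms(2)
  by (rule algebra_gen_C_infinity_on[OF V])
    (auto intro: C_infinity_on_imp_line_differentiable[OF V] C_infinity_on_partial algebra_gen.gen)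

lemma
  assumes V: "openin (Euclidean_space n) V"
  shows C_infinity_on_const: "C_infinity_on n V (\<lambda>_. c)"
    and C_infinity_on_add: "C_infinity_on n V f \<Longrightarrow> C_infinity_on n V g \<Longrightarrow> C_infinity_on n V (\<lambda>x. f x + g x)"
    and C_infinity_on_mult: "C_infinity_on n V f \<Longrightarrow> C_infinity_on n V g \<Longrightarrow> C_infinity_on n V (\<lambda>x. f x * g x)"
    and C_infinity_on_sum: "finite I \<Longrightarrow> (\<And>i. i \<in> I \<Longrightarrow> C_infinity_on n V (h i)) \<Longrightarrow>
      C_infinity_on n V (\<lambda>x. \<Sum>i\<in>I. h i x)"
proof -
  show "C_infinity_on n V (\<lambda>_. c)"
    by (rule C_infinity_on_algebra[OF V algebra_gen.const])
  show "C_infinity_on n V (\<lambda>x. f x + g x)" if "C_infinity_on n V f" "C_infinity_on n V g"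
    using that by (intro C_infinity_on_algebra[OF V] algebra_gen.add algebra_gen.gen) auto
  show "C_infinity_on n V (\<lambda>x. f x * g x)" if "C_infinity_on n V f" "C_infinity_on n V g"
    using that by (intro C_infinity_on_algebra[OF V] algebra_gen.mult algebra_gen.gen) auto
  show "C_infinity_on n V (\<lambda>x. \<Sum>i\<in>I. h i x)"
    if "finite I" "\<And>i. i \<in> I \<Longrightarrow> C_infinity_on n V (h i)"
    using that by (intro C_infinity_on_algebra[OF V] algebra_gen_sum algebra_gen.gen) auto
qed

lemma C_infinity_on_cong:
  assumes V: "openin (Euclidean_space n) V" and "\<And>x. x \<in> V \<Longrightarrow> f x = g x" "C_infinity_on n V g"
  shows "C_infinity_on n V f"
proof (rule C_infinity_on_coinduct[OF V, of _ "{f. \<exists>g. C_infinity_on n V g \<and> (\<forall>x\<in>V. f x = g x)}"])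
  fix g assume "g \<in> {f. \<exists>g. C_infinity_on n V g \<and> (\<forall>x\<in>V. f x = g x)}"
  then obtain h where h: "C_infinity_on n V h" "\<forall>x\<in>V. g x = h x" by auto
  show "line_differentiable_on n V g"
    using line_differentiable_on_cong[OF V] C_infinity_on_imp_line_differentiable[OF V] h by metis
  show "\<exists>h\<in>{f. \<exists>g. C_infinity_on n V g \<and> (\<forall>x\<in>V. f x = g x)}. \<forall>x\<in>V. partial i g x = h x" if "i < n" for i
    using partial_cong_open[OF V, of g h] h C_infinity_on_partial[OF h(1) that] that
    by (intro bexI[of _ "partial i h"]) auto
qed (use assms in auto)

lemma C_infinity_on_local:
  assumes V: "openin (Euclidean_space n) V"
    and loc: "\<And>x. x \<in> V \<Longrightarrow> \<exists>W. openin (Euclidean_space n) W \<and> x \<in> W \<and> W \<subseteq> V \<and> C_infinity_on n W f"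
  shows "C_infinity_on n V f"
  unfolding C_infinity_on_iff[OF V]
proof (intro allI impI)
  fix "is" assume is': "set is \<subseteq> {..<n}"
  have W: "\<exists>W. openin (Euclidean_space n) W \<and> x \<in> W \<and> W \<subseteq> V \<and> line_differentiable_on n W (foldr partial is f)"
    if "x \<in> V" for x using loc[OF that] C_infinity_on_iff is' by metis
  show "line_differentiable_on n V (foldr partial is f)"
    unfolding line_differentiable_on_def
  proof
    have "continuous (at x within V) (foldr partial is f)" if x: "x \<in> V" for x
    proof -
      obtain W where W': "openin (Euclidean_space n) W" "x \<in> W" "W \<subseteq> V"
        "continuous_on W (foldr partial is f)" using W[OF x] unfolding line_differentiable_on_def by auto
      obtain T where T: "open T" "W = {x. \<forall>i\<ge>n. x i = 0} \<inter> T"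
        using W'(1) unfolding Euclidean_space_top_of_set openin_open by auto
      \<comment> \<open>\<open>W\<close> is cut out of \<open>V\<close> by an ambient open set, so
        limits within \<open>V\<close> and within \<open>W\<close> agree.\<close>
      have VT: "V \<inter> T = W" using T W'(3) openin_subset[OF V] by (auto simp: topspace_Euclidean_space)
      have "continuous (at x within W) (foldr partial is f)"
        using W' continuous_on_eq_continuous_within by blast
      moreover have "at x within V = at x within W"
        using T W' VT by (intro at_within_nhd[of _ T]) auto
      ultimately show ?thesis by simp
    qed
    then show "continuous_on V (foldr partial is f)"
      by (simp add: continuous_on_eq_continuous_within)
    show "\<forall>x\<in>V. \<forall>i<n. (\<lambda>t. foldr partial is f (x(i := t))) differentiable (at (x i))"
      using W unfolding line_differentiable_on_def by blast
  qed
qed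

lemma C_infinity_on_coordinate:
  assumes V: "openin (Euclidean_space n) V"
  shows "C_infinity_on n V (\<lambda>x. x j)"
proof (rule algebra_gen_C_infinity_on[OF V, of _ "{\<lambda>x. x j}"])
  have c: "continuous_on V (\<lambda>x. x j)" using continuous_on_product_coordinates[of j] continuous_on_subset by blast
  have d: "((\<lambda>t. (x(i := t)) j) has_real_derivative (if i = j then 1 else 0)) (at (x i))" for x :: "nat \<Rightarrow> real" and i
    by auto
  note l = line_differentiable_onI[of V "\<lambda>x. x j" n "\<lambda>i x. if i = j then 1 else 0", OF c d]
  show "line_differentiable_on n V g" if "g \<in> {\<lambda>x. x j}" for g using l that by auto
  show "\<exists>h\<in>algebra_gen {\<lambda>x. x j}. \<forall>x\<in>V. partial i g x = h x" if "g \<in> {\<lambda>x. x j}" "i < n" for g i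
    using l(2) that by (intro bexI[of _ "\<lambda>_. if i = j then 1 else 0"]) (auto intro: algebra_gen.const)
qed (auto intro: algebra_gen.gen)

text \<open>The chain rule turns the composite of \<phi> \<open>k\<close> with \<open>f\<close> into
  that of \<phi> \<open>(Suc k)\<close> times a derivative of \<open>f\<close>. All these composites
  together with the smooth functions therefore generate an algebra stable under derivatives.\<close>

lemma C_infinity_on_compose:
  fixes \<phi> :: "nat \<Rightarrow> real \<Rightarrow> real"
  assumes V: "openin (Euclidean_space n) V"
    and \<phi>: "\<And>k u. (\<phi> k has_real_derivative \<phi> (Suc k) u) (at u)"
    and f: "C_infinity_on n V f"
  shows "C_infinity_on n V (\<lambda>x. \<phi> 0 (f x))"
proof (rule algebra_gen_C_infinity_on[OF V, of _ "{f. C_infinity_on n V f} \<union> range (\<lambda>k x. \<phi> k (f x))"])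
  let ?G = "{f. C_infinity_on n V f} \<union> range (\<lambda>k x. \<phi> k (f x))"
  have fd: "line_differentiable_on n V f" using C_infinity_on_imp_line_differentiable[OF V f] .
  have c: "continuous_on V (\<lambda>x. \<phi> k (f x))" for k
  proof -
    have "continuous_on UNIV (\<phi> k)"
      using \<phi> DERIV_isCont by (metis continuous_at_imp_continuous_on)
    then show ?thesis
      using fd unfolding line_differentiable_on_def by (auto intro: continuous_on_compose2)
  qed
  have d: "((\<lambda>t. \<phi> k (f (x(i := t)))) has_real_derivative \<phi> (Suc k) (f x) * partial i f x) (at (x i))"
    if "x \<in> V" "i < n" for x i k
    using DERIV_chain2[of "\<phi> k" _ "\<lambda>t. f (x(i := t))" "x i" "partial i f x"] \<phi>
      line_differentiable_onD[OF fd that] by (metis fun_upd_triv)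
  note l = line_differentiable_onI[OF c d]
  show "line_differentiable_on n V g" if "g \<in> ?G" for g
    using that l(1) C_infinity_on_imp_line_differentiable[OF V] by auto
  show "\<exists>h\<in>algebra_gen ?G. \<forall>x\<in>V. partial i g x = h x" if "g \<in> ?G" "i < n" for g i
    using that(1)
  proof
    assume "g \<in> {f. C_infinity_on n V f}"
    then show ?thesis using that(2)
      by (intro bexI[of _ "partial i g"]) (auto intro: algebra_gen.gen C_infinity_on_partial)
  next
    assume "g \<in> range (\<lambda>k x. \<phi> k (f x))"
    then obtain k where "g = (\<lambda>x. \<phi> k (f x))" by auto
    then show ?thesis using that(2) l(2)
      by (intro bexI[of _ "\<lambda>x. \<phi> (Suc k) (f x) * partial i f x"])
        (auto intro!: algebra_gen.mult intro: algebra_gen.gen C_infinity_on_partial[OF f])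
  qed
qed (auto intro: algebra_gen.gen)

section \<open>Symmetry of second partial derivatives\<close>

text \<open>Two applications of the mean value theorem: in direction \<open>i\<close> to the
  increment of \<open>f\<close> in direction \<open>j\<close>, then in direction \<open>j\<close> to
  \<open>partial i f\<close>. The second difference on the left is symmetric in \<open>i\<close> and
  \<open>j\<close>, whereas the derivative on the right is taken in a fixed order; this is the
  source of symmetry.\<close>

lemma mixed_difference_mean_value:
  assumes ij: "i \<noteq> j" "i < n" "j < n" and h: "h > 0"
    and f: "line_differentiable_on n V f" and f': "line_differentiable_on n V (partial i f)"
    and sq: "\<And>s t. s \<in> {x i..x i + h} \<Longrightarrow> t \<in> {x j..x j + h} \<Longrightarrow> x(i := s, j := t) \<in> V"
  shows "\<exists>s\<in>{x i..x i + h}. \<exists>t\<in>{x j..x j + h}.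
     f (x(i := x i + h, j := x j + h)) - f (x(i := x i + h, j := x j))
       - f (x(i := x i, j := x j + h)) + f (x(i := x i, j := x j))
     = h * h * partial j (partial i f) (x(i := s, j := t))"
proof -
  have di: "((\<lambda>s. f (x(i := s, j := t))) has_real_derivative partial i f (x(i := s, j := t))) (at s)"
    if "s \<in> {x i..x i + h}" "t \<in> {x j..x j + h}" for s t
    using line_differentiable_onD[OF f sq[OF that] ij(2)] ij(1) by (simp add: fun_upd_twist[of i j])
  have dj: "((\<lambda>t. partial i f (x(i := s, j := t))) has_real_derivative
      partial j (partial i f) (x(i := s, j := t))) (at t)"
    if "s \<in> {x i..x i + h}" "t \<in> {x j..x j + h}" for s t
    using line_differentiable_onD[OF f' sq[OF that] ij(3)] by simp
  obtain s where s: "x i < s" "s < x i + h" and s_eq: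
    "(f (x(i := x i + h, j := x j + h)) - f (x(i := x i + h, j := x j)))
     - (f (x(i := x i, j := x j + h)) - f (x(i := x i, j := x j)))
     = (x i + h - x i) * (partial i f (x(i := s, j := x j + h)) - partial i f (x(i := s, j := x j)))"
    using MVT2[of "x i" "x i + h" "\<lambda>s. f (x(i := s, j := x j + h)) - f (x(i := s, j := x j))"
      "\<lambda>s. partial i f (x(i := s, j := x j + h)) - partial i f (x(i := s, j := x j))"]
      h DERIV_diff[OF di di] by (auto simp del: fun_upd_triv)
  obtain t where t: "x j < t" "t < x j + h" and t_eq:
    "partial i f (x(i := s, j := x j + h)) - partial i f (x(i := s, j := x j))
     = (x j + h - x j) * partial j (partial i f) (x(i := s, j := t))"
    using MVT2[of "x j" "x j + h" "\<lambda>t. partial i f (x(i := s, j := t))"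
      "\<lambda>t. partial j (partial i f) (x(i := s, j := t))"] h s dj by auto
  show ?thesis
    using s t s_eq t_eq by (intro bexI[of _ s] bexI[of _ t]) (auto simp del: fun_upd_triv)
qed

lemma partial_commute:
  assumes V: "openin (Euclidean_space n) V" and f: "C_infinity_on n V f"
    and x: "x \<in> V" and ij: "i < n" "j < n"
  shows "partial i (partial j f) x = partial j (partial i f) x"
proof (cases "i = j")
  case False
  \<comment> \<open>The coordinate plane through \<open>x\<close> in the directions \<open>i\<close>
    and \<open>j\<close>; continuity of the mixed derivatives is used along this plane.\<close>
  define q where "q = (\<lambda>p::real \<times> real. x(i := fst p, j := snd p))"
  have qc: "continuous_on UNIV q"
  proof (rule continuous_on_coordinatewise_then_product)
    show "continuous_on UNIV (\<lambda>p. q p k)" for k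
      unfolding q_def by (cases "k = i"; cases "k = j") (auto intro: continuous_intros)
  qed
  obtain T where T: "open T" "V = {x. \<forall>i\<ge>n. x i = 0} \<inter> T"
    using V unfolding Euclidean_space_top_of_set openin_open by auto
  have q0: "q (x i, x j) = x" unfolding q_def by simp
  have qV: "q p \<in> V \<longleftrightarrow> q p \<in> T" for p
    using x T ij unfolding q_def by auto
  have Cji: "C_infinity_on n V (partial j (partial i f))" "C_infinity_on n V (partial i (partial j f))"
    using f ij by (auto intro: C_infinity_on_partial)
  have near: "\<forall>\<^sub>F p in nhds (x i, x j). q p \<in> V \<and> \<bar>g (q p) - g x\<bar> < e"
    if g: "C_infinity_on n V g" and e: "e > 0" for g e
  proof -
    have "open (q -` T)" using qc T(1) by (rule open_vimage[rotated])
    moreover have "continuous_on (q -` T) (\<lambda>p. g (q p))"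
    proof (rule continuous_on_compose2[of V g])
      show "continuous_on V g"
        using C_infinity_on_imp_line_differentiable[OF V g] unfolding line_differentiable_on_def by simp
      show "continuous_on (q -` T) q" using qc continuous_on_subset by blast
    qed (use qV in auto)
    ultimately have "isCont (\<lambda>p. g (q p)) (x i, x j)"
      using q0 qV[of "(x i, x j)"] x by (auto simp: continuous_on_eq_continuous_at)
    then have "((\<lambda>p. g (q p)) \<longlongrightarrow> g x) (nhds (x i, x j))"
      using q0 continuous_within_topological[of "(x i, x j)" UNIV]
      by (metis (no_types, lifting) isCont_def tendsto_at_iff_tendsto_nhds)
    then have "\<forall>\<^sub>F p in nhds (x i, x j). \<bar>g (q p) - g x\<bar> < e"
      using e by (auto simp: tendsto_iff dist_real_def)
    moreover have "\<forall>\<^sub>F p in nhds (x i, x j). q p \<in> V"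
      using \<open>open (q -` T)\<close> q0 x qV[of "(x i, x j)"] qV by (auto simp: eventually_nhds intro!: exI[of _ "q -` T"])
    ultimately show ?thesis by eventually_elim simp
  qed
  have "\<bar>partial i (partial j f) x - partial j (partial i f) x\<bar> < e" if e: "e > 0" for e
  proof -
    have "\<forall>\<^sub>F p in nhds (x i, x j). q p \<in> V \<and>
        \<bar>partial j (partial i f) (q p) - partial j (partial i f) x\<bar> < e / 2 \<and>
        \<bar>partial i (partial j f) (q p) - partial i (partial j f) x\<bar> < e / 2"
      using eventually_conj[OF near[OF Cji(1) half_gt_zero[OF e]] near[OF Cji(2) half_gt_zero[OF e]]]
      by eventually_elim simp
    then obtain d where d: "d > 0" and dd: "\<And>p. dist p (x i, x j) < d \<Longrightarrow> q p \<in> V \<and>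
        \<bar>partial j (partial i f) (q p) - partial j (partial i f) x\<bar> < e / 2 \<and>
        \<bar>partial i (partial j f) (q p) - partial i (partial j f) x\<bar> < e / 2"
      unfolding eventually_nhds_metric by auto
    \<comment> \<open>The distance of a point of the square from its corner is at most the sum of
      the two sides, so side \<open>d / 3\<close> keeps the square inside the ball of radius
      \<open>d\<close>.\<close>
    define h where "h = d / 3"
    have h: "h > 0" using d h_def by simp
    have dist: "dist (s, t) (x i, x j) < d" if "s \<in> {x i..x i + h}" "t \<in> {x j..x j + h}" for s t
    proof -
      have "dist (s, t) (x i, x j) \<le> dist s (x i) + dist t (x j)"
        unfolding dist_Pair_Pair by (rule sqrt_sum_squares_le_sum) auto
      also have "\<dots> \<le> h + h" using that by (auto simp: dist_real_def)
      finally show ?thesis using h h_def by simp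
    qed
    note fd = C_infinity_on_imp_line_differentiable[OF V f]
      C_infinity_on_imp_line_differentiable[OF V C_infinity_on_partial[OF f ij(1)]]
      C_infinity_on_imp_line_differentiable[OF V C_infinity_on_partial[OF f ij(2)]]
    have inV: "x(i := s, j := t) \<in> V" if "s \<in> {x i..x i + h}" "t \<in> {x j..x j + h}" for s t
      using dd[OF dist[OF that]] unfolding q_def by simp
    let ?D = "f (x(i := x i + h, j := x j + h)) - f (x(i := x i + h, j := x j))
       - f (x(i := x i, j := x j + h)) + f (x(i := x i, j := x j))"
    obtain s t where st: "s \<in> {x i..x i + h}" "t \<in> {x j..x j + h}"
      and D1: "?D = h * h * partial j (partial i f) (x(i := s, j := t))"
      using mixed_difference_mean_value[OF False ij h fd(1,2) inV] by blast
    have inV': "x(j := t, i := s) \<in> V" if "t \<in> {x j..x j + h}" "s \<in> {x i..x i + h}" for s t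
      using inV[OF that(2,1)] False by (simp add: fun_upd_twist)
    obtain t' s' where st': "t' \<in> {x j..x j + h}" "s' \<in> {x i..x i + h}"
      and D2: "f (x(j := x j + h, i := x i + h)) - f (x(j := x j + h, i := x i))
       - f (x(j := x j, i := x i + h)) + f (x(j := x j, i := x i))
        = h * h * partial i (partial j f) (x(j := t', i := s'))"
      using mixed_difference_mean_value[OF False[symmetric] ij(2,1) h fd(1,3) inV'] by blast
    have "f (x(j := x j + h, i := x i + h)) - f (x(j := x j + h, i := x i))
       - f (x(j := x j, i := x i + h)) + f (x(j := x j, i := x i)) = ?D"
      using False by (simp add: fun_upd_twist del: fun_upd_triv)
    \<comment> \<open>The same second difference has been evaluated in both orders. The mixed
      derivatives thus agree at two points of the square, which may differ, and each value is within
      \<open>e / 2\<close> of the value at \<open>x\<close>.\<close>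
    then have "h * h * partial j (partial i f) (x(i := s, j := t))
        = h * h * partial i (partial j f) (x(i := s', j := t'))"
      using D1 D2 False by (metis fun_upd_twist)
    then have "partial j (partial i f) (q (s, t)) = partial i (partial j f) (q (s', t'))"
      using h unfolding q_def by simp
    then show ?thesis
      using dd[OF dist[OF st]] dd[OF dist[OF st'(2,1)]] by linarith
  qed
  then have "\<bar>partial i (partial j f) x - partial j (partial i f) x\<bar> \<le> 0"
    by (meson le_less_linear less_irrefl)
  then show ?thesis by simp
qed simp

text \<open>Continuity of \<open>B\<close> suffices: \<open>B(y) - B(x) = - B(y) (A(y) - A(x)) B(x)\<close> yields the derivative \<open>- B A' B\<close>,
  so that smoothness follows without determinants.\<close>

lemma C_infinity_on_inverse_matrix:
  fixes A B :: "nat \<Rightarrow> nat \<Rightarrow> (nat \<Rightarrow> real) \<Rightarrow> real"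
  assumes V: "openin (Euclidean_space n) V"
    and A: "\<And>j k. j < r \<Longrightarrow> k < r \<Longrightarrow> C_infinity_on n V (A j k)"
    and B: "\<And>j k. j < r \<Longrightarrow> k < r \<Longrightarrow> continuous_on V (B j k)"
    and AB: "\<And>x j k. x \<in> V \<Longrightarrow> j < r \<Longrightarrow> k < r \<Longrightarrow> (\<Sum>l<r. A j l x * B l k x) = (if j = k then 1 else 0)"
    and BA: "\<And>x j k. x \<in> V \<Longrightarrow> j < r \<Longrightarrow> k < r \<Longrightarrow> (\<Sum>l<r. B j l x * A l k x) = (if j = k then 1 else 0)"
    and jk: "j < r" "k < r"
  shows "C_infinity_on n V (B j k)"
proof (rule algebra_gen_C_infinity_on[OF V,
      of _ "{f. C_infinity_on n V f} \<union> (\<Union>j<r. \<Union>k<r. {B j k})"])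
  let ?G = "{f. C_infinity_on n V f} \<union> (\<Union>j<r. \<Union>k<r. {B j k})"
  have diff: "B j k y - B j k x = - (\<Sum>l<r. \<Sum>m<r. B j l y * (A l m y - A l m x) * B m k x)"
    if "x \<in> V" "y \<in> V" "j < r" "k < r" for x y j k
  proof -
    have "(\<Sum>l<r. \<Sum>m<r. B j l y * A l m y * B m k x) = (\<Sum>m<r. (\<Sum>l<r. B j l y * A l m y) * B m k x)"
      by (subst sum.swap) (simp add: sum_distrib_right)
    also have "\<dots> = (\<Sum>m<r. if j = m then B m k x else 0)"
      using BA[OF that(2,3)] by (intro sum.cong) auto
    also have "\<dots> = B j k x" using that by simp
    finally have 1: "(\<Sum>l<r. \<Sum>m<r. B j l y * A l m y * B m k x) = B j k x" .
    have "(\<Sum>l<r. \<Sum>m<r. B j l y * A l m x * B m k x) = (\<Sum>l<r. B j l y * (\<Sum>m<r. A l m x * B m k x))"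
      by (simp add: sum_distrib_left mult.assoc)
    also have "\<dots> = (\<Sum>l<r. if l = k then B j l y else 0)"
      using AB[OF that(1) _ that(4)] by (intro sum.cong) auto
    also have "\<dots> = B j k y" using that by simp
    finally have 2: "(\<Sum>l<r. \<Sum>m<r. B j l y * A l m x * B m k x) = B j k y" .
    show ?thesis
      using 1 2 by (simp add: algebra_simps sum_subtractf)
  qed
  let ?D = "\<lambda>j k i x. - (\<Sum>l<r. \<Sum>m<r. B j l x * partial i (A l m) x * B m k x)"
  have der: "((\<lambda>t. B j k (x(i := t))) has_real_derivative ?D j k i x) (at (x i))"
    if x: "x \<in> V" and i: "i < n" and jk: "j < r" "k < r" for x i j k
    unfolding has_field_derivative_iff
  proof (rule Lim_transform_eventually)
    have B': "((\<lambda>t. B j l (x(i := t))) \<longlongrightarrow> B j l x) (at (x i))" if l: "l < r" for l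
    proof -
      obtain W where W: "open W" "x i \<in> W" "\<And>t. t \<in> W \<Longrightarrow> x(i := t) \<in> V"
        using eventually_line_in_open[OF V x i] unfolding eventually_nhds by auto
      have "continuous_on W (\<lambda>t. B j l (x(i := t)))"
        using W(3) continuous_on_subset[OF continuous_on_fun_upd_line]
        by (intro continuous_on_compose2[OF B[OF jk(1) l]]) auto
      then show ?thesis
        using W by (simp add: continuous_on_eq_continuous_at isCont_def) (metis fun_upd_triv)
    qed
    have A': "((\<lambda>t. (A l m (x(i := t)) - A l m x) / (t - x i)) \<longlongrightarrow> partial i (A l m) x) (at (x i))"
      if "l < r" "m < r" for l m
      using line_differentiable_onD[OF C_infinity_on_imp_line_differentiable[OF V A[OF that]] x i]
      unfolding has_field_derivative_iff by simp
    show "((\<lambda>t. - (\<Sum>l<r. \<Sum>m<r. B j l (x(i := t)) *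
        ((A l m (x(i := t)) - A l m x) / (t - x i)) * B m k x)) \<longlongrightarrow> ?D j k i x) (at (x i))"
      using A' B' by (intro tendsto_intros) auto
    show "\<forall>\<^sub>F t in at (x i). - (\<Sum>l<r. \<Sum>m<r. B j l (x(i := t)) *
        ((A l m (x(i := t)) - A l m x) / (t - x i)) * B m k x)
        = (B j k (x(i := t)) - B j k (x(i := x i))) / (t - x i)"
      using eventually_line_in_open[OF V x i, THEN filter_leD[OF at_within_le_nhds]]
    proof eventually_elim
      case (elim t)
      show ?case
        using diff[OF x elim jk] by (simp add: sum_divide_distrib)
    qed
  qed
  show "line_differentiable_on n V g" if "g \<in> ?G" for g
    using that
  proof
    assume "g \<in> (\<Union>j<r. \<Union>k<r. {B j k})"
    then obtain j k where "j < r" "k < r" "g = B j k" by auto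
    then show ?thesis using line_differentiable_onI(1)[OF B der] by blast
  qed (auto intro: C_infinity_on_imp_line_differentiable[OF V])
  show "\<exists>h\<in>algebra_gen ?G. \<forall>x\<in>V. partial i g x = h x" if "g \<in> ?G" "i < n" for g i
    using that(1)
  proof
    assume "g \<in> {f. C_infinity_on n V f}"
    then show ?thesis using that(2)
      by (intro bexI[of _ "partial i g"]) (auto intro: algebra_gen.gen C_infinity_on_partial)
  next
    assume "g \<in> (\<Union>j<r. \<Union>k<r. {B j k})"
    then obtain j k where g: "j < r" "k < r" "g = B j k" by auto
    \<comment> \<open>The sign is written as a factor \<open>- 1\<close> because
      \<open>algebra_gen\<close> is closed under constants and products.\<close>
    have pg: "partial i g x = (\<Sum>l<r. \<Sum>m<r. - 1 * (B j l x * partial i (A l m) x * B m k x))" if "x \<in> V" for x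
      using line_differentiable_onI(2)[of V "B j k" n "?D j k"] B der g that \<open>i < n\<close>
      by (simp add: sum_negf)
    have "(\<lambda>x. \<Sum>l<r. \<Sum>m<r. - 1 * (B j l x * partial i (A l m) x * B m k x)) \<in> algebra_gen ?G"
    proof (intro algebra_gen_sum finite_lessThan)
      fix l m assume "l \<in> {..<r}" "m \<in> {..<r}"
      then have "B j l \<in> ?G" "B m k \<in> ?G" "partial i (A l m) \<in> ?G"
        using g that(2) A by (auto intro: C_infinity_on_partial)
      note this[THEN algebra_gen.gen]
      then show "(\<lambda>x. - 1 * (B j l x * partial i (A l m) x * B m k x)) \<in> algebra_gen ?G"
        using algebra_gen.mult[OF algebra_gen.const algebra_gen.mult[OF algebra_gen.mult]] by blast
    qed
    then show ?thesis by (rule bexI[rotated]) (use pg in simp)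
  qed
qed (use jk in \<open>auto intro: algebra_gen.gen\<close>)

text \<open>The functions \<open>p(1/u) exp(-1/u)\<close>, extended by \<open>0\<close>, form a family closed under differentiation.\<close>

definition flat_exp :: "real poly \<Rightarrow> real \<Rightarrow> real" where
  "flat_exp p u = (if u > 0 then poly p (1 / u) * exp (- (1 / u)) else 0)"

lemma tendsto_poly_div_exp_0: "((\<lambda>x::real. poly p x * exp (- x)) \<longlongrightarrow> 0) at_top"
proof -
  have "((\<lambda>x. \<Sum>i\<le>degree p. coeff p i * (x ^ i / exp x)) \<longlongrightarrow> (\<Sum>i\<le>degree p. coeff p i * 0)) at_top"
    by (intro tendsto_intros tendsto_power_div_exp_0)
  then show ?thesis
    by (simp add: poly_altdef exp_minus sum_distrib_right divide_inverse mult.assoc)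
qed

text \<open>With v = 1/u, the derivative of p(v) exp(-v) in u is v^2 (p - p')(v) exp(-v), and
  \<open>[:0, 0, 1:]\<close> is the factor v^2. At 0 the difference quotient from the right is v
  p(v) exp(-v), again a polynomial against an exponential, and tends to 0.\<close>

lemma DERIV_flat_exp:
  "(flat_exp p has_real_derivative flat_exp ([:0, 0, 1:] * (p - pderiv p)) u) (at u)"
proof -
  consider "u > 0" | "u < 0" | "u = 0" by linarith
  then show ?thesis
  proof cases
    case 1
    have "((\<lambda>u. poly p (1 / u) * exp (- (1 / u))) has_real_derivative
        poly p (1 / u) * (exp (- (1 / u)) * (1 / u\<^sup>2)) + poly (pderiv p) (1 / u) * (- (1 / u\<^sup>2)) * exp (- (1 / u))) (at u)"
      using 1 by (auto intro!: derivative_eq_intros DERIV_chain2[OF poly_DERIV] simp: power2_eq_square)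
    moreover have "\<forall>\<^sub>F v in nhds u. flat_exp p v = poly p (1 / v) * exp (- (1 / v))"
      using 1 by (auto simp: eventually_nhds flat_exp_def intro!: exI[of _ "{0<..}"])
    ultimately show ?thesis
      using 1 by (subst DERIV_cong_ev[OF refl _ refl]) (auto simp: flat_exp_def algebra_simps power2_eq_square)
  next
    case 2
    have "\<forall>\<^sub>F v in nhds u. flat_exp p v = 0"
      using 2 by (auto simp: eventually_nhds flat_exp_def intro!: exI[of _ "{..<0}"])
    then show ?thesis
      using 2 by (subst DERIV_cong_ev[OF refl _ refl]) (auto simp: flat_exp_def)
  next
    case 3
    have "((\<lambda>h. poly (pCons 0 p) (inverse h) * exp (- inverse h)) \<longlongrightarrow> 0) (at_right (0::real))"
      using filterlim_compose[OF tendsto_poly_div_exp_0 filterlim_inverse_at_top_right] .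
    then have "((\<lambda>h. flat_exp p h / h) \<longlongrightarrow> 0) (at_right 0)"
      by (rule Lim_transform_eventually)
        (auto simp: eventually_at_filter flat_exp_def field_simps)
    moreover have "((\<lambda>h. flat_exp p h / h) \<longlongrightarrow> 0) (at_left 0)"
      by (rule Lim_transform_eventually[OF tendsto_const])
        (auto simp: eventually_at_filter flat_exp_def)
    ultimately have "((\<lambda>h. flat_exp p h / h) \<longlongrightarrow> 0) (at 0)"
      by (simp add: filterlim_at_split)
    then show ?thesis
      using 3 by (simp add: has_field_derivative_iff flat_exp_def)
  qed
qed

text \<open>Iterating the operator of \<open>DERIV_flat_exp\<close> from the polynomial 1 gives the
  sequence of derivatives that \<open>C_infinity_on_compose\<close> asks for.\<close>

lemma C_infinity_on_flat_exp:
  assumes "openin (Euclidean_space n) V" "C_infinity_on n V f"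
  shows "C_infinity_on n V (\<lambda>x. flat_exp 1 (f x))"
  using C_infinity_on_compose[OF assms(1) _ assms(2),
      of "\<lambda>k. flat_exp (((\<lambda>p. [:0, 0, 1:] * (p - pderiv p)) ^^ k) 1)"] DERIV_flat_exp
  by simp

section \<open>The graded commutative algebra of local functions\<close>

definition mdeg :: "gen multiset \<Rightarrow> nat" where "mdeg A = (\<Sum>z\<in>#A. deg z)"

lemma mdeg_simps [simp]:
  "mdeg {#} = 0" "mdeg (add_mset z A) = deg z + mdeg A" "mdeg (A + B) = mdeg A + mdeg B"
  by (simp_all add: mdeg_def)

lemma koszul_add_left: "koszul (B + C) D = koszul B D * koszul C D"
  by (simp add: koszul_def power_add)

lemma koszul_add_right: "koszul B (C + D) = koszul B C * koszul B D"
  by (simp add: koszul_def power_add sum_mset.distrib)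

lemma koszul_add_mset_left: "koszul (add_mset b B) D = koszul {#b#} D * koszul B D"
  using koszul_add_left[of "{#b#}" B D] by simp

lemma koszul_add_mset_right: "koszul B (add_mset c C) = koszul B {#c#} * koszul B C"
  using koszul_add_right[of B "{#c#}" C] by simp

lemma koszul_empty [simp]: "koszul {#} C = 1" "koszul B {#} = 1"
  by (simp_all add: koszul_def)

lemma koszul_square [simp]: "koszul B C * koszul B C = 1"
  by (simp add: koszul_def flip: power_add)

lemma koszul_square_assoc [simp]: "koszul B C * (koszul B C * x) = x"
  by (simp flip: mult.assoc)

lemma koszul_nonzero [simp]: "koszul B C \<noteq> 0"
  by (simp add: koszul_def)

text \<open>Two distinct odd coordinates, one from each monomial, contribute a sign to exactly one
  of the two factors, according to their order. An odd coordinate common to both would contribute to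
  neither, because the comparison in \<open>koszul\<close> is strict; hence the hypothesis.\<close>

lemma koszul_swap:
  assumes "\<And>z. odd (deg z) \<Longrightarrow> z \<in># B \<Longrightarrow> z \<in># C \<Longrightarrow> False"
  shows "koszul B C * koszul C B = (-1) ^ (mdeg B * mdeg C)"
proof -
  have single: "koszul {#b#} {#c#} * koszul {#c#} {#b#} = (-1) ^ (deg b * deg c)"
    if "odd (deg b) \<Longrightarrow> b \<noteq> c" for b c
    using that by (auto simp: koszul_def minus_one_power_iff)
  have left: "koszul {#b#} C * koszul C {#b#} = (-1) ^ (deg b * mdeg C)"
    if "odd (deg b) \<Longrightarrow> b \<notin># C" for b C
    using that
  proof (induction C)
    case (add c C)
    then have "koszul {#b#} {#c#} * koszul {#c#} {#b#} * (koszul {#b#} C * koszul C {#b#})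
        = (-1) ^ (deg b * deg c) * (-1) ^ (deg b * mdeg C)"
      using single[of b c] by force
    then show ?case
      by (subst koszul_add_mset_left, subst koszul_add_mset_right)
        (simp add: power_add algebra_simps)
  qed simp
  show ?thesis
    using assms
  proof (induction B)
    case (add b B)
    then have "koszul {#b#} C * koszul C {#b#} * (koszul B C * koszul C B)
        = (-1) ^ (deg b * mdeg C) * (-1) ^ (mdeg B * mdeg C)"
      using left[of b C] by force
    then show ?case
      by (subst koszul_add_mset_left, subst koszul_add_mset_right)
        (simp add: power_add algebra_simps)
  qed simp
qed

lemma admissible_single [simp]: "admissible {#z#}"
  by (simp add: admissible_def)

lemma admissible_plusD:
  assumes "admissible (B + C)"
  shows "admissible B" "admissible C" "odd (deg z) \<Longrightarrow> z \<in># B \<Longrightarrow> z \<in># C \<Longrightarrow> False"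
proof -
  have le: "count B z + count C z \<le> 1" if "odd (deg z)" for z
    using assms that unfolding admissible_def by fastforce
  show "admissible B" "admissible C"
    unfolding admissible_def using le by force+
  assume "odd (deg z)" "z \<in># B" "z \<in># C"
  then show False using le[of z] by (simp flip: count_greater_zero_iff)
qed

lemma admissible_add_msetD:
  assumes "admissible (add_mset z A)"
  shows "admissible A" "odd (deg z) \<Longrightarrow> z \<notin># A"
  using admissible_plusD[of "{#z#}" A] assms by auto

lemma admissible_add_mset_iff:
  "admissible (add_mset z A) \<longleftrightarrow> admissible A \<and> (odd (deg z) \<longrightarrow> z \<notin># A)"
proof
  assume r: "admissible A \<and> (odd (deg z) \<longrightarrow> z \<notin># A)"
  show "admissible (add_mset z A)"
    unfolding admissible_def
  proof (intro allI impI)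
    fix w assume "odd (deg w)"
    then show "count (add_mset z A) w \<le> 1"
      using r unfolding admissible_def by (cases "w = z") (auto simp: not_in_iff)
  qed
qed (blast dest: admissible_add_msetD)

section \<open>Decompositions of monomials and associativity of the product\<close>

text \<open>Decompositions are pairs rather than submultisets with their complements, so that
  exchanging the factors of a product and reassociating them become bijections of pairs.\<close>

definition splits :: "gen multiset \<Rightarrow> (gen multiset \<times> gen multiset) set" where
  "splits A = {(B, C). B + C = A}"

lemma sum_splits: "(\<Sum>B | B \<subseteq># A. h B (A - B)) = (\<Sum>(B, C)\<in>splits A. h B C)"
  by (rule sum.reindex_bij_witness[of _ fst "\<lambda>B. (B, A - B)"]) (auto simp: splits_def)

lemma finite_subset_mset: "finite {B. B \<subseteq># (A :: 'a multiset)}"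
proof (induction A)
  case (add z A)
  have "{B. B \<subseteq># add_mset z A} \<subseteq> {B. B \<subseteq># A} \<union> add_mset z ` {B. B \<subseteq># A}"
  proof
    fix B assume "B \<in> {B. B \<subseteq># add_mset z A}"
    then have B: "B \<subseteq># add_mset z A" by simp
    show "B \<in> {B. B \<subseteq># A} \<union> add_mset z ` {B. B \<subseteq># A}"
    proof (cases "z \<in># B")
      case True
      then obtain C where "B = add_mset z C" by (meson multi_member_split)
      then show ?thesis using B by auto
    next
      case False
      have "count B x \<le> count A x" for x
        using mset_subset_eq_count[OF B, of x] False by (cases "x = z") (auto simp: not_in_iff)
      then show ?thesis by (simp add: subseteq_mset_def)
    qed
  qed
  then show ?case using add finite_subset by blast
qed simp

lemma finite_splits [simp]: "finite (splits A)"
proof -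
  have "splits A = (\<lambda>B. (B, A - B)) ` {B. B \<subseteq># A}"
    by (auto simp: splits_def image_iff)
  then show ?thesis by (simp add: finite_subset_mset)
qed

lemma lprod_splits:
  "lprod F G A m = (if admissible A then \<Sum>(B, C)\<in>splits A. koszul B C * F B m * G C m else 0)"
  unfolding lprod_def by (simp add: sum_splits[where h = "\<lambda>B C. koszul B C * F B m * G C m"])

text \<open>The weight discards the pairs whose first component lacks \<open>z\<close>; from the
  others one copy of \<open>z\<close> can be removed. This and its mirror image are the
  combinatorial content of the Leibniz rule, since the exponent of \<open>z\<close> in a product is
  the sum of its exponents in the factors.\<close>

lemma sum_splits_add_mset_left:
  fixes h :: "gen multiset \<Rightarrow> gen multiset \<Rightarrow> real"
  shows "(\<Sum>(B, C)\<in>splits (add_mset z A). real (count B z) * h B C) =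
     (\<Sum>(B, C)\<in>splits A. real (count B z + 1) * h (add_mset z B) C)"
proof -
  have "(\<Sum>(B, C)\<in>splits (add_mset z A). real (count B z) * h B C) =
    (\<Sum>(B, C)\<in>{p \<in> splits (add_mset z A). z \<in># fst p}. real (count B z) * h B C)"
    by (rule sum.mono_neutral_right) (auto simp: not_in_iff)
  also have "\<dots> = (\<Sum>(B, C)\<in>splits A. real (count B z + 1) * h (add_mset z B) C)"
    by (rule sum.reindex_bij_witness[of _ "\<lambda>(B, C). (add_mset z B, C)" "\<lambda>(B, C). (B - {#z#}, C)"])
      (auto simp: splits_def)
  finally show ?thesis .
qed

lemma sum_splits_swap:
  fixes h :: "gen multiset \<Rightarrow> gen multiset \<Rightarrow> real"
  shows "(\<Sum>(B, C)\<in>splits A. h B C) = (\<Sum>(B, C)\<in>splits A. h C B)"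
  by (rule sum.reindex_bij_witness[of _ "\<lambda>(B, C). (C, B)" "\<lambda>(B, C). (C, B)"]) (auto simp: splits_def)

lemma sum_splits_add_mset_right:
  fixes h :: "gen multiset \<Rightarrow> gen multiset \<Rightarrow> real"
  shows "(\<Sum>(B, C)\<in>splits (add_mset z A). real (count C z) * h B C) =
     (\<Sum>(B, C)\<in>splits A. real (count C z + 1) * h B (add_mset z C))"
  using sum_splits_add_mset_left[of z "\<lambda>B C. h C B" A]
  using sum_splits_swap[of "\<lambda>B C. real (count C z) * h B C" "add_mset z A"]
    sum_splits_swap[of "\<lambda>B C. real (count B z + 1) * h C (add_mset z B)" A] by simp

lemma sum_splits_assoc:
  "(\<Sum>(B, C)\<in>splits A. \<Sum>(D, E)\<in>splits B. h D E C) = (\<Sum>(D, X)\<in>splits A. \<Sum>(E, C)\<in>splits X. h D E C)"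
proof -
  have "(\<Sum>(B, C)\<in>splits A. \<Sum>(D, E)\<in>splits B. h D E C)
     = (\<Sum>((B, C), (D, E))\<in>Sigma (splits A) (\<lambda>(B, C). splits B). h D E C)"
    by (subst sum.Sigma[symmetric]) (auto simp: case_prod_beta)
  also have "\<dots> = (\<Sum>((D, X), (E, C))\<in>Sigma (splits A) (\<lambda>(D, X). splits X). h D E C)"
    by (rule sum.reindex_bij_witness[of _ "\<lambda>((D, X), (E, C)). ((D + E, C), (D, E))"
          "\<lambda>((B, C), (D, E)). ((D, E + C), (E, C))"]) (auto simp: splits_def)
  also have "\<dots> = (\<Sum>(D, X)\<in>splits A. \<Sum>(E, C)\<in>splits X. h D E C)"
    by (subst sum.Sigma[symmetric]) (auto simp: case_prod_beta)
  finally show ?thesis .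
qed

lemma lprod_assoc: "lprod (lprod F G) H = lprod F (lprod G H)"
proof (intro ext)
  fix A m
  show "lprod (lprod F G) H A m = lprod F (lprod G H) A m"
  proof (cases "admissible A")
    case True
    \<comment> \<open>The reordering sign of three factors is a product over pairs of factors and
      does not see the bracketing.\<close>
    let ?t = "\<lambda>D E C. koszul D E * koszul D C * koszul E C * F D m * G E m * H C m"
    have "lprod (lprod F G) H A m = (\<Sum>(B, C)\<in>splits A. \<Sum>(D, E)\<in>splits B. ?t D E C)"
      using True unfolding lprod_splits[of "lprod F G"] if_P[OF True]
    proof (intro sum.cong[OF refl], clarify)
      fix B C assume "(B, C) \<in> splits A"
      then have "admissible B" using True by (auto simp: splits_def dest: admissible_plusD)
      then have "koszul B C * lprod F G B m * H C m =
          (\<Sum>(D, E)\<in>splits B. koszul B C * (koszul D E * F D m * G E m) * H C m)"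
        by (simp add: lprod_splits sum_distrib_left sum_distrib_right case_prod_beta)
      also have "\<dots> = (\<Sum>(D, E)\<in>splits B. ?t D E C)"
        by (intro sum.cong) (auto simp: splits_def koszul_add_left mult_ac)
      finally show "koszul B C * lprod F G B m * H C m = (\<Sum>(D, E)\<in>splits B. ?t D E C)" .
    qed
    also have "\<dots> = (\<Sum>(D, X)\<in>splits A. \<Sum>(E, C)\<in>splits X. ?t D E C)"
      by (rule sum_splits_assoc)
    also have "\<dots> = lprod F (lprod G H) A m"
      unfolding lprod_splits[of F] if_P[OF True]
    proof (intro sum.cong[OF refl], clarify)
      fix D X assume "(D, X) \<in> splits A"
      then have "admissible X" using True by (auto simp: splits_def dest: admissible_plusD)
      then have "koszul D X * F D m * lprod G H X m =
          (\<Sum>(E, C)\<in>splits X. koszul D X * F D m * (koszul E C * G E m * H C m))"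
        by (simp add: lprod_splits sum_distrib_left sum_distrib_right case_prod_beta)
      also have "\<dots> = (\<Sum>(E, C)\<in>splits X. ?t D E C)"
        by (intro sum.cong) (auto simp: splits_def koszul_add_right mult_ac)
      finally show "(\<Sum>(E, C)\<in>splits X. ?t D E C) = koszul D X * F D m * lprod G H X m" ..
    qed
    finally show ?thesis .
  qed (simp add: lprod_splits)
qed

section \<open>Parity, graded commutativity and derivatives\<close>

text \<open>Only the parity of the degree is recorded, since Koszul signs see nothing else:
  \<open>graded 4\<close> and \<open>graded 0\<close> coincide, and the zero function is graded for
  every \<open>p\<close>. Support on admissible monomials is included because odd coordinates square
  to zero.\<close>

definition graded :: "nat \<Rightarrow> 'm lfun \<Rightarrow> bool" where
  "graded p F \<longleftrightarrow> (\<forall>A m. F A m \<noteq> 0 \<longrightarrow> admissible A \<and> even (mdeg A + p))"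

definition adm_supported :: "'m lfun \<Rightarrow> bool" where
  "adm_supported F \<longleftrightarrow> (\<forall>A m. F A m \<noteq> 0 \<longrightarrow> admissible A)"

abbreviation lscale :: "real \<Rightarrow> 'm lfun \<Rightarrow> 'm lfun" where "lscale c F \<equiv> fmul (\<lambda>_. c) F"

lemma graded_imp_adm_supported: "graded p F \<Longrightarrow> adm_supported F"
  by (auto simp: graded_def adm_supported_def)

lemma graded_cong: "even (p + q) \<Longrightarrow> graded p F \<Longrightarrow> graded q F"
  unfolding graded_def by (metis even_add)

lemma lprod_commute:
  assumes "graded p F" "graded q G"
  shows "lprod F G = lscale ((-1) ^ (p * q)) (lprod G F)"
proof (intro ext)
  fix A m
  show "lprod F G A m = lscale ((-1) ^ (p * q)) (lprod G F) A m"
  proof (cases "admissible A")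
    case True
    have "koszul B C * F B m * G C m = (-1) ^ (p * q) * (koszul C B * G C m * F B m)"
      if "B + C = A" for B C
    proof (cases "F B m = 0 \<or> G C m = 0")
      case False
      then have "even (mdeg B + p)" "even (mdeg C + q)"
        using assms by (auto simp: graded_def)
      then have "(-1) ^ (p * q) = ((-1) ^ (mdeg B * mdeg C) :: real)"
        by (auto simp: minus_one_power_iff)
      also have "\<dots> = koszul B C * koszul C B"
        using koszul_swap admissible_plusD(3) True that by metis
      finally show ?thesis by (simp add: algebra_simps)
    qed auto
    then have "(\<Sum>(B, C)\<in>splits A. koszul B C * F B m * G C m)
        = (\<Sum>(B, C)\<in>splits A. (-1) ^ (p * q) * (koszul C B * G C m * F B m))"
      by (intro sum.cong) (auto simp: splits_def)
    also have "\<dots> = (-1) ^ (p * q) * (\<Sum>(B, C)\<in>splits A. koszul B C * G B m * F C m)"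
      by (subst sum_splits_swap) (simp add: sum_distrib_left case_prod_beta)
    finally show ?thesis using True by (simp add: lprod_splits fmul_def)
  qed (simp add: lprod_splits fmul_def)
qed

text \<open>A derivative from the right meets \<open>G\<close> first, and the sign arises when it
  passes \<open>G\<close> to reach \<open>F\<close>. If \<open>add_mset z A\<close> is admissible,
  the factor \<open>count A z + 1\<close> is distributed over the two components of each
  decomposition. The delicate case is an odd \<open>z\<close> that already occurs in
  \<open>A\<close>.\<close>

lemma rderiv_lprod:
  assumes F: "adm_supported F" and G: "graded q G"
  shows "rderiv z (lprod F G) = lprod F (rderiv z G) + lscale ((-1) ^ (deg z * q)) (lprod (rderiv z F) G)"
proof (intro ext)
  fix A m
  let ?s = "(-1) ^ (deg z * q) :: real"
  have R: "(lprod F (rderiv z G) + lscale ?s (lprod (rderiv z F) G)) A m =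
     (\<Sum>(B, C)\<in>splits A. koszul B C * koszul C {#z#} * real (count C z + 1) * F B m * G (add_mset z C) m) +
     (\<Sum>(B, C)\<in>splits A. ?s * koszul B C * koszul B {#z#} * real (count B z + 1) * F (add_mset z B) m * G C m)"
    if "admissible A"
    using that by (simp add: lprod_splits fmul_def rderiv_def sum_distrib_left case_prod_beta algebra_simps)
  consider "admissible (add_mset z A)" | "\<not> admissible A"
    | "admissible A" "odd (deg z)" "z \<in># A" "\<not> admissible (add_mset z A)"
    using admissible_add_mset_iff by metis
  then show "rderiv z (lprod F G) A m = (lprod F (rderiv z G) + lscale ?s (lprod (rderiv z F) G)) A m"
  proof cases
    case 1
    let ?h = "\<lambda>B C. koszul A {#z#} * koszul B C * F B m * G C m"
    have cnt: "real (count A z + 1) = real (count B z) + real (count C z)"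
      if "(B, C) \<in> splits (add_mset z A)" for B C
      using that unfolding splits_def by (metis (mono_tags, lifting) Suc_eq_plus1 case_prodD
          count_add_mset count_union mem_Collect_eq of_nat_add)
    have "rderiv z (lprod F G) A m = (\<Sum>(B, C)\<in>splits (add_mset z A). real (count A z + 1) * ?h B C)"
      using 1 unfolding rderiv_def lprod_splits
      by (simp only: if_True sum_distrib_left) (auto intro!: sum.cong simp: mult_ac)
    also have "\<dots> = (\<Sum>(B, C)\<in>splits (add_mset z A). real (count C z) * ?h B C + real (count B z) * ?h B C)"
      by (rule sum.cong[OF refl]) (use cnt in \<open>auto simp: distrib_right[symmetric] add.commute\<close>)
    also have "\<dots> = (\<Sum>(B, C)\<in>splits A. real (count C z + 1) * ?h B (add_mset z C)) +
        (\<Sum>(B, C)\<in>splits A. real (count B z + 1) * ?h (add_mset z B) C)"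
      by (simp only: case_prod_unfold sum.distrib)
        (use sum_splits_add_mset_right[of z ?h A] sum_splits_add_mset_left[of z ?h A]
          in \<open>simp only: case_prod_unfold\<close>)
    also have "(\<Sum>(B, C)\<in>splits A. real (count C z + 1) * ?h B (add_mset z C)) =
       (\<Sum>(B, C)\<in>splits A. koszul B C * koszul C {#z#} * real (count C z + 1) * F B m * G (add_mset z C) m)"
    proof (rule sum.cong[OF refl], clarify)
      fix B C assume "(B, C) \<in> splits A"
      then have A: "A = B + C" by (simp add: splits_def)
      have "koszul A {#z#} * koszul B (add_mset z C) = koszul B C * koszul C {#z#}"
        unfolding A koszul_add_left koszul_add_mset_right[of B z C] by (simp add: mult_ac)
      then show "real (count C z + 1) * ?h B (add_mset z C) =
          koszul B C * koszul C {#z#} * real (count C z + 1) * F B m * G (add_mset z C) m"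
        by (simp add: mult_ac)
    qed
    also have "(\<Sum>(B, C)\<in>splits A. real (count B z + 1) * ?h (add_mset z B) C) =
       (\<Sum>(B, C)\<in>splits A. ?s * koszul B C * koszul B {#z#} * real (count B z + 1) * F (add_mset z B) m * G C m)"
    proof (rule sum.cong[OF refl], clarify)
      fix B C assume BC: "(B, C) \<in> splits A"
      show "real (count B z + 1) * ?h (add_mset z B) C =
        ?s * koszul B C * koszul B {#z#} * real (count B z + 1) * F (add_mset z B) m * G C m"
      proof (cases "G C m = 0")
        case False
        have A: "A = B + C" using BC by (simp add: splits_def)
        have z: "odd (deg z) \<Longrightarrow> z \<notin># C" using 1 A admissible_add_msetD by force
        have "?s = (-1) ^ (deg z * mdeg C)"
          using G False unfolding graded_def by (auto simp: minus_one_power_iff)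
        also have "\<dots> = koszul C {#z#} * koszul {#z#} C"
          using koszul_swap[of "{#z#}" C] z by (auto simp: mult.commute)
        finally have "koszul C {#z#} * koszul {#z#} C = ?s" ..
        then have "koszul A {#z#} * koszul (add_mset z B) C = ?s * koszul B C * koszul B {#z#}"
          unfolding A koszul_add_left koszul_add_mset_left[of z B] by (simp add: mult_ac)
        then show ?thesis by (simp add: mult_ac)
      qed simp
    qed
    finally show ?thesis
      using R admissible_add_msetD(1)[OF 1] by simp
  next
    case 2
    then show ?thesis
      using admissible_add_msetD(1) by (auto simp: rderiv_def lprod_splits fmul_def)
  next
    \<comment> \<open>The left side vanishes because the odd \<open>z\<close> would occur twice. On
      the right, nonzero terms have one \<open>z\<close> in the argument of \<open>F\<close> and one
      in that of \<open>G\<close>; they appear once in each sum, and shifting \<open>z\<close> from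
      one component to the other matches them with opposite signs.\<close>
    case 3
    obtain A' where A': "A = add_mset z A'" using 3 by (meson multi_member_split)
    have z: "z \<notin># A'" using 3 A' admissible_add_msetD by blast
    have F0: "F (add_mset z B) m = 0" if "z \<in># B" for B
      using that F 3(2) admissible_add_msetD unfolding adm_supported_def by blast
    have G0: "G (add_mset z B) m = 0" if "z \<in># B" for B
      using that G 3(2) admissible_add_msetD unfolding graded_def by blast
    let ?h1 = "\<lambda>B C. koszul B C * koszul C {#z#} * F B m * G (add_mset z C) m"
    let ?h2 = "\<lambda>B C. ?s * koszul B C * koszul B {#z#} * F (add_mset z B) m * G C m"
    have cnt: "count B z + count C z = 1" if "(B, C) \<in> splits A" for B C
      using that A' z unfolding splits_def
      by (metis (mono_tags, lifting) One_nat_def case_prodD count_add_mset count_union mem_Collect_eq not_in_iff)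
    have "(\<Sum>(B, C)\<in>splits A. koszul B C * koszul C {#z#} * real (count C z + 1) * F B m * G (add_mset z C) m)
       = (\<Sum>(B, C)\<in>splits A. real (count B z) * ?h1 B C)"
    proof (rule sum.cong[OF refl], clarify)
      fix B C assume "(B, C) \<in> splits A"
      then show "koszul B C * koszul C {#z#} * real (count C z + 1) * F B m * G (add_mset z C) m =
          real (count B z) * ?h1 B C"
        using cnt[of B C] G0[of C] by (cases "z \<in># C") (auto simp: not_in_iff)
    qed
    also have "\<dots> = (\<Sum>(B, C)\<in>splits A'. real (count B z + 1) * ?h1 (add_mset z B) C)"
      unfolding A' by (rule sum_splits_add_mset_left)
    also have "\<dots> = - (\<Sum>(B, C)\<in>splits A'. real (count C z + 1) * ?h2 B (add_mset z C))"
      unfolding sum_negf[symmetric]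
    proof (rule sum.cong[OF refl], clarify)
      fix B C assume BC: "(B, C) \<in> splits A'"
      then have nz: "z \<notin># B" "z \<notin># C" using z by (auto simp: splits_def)
      show "real (count B z + 1) * ?h1 (add_mset z B) C = - (real (count C z + 1) * ?h2 B (add_mset z C))"
      proof (cases "G (add_mset z C) m = 0")
        case False
        then have "?s = - ((-1) ^ (deg z * mdeg C))"
          using G 3(2) unfolding graded_def by (auto simp: minus_one_power_iff)
        also have "\<dots> = - (koszul C {#z#} * koszul {#z#} C)"
          using koszul_swap[of "{#z#}" C] nz by (auto simp: mult.commute)
        finally show ?thesis
          using nz by (simp add: koszul_add_mset_left[of z B] koszul_add_mset_right[of B z C] not_in_iff mult_ac)
      qed simp
    qed
    also have "(\<Sum>(B, C)\<in>splits A'. real (count C z + 1) * ?h2 B (add_mset z C)) =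
       (\<Sum>(B, C)\<in>splits A. real (count C z) * ?h2 B C)"
      unfolding A' by (rule sum_splits_add_mset_right[symmetric])
    also have "\<dots> = (\<Sum>(B, C)\<in>splits A. ?s * koszul B C * koszul B {#z#} * real (count B z + 1) * F (add_mset z B) m * G C m)"
    proof (rule sum.cong[OF refl], clarify)
      fix B C assume "(B, C) \<in> splits A"
      then show "real (count C z) * ?h2 B C =
          ?s * koszul B C * koszul B {#z#} * real (count B z + 1) * F (add_mset z B) m * G C m"
        using cnt[of B C] F0[of B] by (cases "z \<in># B") (auto simp: not_in_iff)
    qed
    finally have "(lprod F (rderiv z G) + lscale ?s (lprod (rderiv z F) G)) A m = 0"
      using R 3(1) by simp
    moreover have "rderiv z (lprod F G) A m = 0"
      using 3(4) by (simp add: rderiv_def lprod_splits)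
    ultimately show ?thesis by simp
  qed
qed

lemma rderiv_commute:
  assumes F: "adm_supported F"
  shows "rderiv a (rderiv b F) = lscale ((-1) ^ (deg a * deg b)) (rderiv b (rderiv a F))"
proof (intro ext)
  fix A m
  show "rderiv a (rderiv b F) A m = lscale ((-1) ^ (deg a * deg b)) (rderiv b (rderiv a F)) A m"
  proof (cases "a = b")
    case True
    have "odd (deg a) \<Longrightarrow> F (add_mset a (add_mset a A)) m = 0"
      using F admissible_add_msetD(2) unfolding adm_supported_def by force
    then show ?thesis
      using True by (auto simp: rderiv_def fmul_def minus_one_power_iff)
  next
    case False
    have "koszul {#a#} {#b#} * koszul {#b#} {#a#} = (-1) ^ (deg a * deg b)"
      using koszul_swap[of "{#a#}" "{#b#}"] False by auto
    then have "koszul {#a#} {#b#} = (-1) ^ (deg a * deg b) * koszul {#b#} {#a#}"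
      by (metis koszul_square mult.assoc mult.right_neutral)
    then show ?thesis
      using False by (simp add: rderiv_def fmul_def koszul_add_mset_left[of a A] koszul_add_mset_left[of b A] add_mset_commute mult_ac)
  qed
qed

text \<open>After removal of \<open>w\<close> the remaining monomial has the parity of
  \<open>q + deg w\<close>, and passing \<open>w\<close> across it costs
  \<open>deg w * (q + deg w)\<close>, which has the parity of the exponent here. Thus one Leibniz
  rule and one commutation rule, those for right derivatives, serve for the whole bracket.\<close>

lemma lderiv_eq_rderiv:
  assumes "graded q G"
  shows "lderiv w G = lscale ((-1) ^ (deg w * (q + 1))) (rderiv w G)"
proof (intro ext)
  fix A m
  show "lderiv w G A m = lscale ((-1) ^ (deg w * (q + 1))) (rderiv w G) A m"
  proof (cases "G (add_mset w A) m = 0")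
    case False
    then have ad: "admissible (add_mset w A)" "even (deg w + mdeg A + q)"
      using assms unfolding graded_def by auto
    have "koszul {#w#} A * koszul A {#w#} = (-1) ^ (deg w * mdeg A)"
      using koszul_swap[of "{#w#}" A] admissible_add_msetD[OF ad(1)] by auto
    also have "\<dots> = (-1) ^ (deg w * (q + 1))"
      using ad(2) by (auto simp: minus_one_power_iff)
    finally have "koszul {#w#} A = (-1) ^ (deg w * (q + 1)) * koszul A {#w#}"
      by (metis koszul_square mult.assoc mult.right_neutral)
    then show ?thesis by (simp add: lderiv_def rderiv_def fmul_def)
  qed (simp add: lderiv_def rderiv_def fmul_def)
qed

lemma rderiv_var: "rderiv w (var z) = (if w = z then lone else 0)"
  by (auto simp: rderiv_def var_def lone_def fun_eq_iff)

lemma lprod_lone_right: "adm_supported F \<Longrightarrow> lprod F lone = F"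
proof (intro ext)
  fix A m assume F: "adm_supported F"
  have "(\<Sum>(B, C)\<in>splits A. koszul B C * F B m * lone C m) = (\<Sum>(B, C)\<in>{(A, {#})}. koszul B C * F B m * lone C m)"
    by (rule sum.mono_neutral_right[OF finite_splits]) (auto simp: splits_def lone_def split: if_splits)
  then show "lprod F lone A m = F A m"
    using F by (auto simp: lprod_splits lone_def adm_supported_def)
qed

lemma lprod_var_right:
  "lprod F (var z) (add_mset z A) m = (if admissible (add_mset z A) then koszul A {#z#} * F A m else 0)"
proof -
  have "(\<Sum>(B, C)\<in>splits (add_mset z A). koszul B C * F B m * var z C m) =
     (\<Sum>(B, C)\<in>{(A, {#z#})}. koszul B C * F B m * var z C m)"
    by (rule sum.mono_neutral_right[OF finite_splits]) (auto simp: splits_def var_def split: if_splits)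
  then show ?thesis by (simp add: lprod_splits var_def)
qed

section \<open>Linearity and parity of the operations\<close>

lemma lprod_add_left: "lprod (F + G) H = lprod F H + lprod G H"
  by (auto simp: lprod_splits fun_eq_iff algebra_simps sum.distrib case_prod_beta)

lemma lprod_add_right: "lprod F (G + H) = lprod F G + lprod F H"
  by (auto simp: lprod_splits fun_eq_iff algebra_simps sum.distrib case_prod_beta)

lemma lprod_fmul_left: "lprod (fmul f F) G = fmul f (lprod F G)"
  by (auto simp: lprod_splits fun_eq_iff fmul_def algebra_simps sum_distrib_left case_prod_beta)

lemma lprod_fmul_right: "lprod F (fmul f G) = fmul f (lprod F G)"
  by (auto simp: lprod_splits fun_eq_iff fmul_def algebra_simps sum_distrib_left case_prod_beta)

lemma lprod_zero [simp]: "lprod 0 G = 0" "lprod F 0 = 0"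
  by (auto simp: lprod_splits fun_eq_iff)

lemma lprod_diff_left: "lprod (F - G) H = lprod F H - lprod G H"
  by (auto simp: lprod_splits fun_eq_iff algebra_simps sum_subtractf case_prod_beta)

lemma lprod_diff_right: "lprod F (G - H) = lprod F G - lprod F H"
  by (auto simp: lprod_splits fun_eq_iff algebra_simps sum_subtractf case_prod_beta)

lemma lprod_sum_left: "lprod (\<Sum>i\<in>I. F i) G = (\<Sum>i\<in>I. lprod (F i) G)"
  by (induction I rule: infinite_finite_induct) (simp_all only: simp_thms not_False_eq_True sum.infinite sum.empty sum.insert lprod_zero lprod_add_left)

lemma lprod_sum_right: "lprod F (\<Sum>i\<in>I. G i) = (\<Sum>i\<in>I. lprod F (G i))"
  by (induction I rule: infinite_finite_induct) (simp_all only: simp_thms not_False_eq_True sum.infinite sum.empty sum.insert lprod_zero lprod_add_right)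

lemma fmul_add: "fmul f (F + G) = fmul f F + fmul f G"
  and fmul_diff: "fmul f (F - G) = fmul f F - fmul f G"
  and fmul_zero [simp]: "fmul f 0 = 0"
  and fmul_fmul: "fmul f (fmul g F) = fmul (\<lambda>m. f m * g m) F"
  by (auto simp: fmul_def fun_eq_iff algebra_simps)

lemma fmul_sum: "fmul f (\<Sum>i\<in>I. F i) = (\<Sum>i\<in>I. fmul f (F i))"
  by (induction I rule: infinite_finite_induct) (simp_all only: simp_thms not_False_eq_True sum.infinite sum.empty sum.insert fmul_zero fmul_add)

lemma rderiv_add: "rderiv z (F + G) = rderiv z F + rderiv z G"
  and rderiv_diff: "rderiv z (F - G) = rderiv z F - rderiv z G"
  and rderiv_zero [simp]: "rderiv z 0 = 0"
  and rderiv_fmul: "rderiv z (fmul f F) = fmul f (rderiv z F)"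
  and lderiv_add: "lderiv z (F + G) = lderiv z F + lderiv z G"
  and lderiv_zero [simp]: "lderiv z 0 = 0"
  by (auto simp: rderiv_def lderiv_def fmul_def fun_eq_iff algebra_simps)

lemma rderiv_sum: "rderiv z (\<Sum>i\<in>I. F i) = (\<Sum>i\<in>I. rderiv z (F i))"
  by (induction I rule: infinite_finite_induct) (simp_all only: simp_thms not_False_eq_True sum.infinite sum.empty sum.insert rderiv_zero rderiv_add)

lemma graded_lprod:
  assumes "graded p F" "graded q G"
  shows "graded (p + q) (lprod F G)"
  unfolding graded_def
proof (intro allI impI)
  fix A m assume nz: "lprod F G A m \<noteq> 0"
  then have ad: "admissible A" by (auto simp: lprod_splits split: if_splits)
  then obtain B C where "(B, C) \<in> splits A" "koszul B C * F B m * G C m \<noteq> 0"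
    using nz by (auto simp: lprod_splits elim: sum.not_neutral_contains_not_neutral)
  then have "mdeg A = mdeg B + mdeg C" "even (mdeg B + p)" "even (mdeg C + q)"
    using assms unfolding graded_def by (force simp: splits_def)+
  then show "admissible A \<and> even (mdeg A + (p + q))"
    using ad by auto
qed

lemma graded_rderiv: "graded p F \<Longrightarrow> graded (p + deg z) (rderiv z F)"
  unfolding graded_def rderiv_def using admissible_add_msetD by fastforce

lemma graded_fmul: "graded p F \<Longrightarrow> graded p (fmul f F)"
  by (auto simp: graded_def fmul_def)

lemma graded_add: "graded p F \<Longrightarrow> graded p G \<Longrightarrow> graded p (F + G)"
  unfolding graded_def by (metis add_0 plus_fun_apply)

lemma graded_diff: "graded p F \<Longrightarrow> graded p G \<Longrightarrow> graded p (F - G)"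
  unfolding graded_def by (metis diff_0_right minus_apply)

lemma graded_zero [simp]: "graded p 0"
  by (simp add: graded_def)

lemma graded_sum: "(\<And>i. i \<in> I \<Longrightarrow> graded p (F i)) \<Longrightarrow> graded p (\<Sum>i\<in>I. F i)"
  by (induction I rule: infinite_finite_induct)
    (simp_all only: simp_thms not_False_eq_True sum.infinite sum.empty sum.insert graded_zero graded_add insert_iff)

lemma graded_var: "graded (deg z) (var z)"
  by (auto simp: graded_def var_def)

section \<open>Smooth coefficients in a chart\<close>

lemma pd_const [simp]: "pd \<A> \<alpha> i (\<lambda>_. c) = (\<lambda>_. 0)"
  by (auto simp: pd_def partial_def comp_def)

lemma pd_zero [simp]: "pd \<A> \<alpha> i 0 = 0"
  using pd_const[of \<A> \<alpha> i 0] by (simp add: zero_fun_def)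

lemma xderiv_zero [simp]: "xderiv \<A> \<alpha> i 0 = 0"
  by (auto simp: xderiv_def)

locale bundle_chart =
  fixes \<A> :: "('i, 'm) graded_bundle" and \<alpha> :: 'i
  assumes gvb: "graded_vector_bundle \<A>" and chart_idx: "\<alpha> \<in> idx \<A>"
begin

abbreviation dom :: "'m set" where "dom \<equiv> cdom \<A> \<alpha>"
abbreviation crd :: "'m \<Rightarrow> nat \<Rightarrow> real" where "crd \<equiv> chart \<A> \<alpha>"
abbreviation inv\<^sub>x :: "(nat \<Rightarrow> real) \<Rightarrow> 'm" where "inv\<^sub>x \<equiv> chart_inv \<A> \<alpha>"
abbreviation img :: "(nat \<Rightarrow> real) set" where "img \<equiv> crd ` dom"
abbreviation E\<^sub>x :: "(nat \<Rightarrow> real) topology" where "E\<^sub>x \<equiv> Euclidean_space (bdim \<A>)"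

abbreviation smooth :: "('m \<Rightarrow> real) \<Rightarrow> bool" where
  "smooth \<equiv> smooth_in \<A> \<alpha> (dom)"

abbreviation dM :: "nat \<Rightarrow> ('m \<Rightarrow> real) \<Rightarrow> 'm \<Rightarrow> real" where
  "dM \<equiv> pd \<A> \<alpha>"

abbreviation dX :: "nat \<Rightarrow> 'm lfun \<Rightarrow> 'm lfun" where
  "dX \<equiv> xderiv \<A> \<alpha>"

abbreviation brk :: "'m lfun \<Rightarrow> 'm lfun \<Rightarrow> 'm lfun" where
  "brk \<equiv> lbracket \<A> \<alpha>"

lemma open_chart_image: "openin (E\<^sub>x) (img)"
  using gvb chart_idx unfolding graded_vector_bundle_def smooth_manifold_def by blast

lemma open_chart_domain: "openin (base \<A>) (dom)"
  using gvb chart_idx unfolding graded_vector_bundle_def smooth_manifold_def by blast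

lemma chart_homeomorphic: "homeomorphic_map (subtopology (base \<A>) (dom))
   (subtopology (E\<^sub>x) (img)) (crd)"
  using gvb chart_idx unfolding graded_vector_bundle_def smooth_manifold_def by blast

lemma topspace_chart_domain: "topspace (subtopology (base \<A>) (dom)) = dom"
  using openin_subset[OF open_chart_domain] by auto

lemma inj_on_chart: "inj_on (crd) (dom)"
  using homeomorphic_imp_injective_map[OF chart_homeomorphic] unfolding topspace_chart_domain .

lemma chart_inv_chart [simp]: "m \<in> dom \<Longrightarrow> inv\<^sub>x (crd m) = m"
  unfolding chart_inv_def by (simp add: inj_on_chart)

lemma smoothD: "smooth f \<Longrightarrow> C_infinity_on (bdim \<A>) (img) (\<lambda>x. f (inv\<^sub>x x))"
  by (simp add: smooth_in_def comp_def)

lemma smoothI: "C_infinity_on (bdim \<A>) (img) (\<lambda>x. f (inv\<^sub>x x)) \<Longrightarrow> smooth f"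
  by (simp add: smooth_in_def comp_def)

lemma smooth_const: "smooth (\<lambda>_. c)"
  by (intro smoothI C_infinity_on_const[OF open_chart_image])

lemma smooth_add: "smooth f \<Longrightarrow> smooth g \<Longrightarrow> smooth (\<lambda>m. f m + g m)"
  by (intro smoothI C_infinity_on_add[OF open_chart_image]) (auto dest: smoothD)

lemma smooth_mult: "smooth f \<Longrightarrow> smooth g \<Longrightarrow> smooth (\<lambda>m. f m * g m)"
  by (intro smoothI C_infinity_on_mult[OF open_chart_image]) (auto dest: smoothD)

lemma smooth_sum: "finite I \<Longrightarrow> (\<And>i. i \<in> I \<Longrightarrow> smooth (f i)) \<Longrightarrow> smooth (\<lambda>m. \<Sum>i\<in>I. f i m)"
  by (intro smoothI C_infinity_on_sum[OF open_chart_image]) (auto dest: smoothD)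

lemma pd_chart_inv:
  "x \<in> img \<Longrightarrow>
    dM i f (inv\<^sub>x x) = partial i (\<lambda>x. f (inv\<^sub>x x)) x"
  by (auto simp: pd_def comp_def)

lemma smooth_pd:
  assumes "smooth f" "i < bdim \<A>"
  shows "smooth (dM i f)"
proof (rule smoothI, rule C_infinity_on_cong[OF open_chart_image])
  show "C_infinity_on (bdim \<A>) (img) (partial i (\<lambda>x. f (inv\<^sub>x x)))"
    using C_infinity_on_partial[OF smoothD[OF assms(1)] assms(2)] .
qed (rule pd_chart_inv)

lemma smooth_has_derivative:
  assumes "smooth f" "i < bdim \<A>" "m \<in> dom"
  shows "((\<lambda>t. f (inv\<^sub>x ((crd m)(i := t)))) has_real_derivative dM i f m)
    (at (crd m i))"
  using line_differentiable_onD[OF C_infinity_on_imp_line_differentiable[OF open_chart_image smoothD[OF assms(1)]],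
      of "crd m" i] assms(2,3)
  by (simp add: pd_def comp_def)

lemma pd_eqI:
  assumes "m \<in> dom"
    and "((\<lambda>t. f (inv\<^sub>x ((crd m)(i := t)))) has_real_derivative D) (at (crd m i))"
  shows "dM i f m = D"
  using assms by (simp add: pd_def partial_def comp_def DERIV_imp_deriv)

lemma pd_outside: "m \<notin> dom \<Longrightarrow> dM i f m = 0"
  by (simp add: pd_def)

lemma pd_add:
  assumes "smooth f" "smooth g" "i < bdim \<A>"
  shows "dM i (\<lambda>m. f m + g m) = (\<lambda>m. dM i f m + dM i g m)"
proof
  fix m show "dM i (\<lambda>m. f m + g m) m = dM i f m + dM i g m"
    using DERIV_add[OF smooth_has_derivative[OF assms(1,3)] smooth_has_derivative[OF assms(2,3)]]
    by (cases "m \<in> dom") (auto intro: pd_eqI simp: pd_outside)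
qed

lemma pd_mult:
  assumes "smooth f" "smooth g" "i < bdim \<A>"
  shows "dM i (\<lambda>m. f m * g m) = (\<lambda>m. dM i f m * g m + f m * dM i g m)"
proof
  fix m show "dM i (\<lambda>m. f m * g m) m = dM i f m * g m + f m * dM i g m"
  proof (cases "m \<in> dom")
    case True
    show ?thesis
      using DERIV_mult[OF smooth_has_derivative[OF assms(1,3) True] smooth_has_derivative[OF assms(2,3) True]] True
      by (intro pd_eqI) (auto simp: algebra_simps)
  qed (simp add: pd_outside)
qed

lemma pd_cmult:
  assumes "smooth f" "i < bdim \<A>"
  shows "dM i (\<lambda>m. c * f m) = (\<lambda>m. c * dM i f m)"
  using pd_mult[OF smooth_const assms, of c] by simp

lemma pd_commute:
  assumes "smooth f" "i < bdim \<A>" "j < bdim \<A>"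
  shows "dM i (dM j f) = dM j (dM i f)"
proof
  fix m show "dM i (dM j f) m = dM j (dM i f) m"
  proof (cases "m \<in> dom")
    case True
    let ?g = "\<lambda>x. f (inv\<^sub>x x)"
    have "dM i (dM j f) m = partial i (partial j ?g) (crd m)"
      if "i < bdim \<A>" for i j
      using True that partial_cong_open[OF open_chart_image pd_chart_inv[of _ j f]]
      by (simp add: pd_def[of _ _ i] comp_def)
    then show ?thesis
      using partial_commute[OF open_chart_image smoothD[OF assms(1)]] True assms by simp
  qed (simp add: pd_outside)
qed

section \<open>Local functions with smooth coefficients\<close>

definition coef_smooth :: "'m lfun \<Rightarrow> bool" where
  "coef_smooth F \<longleftrightarrow> (\<forall>A. smooth (F A))"

lemma coef_smooth_zero [simp]: "coef_smooth 0"
  unfolding coef_smooth_def using smooth_const[of 0] by (simp add: zero_fun_def)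

lemma coef_smooth_add: "coef_smooth F \<Longrightarrow> coef_smooth G \<Longrightarrow> coef_smooth (F + G)"
  unfolding coef_smooth_def plus_fun_def by (auto intro: smooth_add)

lemma coef_smooth_fmul: "smooth f \<Longrightarrow> coef_smooth F \<Longrightarrow> coef_smooth (fmul f F)"
  unfolding coef_smooth_def fmul_def by (auto intro: smooth_mult)

lemma coef_smooth_diff:
  assumes "coef_smooth F" "coef_smooth G" shows "coef_smooth (F - G)"
proof -
  have "F - G = F + lscale (-1) G" by (simp add: fmul_def fun_eq_iff)
  then show ?thesis using assms by (simp only: coef_smooth_add coef_smooth_fmul smooth_const)
qed

lemma coef_smooth_sum: "(\<And>i. i \<in> I \<Longrightarrow> coef_smooth (F i)) \<Longrightarrow> coef_smooth (\<Sum>i\<in>I. F i)"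
  by (induction I rule: infinite_finite_induct)
    (simp_all only: simp_thms not_False_eq_True sum.infinite sum.empty sum.insert coef_smooth_zero
      coef_smooth_add insert_iff)

lemma coef_smooth_rderiv: "coef_smooth F \<Longrightarrow> coef_smooth (rderiv z F)"
  unfolding coef_smooth_def rderiv_def by (auto intro!: smooth_mult smooth_const)

lemma coef_smooth_lderiv: "coef_smooth F \<Longrightarrow> coef_smooth (lderiv z F)"
  unfolding coef_smooth_def lderiv_def by (auto intro!: smooth_mult smooth_const)

lemma coef_smooth_xderiv: "coef_smooth F \<Longrightarrow> i < bdim \<A> \<Longrightarrow> coef_smooth (dX i F)"
  unfolding coef_smooth_def xderiv_def by (auto intro: smooth_pd)

lemma coef_smooth_lprod:
  assumes "coef_smooth F" "coef_smooth G" shows "coef_smooth (lprod F G)"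
  unfolding coef_smooth_def
proof
  fix A
  have "smooth (\<lambda>m. \<Sum>p\<in>splits A. koszul (fst p) (snd p) * F (fst p) m * G (snd p) m)"
    using assms unfolding coef_smooth_def by (intro smooth_sum smooth_mult smooth_const) auto
  moreover have "lprod F G A = (if admissible A then
      \<lambda>m. \<Sum>p\<in>splits A. koszul (fst p) (snd p) * F (fst p) m * G (snd p) m else (\<lambda>_. 0))"
    by (auto simp: lprod_splits case_prod_unfold fun_eq_iff)
  ultimately show "smooth (lprod F G A)" by (simp add: smooth_const)
qed

lemma coef_smooth_var: "coef_smooth (var z)"
  unfolding coef_smooth_def var_def by (auto intro: smooth_const)

lemma xderiv_add:
  "coef_smooth F \<Longrightarrow> coef_smooth G \<Longrightarrow> i < bdim \<A> \<Longrightarrow>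
    dX i (F + G) = dX i F + dX i G"
  unfolding coef_smooth_def xderiv_def plus_fun_def by (auto simp: pd_add fun_eq_iff)

lemma xderiv_fmul:
  "smooth f \<Longrightarrow> coef_smooth F \<Longrightarrow> i < bdim \<A> \<Longrightarrow>
    dX i (fmul f F) = fmul (dM i f) F + fmul f (dX i F)"
  unfolding coef_smooth_def xderiv_def fmul_def plus_fun_def by (auto simp: pd_mult fun_eq_iff)

lemma xderiv_lscale:
  "coef_smooth F \<Longrightarrow> i < bdim \<A> \<Longrightarrow> dX i (lscale c F) = lscale c (dX i F)"
  unfolding coef_smooth_def xderiv_def fmul_def by (auto simp: pd_cmult fun_eq_iff)

lemma xderiv_diff:
  assumes "coef_smooth F" "coef_smooth G" "i < bdim \<A>"
  shows "dX i (F - G) = dX i F - dX i G"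
proof -
  have "F - G = F + lscale (-1) G" by (simp add: fmul_def fun_eq_iff)
  then have "dX i (F - G) = dX i F + lscale (-1) (dX i G)"
    using assms by (simp only: xderiv_add xderiv_lscale coef_smooth_fmul smooth_const)
  then show ?thesis by (auto simp: fmul_def fun_eq_iff)
qed

lemma xderiv_sum:
  "(\<And>j. j \<in> J \<Longrightarrow> coef_smooth (F j)) \<Longrightarrow> i < bdim \<A> \<Longrightarrow>
    dX i (\<Sum>j\<in>J. F j) = (\<Sum>j\<in>J. dX i (F j))"
  by (induction J rule: infinite_finite_induct)
    (simp_all only: simp_thms not_False_eq_True sum.infinite sum.empty sum.insert xderiv_zero
      xderiv_add coef_smooth_sum insert_iff)

lemma xderiv_rderiv:
  "coef_smooth F \<Longrightarrow> i < bdim \<A> \<Longrightarrow> dX i (rderiv z F) = rderiv z (dX i F)"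
  unfolding coef_smooth_def xderiv_def rderiv_def by (auto simp: pd_cmult fun_eq_iff)

lemma lprod_var_right_notin: "z \<notin># A \<Longrightarrow> lprod F (var z) A m = 0"
  unfolding lprod_splits by (auto simp: splits_def var_def split: if_splits intro!: sum.neutral)

text \<open>Multiplication by a coordinate moves each coefficient to another monomial with a
  constant factor, and \<open>dX\<close> acts on the coefficients only.\<close>

lemma xderiv_lprod_var:
  assumes F: "coef_smooth F" and i: "i < bdim \<A>"
  shows "dX i (lprod F (var z)) = lprod (dX i F) (var z)"
proof
  fix A
  show "dX i (lprod F (var z)) A = lprod (dX i F) (var z) A"
  proof (cases "z \<in># A")
    case True
    then obtain B where A: "A = add_mset z B" by (meson multi_member_split)
    define c where "c = (if admissible A then koszul B {#z#} else 0)"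
    have "lprod F (var z) A = (\<lambda>m. c * F B m)" for F :: "'m lfun"
      unfolding A c_def by (auto simp: lprod_var_right fun_eq_iff)
    then show ?thesis
      using F i unfolding xderiv_def coef_smooth_def by (simp add: pd_cmult)
  next
    case False
    then have "lprod F (var z) A = (\<lambda>_. 0)" for F :: "'m lfun" by (auto simp: lprod_var_right_notin)
    then show ?thesis unfolding xderiv_def by simp
  qed
qed

text \<open>A derivative at one point sees nearby values, but \<open>graded\<close> speaks about all
  points at once: a forbidden coefficient is identically zero, and so is its derivative.\<close>

lemma graded_xderiv:
  assumes "graded p F" shows "graded p (dX i F)"
proof -
  have "F A = (\<lambda>_. 0)" if "\<not> (admissible A \<and> even (mdeg A + p))" for A
    using assms that unfolding graded_def by (intro ext) blast
  then show ?thesis unfolding graded_def xderiv_def by fastforce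
qed

lemma adm_supported_xderiv:
  assumes "adm_supported F" shows "adm_supported (dX i F)"
proof -
  have "F A = (\<lambda>_. 0)" if "\<not> admissible A" for A
    using assms that unfolding adm_supported_def by auto
  then show ?thesis unfolding adm_supported_def xderiv_def by fastforce
qed

end

section \<open>The big bracket in a chart\<close>

text \<open>The partner in a Darboux pair. The partner of \<open>P i\<close> is a base coordinate,
  which is not a \<open>gen\<close>; the value there is a convention that keeps the map an
  involution, and \<open>fibre_gens\<close> leaves the \<open>P i\<close> out.\<close>

primrec dual_gen :: "gen \<Rightarrow> gen" where
  "dual_gen (Xi j) = Xid j"
| "dual_gen (Th k) = Thd k"
| "dual_gen (P i) = P i"
| "dual_gen (Xid j) = Xi j"
| "dual_gen (Thd k) = Th k"

text \<open>The value of the coordinate bracket of \<open>dual_gen w\<close> with \<open>w\<close>.\<close>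

primrec pair_sign :: "gen \<Rightarrow> real" where
  "pair_sign (Xi j) = -1"
| "pair_sign (Th k) = 1"
| "pair_sign (P i) = 0"
| "pair_sign (Xid j) = 1"
| "pair_sign (Thd k) = -1"

definition fibre_gens :: "('i, 'm) graded_bundle \<Rightarrow> gen set" where
  "fibre_gens \<A> = Xi ` {..<rk\<^sub>1 \<A>} \<union> Th ` {..<rk\<^sub>2 \<A>} \<union> Xid ` {..<rk\<^sub>1 \<A>} \<union> Thd ` {..<rk\<^sub>2 \<A>}"

lemma finite_fibre_gens [simp]: "finite (fibre_gens \<A>)"
  by (simp add: fibre_gens_def)

lemma dual_gen_dual_gen [simp]: "dual_gen (dual_gen w) = w"
  by (cases w) auto

lemma dual_gen_fibre_gens_iff [simp]: "dual_gen w \<in> fibre_gens \<A> \<longleftrightarrow> w \<in> fibre_gens \<A>"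
  by (cases w) (auto simp: fibre_gens_def)

lemma P_notin_fibre_gens [simp]: "P i \<notin> fibre_gens \<A>"
  by (auto simp: fibre_gens_def)

lemma pair_sign_dual_gen: "w \<in> fibre_gens \<A> \<Longrightarrow> pair_sign (dual_gen w) = - pair_sign w"
  by (auto simp: fibre_gens_def)

lemma even_deg_dual_gen: "w \<in> fibre_gens \<A> \<Longrightarrow> even (deg (dual_gen w)) \<longleftrightarrow> odd (deg w)"
  by (auto simp: fibre_gens_def)

lemma sum_lfun_apply: "(\<Sum>i\<in>I. F i) A m = (\<Sum>i\<in>I. (F i :: 'm lfun) A m)"
  by (induction I rule: infinite_finite_induct) auto

lemma fmul_apply: "fmul f F A m = f m * F A m"
  by (simp add: fmul_def)

text \<open>A single sum over fibre coordinates, with the signs of the coordinate brackets stored in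
  \<open>pair_sign\<close>, makes the later sign computations uniform in \<open>w\<close>. The pairs
  of a base coordinate and a momentum stay apart because one partner acts on coefficients.\<close>

lemma lbracket_fibre_gens:
  "lbracket \<A> \<alpha> F G =
     (\<Sum>w\<in>fibre_gens \<A>. lscale (pair_sign w) (lprod (rderiv (dual_gen w) F) (lderiv w G))) +
     (\<Sum>i<bdim \<A>. lprod (xderiv \<A> \<alpha> i F) (lderiv (P i) G) - lprod (rderiv (P i) F) (xderiv \<A> \<alpha> i G))"
proof (intro ext)
  fix A m
  let ?t = "\<lambda>w. pair_sign w * lprod (rderiv (dual_gen w) F) (lderiv w G) A m"
  have "(\<Sum>w\<in>fibre_gens \<A>. ?t w) =
     (\<Sum>w\<in>Xi ` {..<rk\<^sub>1 \<A>}. ?t w) + (\<Sum>w\<in>Th ` {..<rk\<^sub>2 \<A>}. ?t w)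
     + (\<Sum>w\<in>Xid ` {..<rk\<^sub>1 \<A>}. ?t w) + (\<Sum>w\<in>Thd ` {..<rk\<^sub>2 \<A>}. ?t w)"
    unfolding fibre_gens_def by (subst sum.union_disjoint; auto)+
  also have "\<dots> = (\<Sum>j<rk\<^sub>1 \<A>. ?t (Xi j)) + (\<Sum>k<rk\<^sub>2 \<A>. ?t (Th k)) + (\<Sum>j<rk\<^sub>1 \<A>. ?t (Xid j)) + (\<Sum>k<rk\<^sub>2 \<A>. ?t (Thd k))"
    by (subst sum.reindex; simp add: inj_on_def)+
  finally show "lbracket \<A> \<alpha> F G A m = ((\<Sum>w\<in>fibre_gens \<A>. lscale (pair_sign w) (lprod (rderiv (dual_gen w) F) (lderiv w G))) +
     (\<Sum>i<bdim \<A>. lprod (xderiv \<A> \<alpha> i F) (lderiv (P i) G) - lprod (rderiv (P i) F) (xderiv \<A> \<alpha> i G))) A m"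
    unfolding lbracket_def
    by (simp add: sum_lfun_apply fmul_apply sum_subtractf sum_negf algebra_simps)
qed

lemma adm_supported_rderiv: "adm_supported F \<Longrightarrow> adm_supported (rderiv z F)"
  unfolding adm_supported_def rderiv_def using admissible_add_msetD by fastforce

lemma adm_supported_lprod: "adm_supported (lprod F G)"
  unfolding adm_supported_def lprod_splits by auto

lemma adm_supported_add: "adm_supported F \<Longrightarrow> adm_supported G \<Longrightarrow> adm_supported (F + G)"
  unfolding adm_supported_def by (metis add_0 plus_fun_apply)

lemma adm_supported_diff: "adm_supported F \<Longrightarrow> adm_supported G \<Longrightarrow> adm_supported (F - G)"
  unfolding adm_supported_def by (metis diff_0_right minus_apply)

lemma adm_supported_fmul: "adm_supported F \<Longrightarrow> adm_supported (fmul f F)"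
  by (auto simp: adm_supported_def fmul_def)

lemma adm_supported_sum: "(\<And>i. i \<in> I \<Longrightarrow> adm_supported (F i)) \<Longrightarrow> adm_supported (\<Sum>i\<in>I. F i)"
  unfolding adm_supported_def sum_lfun_apply by (meson sum.neutral)

lemma adm_supported_lbracket: "adm_supported (lbracket \<A> \<alpha> F G)"
  unfolding lbracket_fibre_gens
  by (intro adm_supported_add adm_supported_sum adm_supported_fmul adm_supported_diff adm_supported_lprod)

lemma lbracket_zero [simp]: "lbracket \<A> \<alpha> 0 G = 0" "lbracket \<A> \<alpha> F 0 = 0"
  unfolding lbracket_fibre_gens
  by (simp_all only: rderiv_zero lderiv_zero xderiv_zero lprod_zero fmul_zero sum.neutral_const diff_self add_0)

context bundle_chart
begin

section \<open>Parity, bilinearity and antisymmetry of the bracket\<close>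

lemma lbracket_graded:
  assumes G: "graded q G"
  shows "brk F G =
     (\<Sum>w\<in>fibre_gens \<A>. lscale (pair_sign w * (-1) ^ (deg w * (q + 1))) (lprod (rderiv (dual_gen w) F) (rderiv w G))) +
     (\<Sum>i<bdim \<A>. lscale ((-1) ^ (q + 1)) (lprod (dX i F) (rderiv (P i) G))
        - lprod (rderiv (P i) F) (dX i G))"
proof -
  have 3: "(-1::real) ^ (3 * (q + 1)) = (-1) ^ (q + 1)" by (simp add: minus_one_power_iff)
  show ?thesis
    unfolding lbracket_fibre_gens lderiv_eq_rderiv[OF G] lprod_fmul_right fmul_fmul deg.simps 3 ..
qed

lemma graded_lbracket:
  assumes F: "graded p F" and G: "graded q G"
  shows "graded (p + q + 1) (brk F G)"
  unfolding lbracket_graded[OF G]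
proof (intro graded_add graded_sum graded_diff graded_fmul)
  fix w assume "w \<in> fibre_gens \<A>"
  then show "graded (p + q + 1) (lprod (rderiv (dual_gen w) F) (rderiv w G))"
    using graded_lprod[OF graded_rderiv[OF F] graded_rderiv[OF G], of "dual_gen w" w] even_deg_dual_gen[of w \<A>]
    by (auto elim!: graded_cong[rotated])
next
  fix i
  show "graded (p + q + 1) (lprod (dX i F) (rderiv (P i) G))"
    using graded_lprod[OF graded_xderiv[OF F, of i] graded_rderiv[OF G, of "P i"]]
    by (auto elim!: graded_cong[rotated])
  show "graded (p + q + 1) (lprod (rderiv (P i) F) (dX i G))"
    using graded_lprod[OF graded_rderiv[OF F, of "P i"] graded_xderiv[OF G, of i]]
    by (auto elim!: graded_cong[rotated])
qed

lemma coef_smooth_lbracket: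
  assumes "coef_smooth F" "coef_smooth G"
  shows "coef_smooth (brk F G)"
  unfolding lbracket_fibre_gens
  using assms
  by (intro coef_smooth_add coef_smooth_sum coef_smooth_diff coef_smooth_fmul smooth_const coef_smooth_lprod
      coef_smooth_rderiv coef_smooth_lderiv coef_smooth_xderiv) auto

lemma lbracket_add_left:
  assumes "coef_smooth F" "coef_smooth G"
  shows "brk (F + G) H = brk F H + brk G H"
proof -
  have "(\<Sum>i<bdim \<A>. lprod (dX i (F + G)) (lderiv (P i) H) - lprod (rderiv (P i) (F + G)) (dX i H)) =
     (\<Sum>i<bdim \<A>. (lprod (dX i F) (lderiv (P i) H) - lprod (rderiv (P i) F) (dX i H)) +
        (lprod (dX i G) (lderiv (P i) H) - lprod (rderiv (P i) G) (dX i H)))"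
    by (rule sum.cong[OF refl])
      (simp add: xderiv_add[OF assms] rderiv_add lprod_add_left algebra_simps del: plus_fun_apply)
  then show ?thesis
    unfolding lbracket_fibre_gens
    by (simp only: rderiv_add lprod_add_left fmul_add sum.distrib) (simp only: ac_simps)
qed

lemma lbracket_add_right:
  assumes "coef_smooth G" "coef_smooth H"
  shows "brk F (G + H) = brk F G + brk F H"
proof -
  have "(\<Sum>i<bdim \<A>. lprod (dX i F) (lderiv (P i) (G + H)) - lprod (rderiv (P i) F) (dX i (G + H))) =
     (\<Sum>i<bdim \<A>. (lprod (dX i F) (lderiv (P i) G) - lprod (rderiv (P i) F) (dX i G)) +
        (lprod (dX i F) (lderiv (P i) H) - lprod (rderiv (P i) F) (dX i H)))"
    by (rule sum.cong[OF refl])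
      (simp add: xderiv_add[OF assms] lderiv_add lprod_add_right algebra_simps del: plus_fun_apply)
  then show ?thesis
    unfolding lbracket_fibre_gens
    by (simp only: lderiv_add lprod_add_right fmul_add sum.distrib) (simp only: ac_simps)
qed

lemma lbracket_lscale_right:
  assumes "coef_smooth G"
  shows "brk F (lscale c G) = lscale c (brk F G)"
proof -
  have l: "lderiv w (lscale c G) = lscale c (lderiv w G)" for w
    by (simp add: lderiv_def fmul_def fun_eq_iff)
  have "(\<Sum>i<bdim \<A>. lprod (dX i F) (lderiv (P i) (lscale c G)) - lprod (rderiv (P i) F) (dX i (lscale c G))) =
     (\<Sum>i<bdim \<A>. lscale c (lprod (dX i F) (lderiv (P i) G) - lprod (rderiv (P i) F) (dX i G)))"
    by (rule sum.cong[OF refl])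
      (simp add: xderiv_lscale[OF assms] l lprod_fmul_right fmul_diff)
  then show ?thesis
    unfolding lbracket_fibre_gens
    by (simp only: l lprod_fmul_right fmul_add fmul_sum fmul_fmul mult.commute[of c])
qed

lemma lbracket_lscale_left:
  assumes "coef_smooth F"
  shows "brk (lscale c F) G = lscale c (brk F G)"
proof -
  have "(\<Sum>i<bdim \<A>. lprod (dX i (lscale c F)) (lderiv (P i) G) - lprod (rderiv (P i) (lscale c F)) (dX i G)) =
     (\<Sum>i<bdim \<A>. lscale c (lprod (dX i F) (lderiv (P i) G) - lprod (rderiv (P i) F) (dX i G)))"
    by (rule sum.cong[OF refl])
      (simp add: xderiv_lscale[OF assms] rderiv_fmul lprod_fmul_left fmul_diff)
  then show ?thesis
    unfolding lbracket_fibre_gens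
    by (simp only: rderiv_fmul lprod_fmul_left fmul_add fmul_sum fmul_fmul mult.commute[of c])
qed

lemma lbracket_sum_right:
  "(\<And>i. i \<in> I \<Longrightarrow> coef_smooth (G i)) \<Longrightarrow> brk F (\<Sum>i\<in>I. G i) = (\<Sum>i\<in>I. brk F (G i))"
  by (induction I rule: infinite_finite_induct)
    (simp_all only: simp_thms not_False_eq_True sum.infinite sum.empty sum.insert lbracket_zero
      lbracket_add_right coef_smooth_sum insert_iff)

text \<open>Exchanging the factors turns the summand of \<open>w\<close> into that of
  \<open>dual_gen w\<close>, where \<open>pair_sign\<close> has the opposite sign; exactly one of
  the two coordinates is odd. The exponent has the parity of (p - 3)(q - 3).\<close>

lemma lbracket_antisym:
  assumes F: "graded p F" and G: "graded q G"
  shows "brk F G = lscale (- ((-1) ^ ((p + 1) * (q + 1)))) (brk G F)"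
proof (intro ext)
  fix A and m :: 'm
  let ?s = "- ((-1) ^ ((p + 1) * (q + 1))) :: real" and ?l = "\<lambda>F G. lprod F G A m"
  let ?c = "\<lambda>q w. pair_sign w * (-1) ^ (deg w * (q + 1))"
  let ?fib = "\<lambda>q F G w. ?c q w * ?l (rderiv (dual_gen w) F) (rderiv w G)"
  let ?bas = "\<lambda>q F G k. (-1) ^ (q + 1) * ?l (dX k F) (rderiv (P k) G) - ?l (rderiv (P k) F) (dX k G)"
  have brk_apply: "brk F G A m = (\<Sum>w\<in>fibre_gens \<A>. ?fib q F G w) + (\<Sum>k<bdim \<A>. ?bas q F G k)"
    if "graded q G" for q F G
    unfolding lbracket_graded[OF that] plus_fun_apply sum_lfun_apply minus_apply fmul_apply ..
  have "?fib q F G w = ?s * ?fib p G F (dual_gen w)" if w: "w \<in> fibre_gens \<A>" for w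
  proof -
    have "?l (rderiv (dual_gen w) F) (rderiv w G) =
       (-1) ^ ((p + deg (dual_gen w)) * (q + deg w)) * ?l (rderiv w G) (rderiv (dual_gen w) F)"
      using lprod_commute[OF graded_rderiv[OF F] graded_rderiv[OF G], of "dual_gen w" w] by (simp add: fmul_apply)
    moreover have "(-1::real) ^ (deg w * (q + 1)) * (-1) ^ ((p + deg (dual_gen w)) * (q + deg w)) =
        - ?s * (-1) ^ (deg (dual_gen w) * (p + 1))"
      using even_deg_dual_gen[OF w] by (cases "even p"; cases "even q"; cases "even (deg w)") (auto simp: minus_one_power_iff)
    ultimately show ?thesis
      using pair_sign_dual_gen[OF w] by (simp add: mult_ac)
  qed
  then have "(\<Sum>w\<in>fibre_gens \<A>. ?fib q F G w) = (\<Sum>w\<in>fibre_gens \<A>. ?s * ?fib p G F (dual_gen w))"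
    by (rule sum.cong[OF refl])
  also have "\<dots> = (\<Sum>w\<in>fibre_gens \<A>. ?s * ?fib p G F w)"
    by (rule sum.reindex_bij_witness[of _ dual_gen dual_gen]) auto
  finally have 1: "(\<Sum>w\<in>fibre_gens \<A>. ?fib q F G w) = ?s * (\<Sum>w\<in>fibre_gens \<A>. ?fib p G F w)"
    by (simp add: sum_distrib_left)
  have "?bas q F G i = ?s * ?bas p G F i" for i
  proof -
    have "?l (dX i F) (rderiv (P i) G) = (-1) ^ (p * (q + 3)) * ?l (rderiv (P i) G) (dX i F)"
      using lprod_commute[OF graded_xderiv[OF F] graded_rderiv[OF G], of i "P i"] by (simp add: fmul_apply)
    moreover have "?l (rderiv (P i) F) (dX i G) = (-1) ^ ((p + 3) * q) * ?l (dX i G) (rderiv (P i) F)"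
      using lprod_commute[OF graded_rderiv[OF F] graded_xderiv[OF G], of "P i" i] by (simp add: fmul_apply)
    ultimately show ?thesis
      by (cases "even p"; cases "even q") (auto simp: minus_one_power_iff)
  qed
  then have 2: "(\<Sum>k<bdim \<A>. ?bas q F G k) = ?s * (\<Sum>k<bdim \<A>. ?bas p G F k)"
    unfolding sum_distrib_left by (rule sum.cong[OF refl])
  show "brk F G A m = lscale ?s (brk G F) A m"
    unfolding fmul_apply brk_apply[OF F] brk_apply[OF G] 1 2 by (simp only: distrib_left)
qed

end

section \<open>The Jacobi identity with a section\<close>

context bundle_chart
begin

section \<open>Bracketing with a local section as an operator\<close>

text \<open>The explicit form of the bracket with \<open>fmul f (var z)\<close> as second argument:
  \<open>z\<close> pairs with its dual coordinate, and \<open>f\<close> with the momenta. Written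
  with right derivatives, it can be commuted past each ingredient of the bracket.\<close>

definition linear_ad :: "('m \<Rightarrow> real) \<Rightarrow> gen \<Rightarrow> 'm lfun \<Rightarrow> 'm lfun" where
  "linear_ad f z F = fmul (\<lambda>m. pair_sign z * f m) (rderiv (dual_gen z) F)
     - (\<Sum>i<bdim \<A>. fmul (dM i f) (lprod (rderiv (P i) F) (var z)))"

lemma linear_ad_apply:
  "linear_ad f z F A m = pair_sign z * f m * rderiv (dual_gen z) F A m
     - (\<Sum>i<bdim \<A>. dM i f m * lprod (rderiv (P i) F) (var z) A m)"
  by (simp add: linear_ad_def fmul_apply sum_lfun_apply)

lemma xderiv_fmul_var: "dX i (fmul f (var z)) = fmul (dM i f) (var z)"
proof
  fix A
  show "dX i (fmul f (var z)) A = fmul (dM i f) (var z) A"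
    by (cases "A = {#z#}") (simp_all add: xderiv_def fmul_def var_def)
qed

lemma lbracket_linear:
  assumes F: "adm_supported F" and z: "z \<in> fibre_gens \<A>"
  shows "brk F (fmul f (var z)) = linear_ad f z F"
proof (intro ext)
  fix A m
  have l: "lderiv w (fmul f (var z)) = (if w = z then fmul f lone else 0)" for w
    by (auto simp: lderiv_def fmul_def var_def lone_def fun_eq_iff)
  have P: "P i \<noteq> z" for i using z by auto
  have "(\<Sum>w\<in>fibre_gens \<A>. pair_sign w * lprod (rderiv (dual_gen w) F) (if w = z then fmul f lone else 0) A m)
     = (\<Sum>w\<in>fibre_gens \<A>. if w = z then pair_sign w * (f m * rderiv (dual_gen w) F A m) else 0)"
    by (rule sum.cong)
      (auto simp: lprod_fmul_right lprod_lone_right[OF adm_supported_rderiv[OF F]] fmul_apply)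
  also have "\<dots> = pair_sign z * (f m * rderiv (dual_gen z) F A m)" using z by simp
  finally show "brk F (fmul f (var z)) A m = linear_ad f z F A m"
    unfolding lbracket_fibre_gens linear_ad_apply
    using P by (simp add: l sum_lfun_apply fmul_apply xderiv_fmul_var lprod_fmul_right sum_negf)
qed

lemma linear_ad_add: "linear_ad f z (F + G) = linear_ad f z F + linear_ad f z G"
proof (intro ext)
  fix A m
  show "linear_ad f z (F + G) A m = (linear_ad f z F + linear_ad f z G) A m"
    unfolding linear_ad_apply rderiv_add lprod_add_left plus_fun_apply
    by (simp add: algebra_simps sum.distrib)
qed

lemma linear_ad_zero: "linear_ad f z 0 = 0"
  by (intro ext) (simp add: linear_ad_apply)

lemma linear_ad_lscale: "linear_ad f z (lscale c F) = lscale c (linear_ad f z F)"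
  by (intro ext) (simp add: linear_ad_apply rderiv_fmul lprod_fmul_left fmul_apply algebra_simps sum_distrib_left)

lemma linear_ad_diff: "linear_ad f z (F - G) = linear_ad f z F - linear_ad f z G"
  by (intro ext) (simp add: linear_ad_apply rderiv_diff lprod_diff_left algebra_simps sum_subtractf)

lemma linear_ad_sum: "linear_ad f z (\<Sum>i\<in>I. F i) = (\<Sum>i\<in>I. linear_ad f z (F i))"
  by (induction I rule: infinite_finite_induct)
    (simp_all only: simp_thms not_False_eq_True sum.infinite sum.empty sum.insert linear_ad_zero linear_ad_add)

lemma graded_linear_ad:
  assumes "graded q G" and z: "z \<in> fibre_gens \<A>"
  shows "graded (q + deg z + 1) (linear_ad f z G)"
  unfolding linear_ad_def
proof (intro graded_diff graded_sum graded_fmul)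
  show "graded (q + deg z + 1) (rderiv (dual_gen z) G)"
    using graded_rderiv[OF assms(1), of "dual_gen z"] even_deg_dual_gen[OF z] by (auto elim!: graded_cong[rotated])
  show "graded (q + deg z + 1) (lprod (rderiv (P i) G) (var z))" for i
    using graded_lprod[OF graded_rderiv[OF assms(1), of "P i"] graded_var[of z]] by (auto elim!: graded_cong[rotated])
qed

lemma adm_supported_linear_ad: "adm_supported F \<Longrightarrow> adm_supported (linear_ad f z F)"
  unfolding linear_ad_def
  by (intro adm_supported_diff adm_supported_sum adm_supported_fmul adm_supported_lprod adm_supported_rderiv)

text \<open>Both parts are derivations from the right of the parity of \<open>deg z + 1\<close>:
  this is the parity of \<open>dual_gen z\<close>, and also that of \<open>rderiv (P i)\<close>
  followed by right multiplication with \<open>z\<close>, once \<open>z\<close> has been moved past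
  \<open>G\<close>.\<close>

lemma linear_ad_lprod:
  assumes F: "adm_supported F" and G: "graded q G" and z: "z \<in> fibre_gens \<A>"
  shows "linear_ad f z (lprod F G) A m = lprod F (linear_ad f z G) A m
    + (-1) ^ ((deg z + 1) * q) * lprod (linear_ad f z F) G A m"
proof -
  let ?s = "(-1) ^ ((deg z + 1) * q) :: real"
  have s: "(-1) ^ (deg (dual_gen z) * q) = ?s"
    using even_deg_dual_gen[OF z] by (auto simp: minus_one_power_iff)
  have 1: "rderiv (dual_gen z) (lprod F G) A m = lprod F (rderiv (dual_gen z) G) A m + ?s * lprod (rderiv (dual_gen z) F) G A m"
    unfolding rderiv_lprod[OF F G] s by (simp add: fmul_apply)
  have zG: "lprod G (var z) = lscale ((-1) ^ (q * deg z)) (lprod (var z) G)"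
    by (rule lprod_commute[OF G graded_var])
  have 2: "lprod (rderiv (P i) (lprod F G)) (var z) A m =
     lprod F (lprod (rderiv (P i) G) (var z)) A m + ?s * lprod (lprod (rderiv (P i) F) (var z)) G A m" for i
  proof -
    have "lprod (rderiv (P i) (lprod F G)) (var z) A m =
       lprod F (lprod (rderiv (P i) G) (var z)) A m + (-1) ^ (3 * q) * lprod (rderiv (P i) F) (lprod G (var z)) A m"
      unfolding rderiv_lprod[OF F G] by (simp add: lprod_add_left lprod_fmul_left lprod_assoc del: plus_fun_apply) (simp add: fmul_apply)
    also have "lprod (rderiv (P i) F) (lprod G (var z)) A m = (-1) ^ (q * deg z) * lprod (lprod (rderiv (P i) F) (var z)) G A m"
      unfolding zG lprod_fmul_right lprod_assoc fmul_apply ..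
    finally show ?thesis
      by (auto simp: minus_one_power_iff)
  qed
  have r: "lprod F (linear_ad f z G) A m = pair_sign z * f m * lprod F (rderiv (dual_gen z) G) A m -
     (\<Sum>i<bdim \<A>. dM i f m * lprod F (lprod (rderiv (P i) G) (var z)) A m)"
    unfolding linear_ad_def lprod_diff_right lprod_fmul_right lprod_sum_right
    by (simp add: fmul_apply sum_lfun_apply)
  have l: "lprod (linear_ad f z F) G A m = pair_sign z * f m * lprod (rderiv (dual_gen z) F) G A m -
     (\<Sum>i<bdim \<A>. dM i f m * lprod (lprod (rderiv (P i) F) (var z)) G A m)"
    unfolding linear_ad_def lprod_diff_left lprod_fmul_left lprod_sum_left
    by (simp add: fmul_apply sum_lfun_apply)
  show ?thesis
    unfolding linear_ad_apply[of f z "lprod F G"] 1 2 r l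
    by (simp add: algebra_simps sum.distrib sum_distrib_left)
qed

text \<open>Up to sign the bracket with the base function \<open>f\<close>; it measures the failure
  of \<open>linear_ad f z\<close> to commute, up to sign, with \<open>rderiv z\<close>.\<close>

definition base_ad :: "('m \<Rightarrow> real) \<Rightarrow> 'm lfun \<Rightarrow> 'm lfun" where
  "base_ad f F = (\<Sum>i<bdim \<A>. fmul (dM i f) (rderiv (P i) F))"

text \<open>Right derivatives commute up to sign, so a correction arises only where
  \<open>rderiv w\<close> hits the factor \<open>var z\<close> in the momentum part of
  \<open>linear_ad\<close>, that is, for \<open>w = z\<close>.\<close>

lemma linear_ad_rderiv:
  assumes F: "adm_supported F" and z: "z \<in> fibre_gens \<A>"
  shows "linear_ad f z (rderiv w F) = lscale ((-1) ^ (deg w * (deg z + 1)))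
    (rderiv w (linear_ad f z F) + (if w = z then base_ad f F else 0))"
proof (intro ext)
  fix A m
  let ?s = "(-1) ^ (deg w * (deg z + 1)) :: real"
  have 1: "rderiv (dual_gen z) (rderiv w F) A m = ?s * rderiv w (rderiv (dual_gen z) F) A m"
  proof -
    have "(-1) ^ (deg (dual_gen z) * deg w) = ?s"
      using even_deg_dual_gen[OF z] by (auto simp: minus_one_power_iff)
    then show ?thesis using rderiv_commute[OF F, of "dual_gen z" w] by (simp add: fmul_apply)
  qed
  have 2: "lprod (rderiv (P i) (rderiv w F)) (var z) A m =
     ?s * (rderiv w (lprod (rderiv (P i) F) (var z)) A m - (if w = z then rderiv (P i) F A m else 0))" for i
  proof -
    have "rderiv w (lprod (rderiv (P i) F) (var z)) = lprod (rderiv (P i) F) (if w = z then lone else 0) +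
        lscale ((-1) ^ (deg w * deg z)) (lprod (rderiv w (rderiv (P i) F)) (var z))"
      using rderiv_lprod[OF adm_supported_rderiv[OF F] graded_var[of z], of w "P i"] by (simp only: rderiv_var)
    also have "lprod (rderiv w (rderiv (P i) F)) (var z) = lscale ((-1) ^ (deg w * 3)) (lprod (rderiv (P i) (rderiv w F)) (var z))"
      using rderiv_commute[OF F, of w "P i"] by (simp add: lprod_fmul_left)
    also have "lprod (rderiv (P i) F) (if w = z then lone else 0) = (if w = z then rderiv (P i) F else 0)"
      using lprod_lone_right[OF adm_supported_rderiv[OF F]] by auto
    finally have "rderiv w (lprod (rderiv (P i) F) (var z)) A m = (if w = z then rderiv (P i) F A m else 0) +
        ?s * lprod (rderiv (P i) (rderiv w F)) (var z) A m"
      by (cases "even (deg w)"; cases "even (deg z)") (auto simp: fmul_apply minus_one_power_iff)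
    then show ?thesis by (simp add: algebra_simps minus_one_power_iff)
  qed
  have "rderiv w (linear_ad f z F) A m = pair_sign z * f m * rderiv w (rderiv (dual_gen z) F) A m -
     (\<Sum>i<bdim \<A>. dM i f m * rderiv w (lprod (rderiv (P i) F) (var z)) A m)"
    unfolding linear_ad_def rderiv_diff rderiv_fmul rderiv_sum by (simp add: fmul_apply sum_lfun_apply)
  moreover have "(if w = z then base_ad f F else 0) A m =
     (\<Sum>i<bdim \<A>. dM i f m * (if w = z then rderiv (P i) F A m else 0))"
    unfolding base_ad_def by (simp add: fmul_apply sum_lfun_apply)
  ultimately show "linear_ad f z (rderiv w F) A m =
     lscale ?s (rderiv w (linear_ad f z F) + (if w = z then base_ad f F else 0)) A m"
    unfolding linear_ad_apply[of f z "rderiv w F"] 1 2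
    by (simp add: fmul_apply right_diff_distrib distrib_left sum_subtractf sum_distrib_left mult_ac)
qed

text \<open>The commutator of \<open>linear_ad f z\<close> with \<open>dX k\<close> differentiates
  \<open>f\<close> once more in each of its two parts; this is the contribution of the momentum
  part, with second derivatives.\<close>

definition hessian_ad :: "('m \<Rightarrow> real) \<Rightarrow> gen \<Rightarrow> nat \<Rightarrow> 'm lfun \<Rightarrow> 'm lfun" where
  "hessian_ad f z k F = (\<Sum>i<bdim \<A>. fmul (dM k (dM i f)) (lprod (rderiv (P i) F) (var z)))"

lemma linear_ad_xderiv:
  assumes F: "coef_smooth F" and f: "smooth f" and k: "k < bdim \<A>"
  shows "linear_ad f z (dX k F) = dX k (linear_ad f z F)
    - fmul (\<lambda>m. pair_sign z * dM k f m) (rderiv (dual_gen z) F) + hessian_ad f z k F"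
proof (intro ext)
  fix A m
  have a: "dX k (fmul (\<lambda>m. pair_sign z * f m) (rderiv (dual_gen z) F)) A m =
     pair_sign z * dM k f m * rderiv (dual_gen z) F A m
     + pair_sign z * f m * rderiv (dual_gen z) (dX k F) A m"
    using F f k by (simp add: xderiv_fmul smooth_mult smooth_const coef_smooth_rderiv xderiv_rderiv fmul_apply pd_cmult)
  have b: "dX k (fmul (dM i f) (lprod (rderiv (P i) F) (var z))) A m =
     dM k (dM i f) m * lprod (rderiv (P i) F) (var z) A m
     + dM i f m * lprod (rderiv (P i) (dX k F)) (var z) A m" if "i < bdim \<A>" for i
    using F f k that
    by (simp add: xderiv_fmul smooth_pd coef_smooth_rderiv coef_smooth_lprod coef_smooth_var
        xderiv_rderiv xderiv_lprod_var fmul_apply)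
  have "dX k (linear_ad f z F) =
    dX k (fmul (\<lambda>m. pair_sign z * f m) (rderiv (dual_gen z) F)) -
    (\<Sum>i<bdim \<A>. dX k (fmul (dM i f) (lprod (rderiv (P i) F) (var z))))"
    unfolding linear_ad_def using F f k
    by (subst xderiv_diff xderiv_sum,
        auto intro!: coef_smooth_sum coef_smooth_fmul smooth_mult smooth_const coef_smooth_rderiv
          coef_smooth_lprod coef_smooth_var smooth_pd)+
  then have "dX k (linear_ad f z F) A m =
    dX k (fmul (\<lambda>m. pair_sign z * f m) (rderiv (dual_gen z) F)) A m -
    (\<Sum>i<bdim \<A>. dX k (fmul (dM i f) (lprod (rderiv (P i) F) (var z))) A m)"
    by (simp add: sum_lfun_apply)
  also have "(\<Sum>i<bdim \<A>. dX k (fmul (dM i f) (lprod (rderiv (P i) F) (var z))) A m) =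
    (\<Sum>i<bdim \<A>. dM k (dM i f) m * lprod (rderiv (P i) F) (var z) A m
     + dM i f m * lprod (rderiv (P i) (dX k F)) (var z) A m)"
    by (rule sum.cong) (auto simp: b)
  finally show "linear_ad f z (dX k F) A m = (dX k (linear_ad f z F)
    - fmul (\<lambda>m. pair_sign z * dM k f m) (rderiv (dual_gen z) F) + hessian_ad f z k F) A m"
    unfolding linear_ad_apply a hessian_ad_def by (simp add: fmul_apply sum_lfun_apply sum.distrib)
qed

text \<open>The commutators of \<open>{\<cdot>, f z}\<close> with the coordinate derivations cancel in pairs; the second derivatives
  of \<open>f\<close>, which come from the pairs \<open>(x\<^sup>k, p\<^sub>k)\<close>, cancel by their symmetry.\<close>

lemma linear_ad_lbracket:
  assumes F: "adm_supported F" "coef_smooth F" and G: "graded q G" "coef_smooth G"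
    and f: "smooth f" and z: "z \<in> fibre_gens \<A>"
  shows "linear_ad f z (brk F G) = brk F (linear_ad f z G)
    + lscale ((-1) ^ ((deg z + 1) * (q + 1))) (brk (linear_ad f z F) G)"
proof (intro ext)
  fix A and m :: 'm
  let ?D = "linear_ad f z" and ?n = "bdim \<A>" and ?q = "q + deg z + 1"
  let ?z = "dual_gen z" and ?p = "\<lambda>k. pair_sign z * dM k f m"
  let ?l = "\<lambda>F G. lprod F G A m"
  let ?y = "(-1) ^ ((deg z + 1) * (q + 1)) :: real" and ?s = "\<lambda>q. (-1) ^ (q + 1) :: real"
  \<comment> \<open>\<open>?e1\<close> and \<open>?e2\<close> are the defects of the fibre sum,
    located at \<open>w = z\<close> and \<open>w = dual_gen z\<close>. They cancel the
    first-derivative terms of \<open>?h\<close> below after summation over \<open>k\<close>.\<close>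
  let ?e1 = "pair_sign z * (-1) ^ (deg z * (q + 1)) * ?l (rderiv ?z F) (base_ad f G)"
  let ?e2 = "- (pair_sign z * ?l (base_ad f F) (rderiv ?z G))"
  let ?c = "\<lambda>q w. pair_sign w * (-1) ^ (deg w * (q + 1)) :: real"
  let ?fib = "\<lambda>q F G w. ?c q w * ?l (rderiv (dual_gen w) F) (rderiv w G)"
  let ?bas = "\<lambda>q F G k. ?s q * ?l (dX k F) (rderiv (P k) G) - ?l (rderiv (P k) F) (dX k G)"
  have brk_apply: "brk F G A m = (\<Sum>w\<in>fibre_gens \<A>. ?fib q F G w) + (\<Sum>k<?n. ?bas q F G k)"
    if "graded q G" for q F G
    unfolding lbracket_graded[OF that] plus_fun_apply sum_lfun_apply minus_apply fmul_apply ..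
  have GD: "graded ?q (?D G)" by (rule graded_linear_ad[OF G(1) z])
  have Gadm: "adm_supported G" using G(1) by (rule graded_imp_adm_supported)
  have fibre: "?c q w * ?D (lprod (rderiv (dual_gen w) F) (rderiv w G)) A m =
      ?fib ?q F (?D G) w + ?y * ?fib q (?D F) G w
      + (if w = z then ?e1 else 0) + (if w = ?z then ?e2 else 0)"
    if w: "w \<in> fibre_gens \<A>" for w
  proof -
    let ?w = "dual_gen w" and ?u = "(-1) ^ (deg w * (deg z + 1)) :: real"
    let ?v = "(-1) ^ (deg (dual_gen w) * (deg z + 1)) :: real" and ?t = "(-1) ^ ((deg z + 1) * (q + deg w)) :: real"
    let ?a = "?l (rderiv ?w F) (rderiv w (?D G)) + (if w = z then ?l (rderiv ?w F) (base_ad f G) else 0)"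
    let ?b = "?l (rderiv ?w (?D F)) (rderiv w G) + (if ?w = z then ?l (base_ad f F) (rderiv w G) else 0)"
    have 1: "?l (rderiv ?w F) (?D (rderiv w G)) = ?u * ?a"
      unfolding linear_ad_rderiv[OF Gadm z]
      by (simp add: lprod_fmul_right lprod_add_right fmul_apply del: plus_fun_apply) simp
    have 2: "?l (?D (rderiv ?w F)) (rderiv w G) = ?v * ?b"
      unfolding linear_ad_rderiv[OF F(1) z]
      by (simp add: lprod_fmul_left lprod_add_left fmul_apply del: plus_fun_apply) simp
    have D: "?D (lprod (rderiv ?w F) (rderiv w G)) A m =
        ?l (rderiv ?w F) (?D (rderiv w G)) + ?t * ?l (?D (rderiv ?w F)) (rderiv w G)"
      by (rule linear_ad_lprod[OF adm_supported_rderiv[OF F(1)] graded_rderiv[OF G(1)] z])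
    have s1: "(-1) ^ (deg w * (q + 1)) * ?u = (-1) ^ (deg w * (?q + 1))"
      by (simp add: algebra_simps flip: power_add)
    have s2: "?t * ?v = ?y"
      using even_deg_dual_gen[OF w] by (cases "even (deg w)"; cases "even (deg z)"; cases "even q")
        (auto simp: minus_one_power_iff)
    have "?c q w * ?D (lprod (rderiv ?w F) (rderiv w G)) A m =
        pair_sign w * ((-1) ^ (deg w * (q + 1)) * ?u) * ?a + ?c q w * (?t * ?v) * ?b"
      unfolding D 1 2 by (simp only: distrib_left mult_ac)
    also have "\<dots> = ?fib ?q F (?D G) w + ?y * ?fib q (?D F) G w
      + (if w = z then ?c ?q w * ?l (rderiv ?w F) (base_ad f G) else 0)
      + (if ?w = z then ?c q w * ?y * ?l (base_ad f F) (rderiv w G) else 0)"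
      unfolding s1 s2 by (simp add: distrib_left mult_ac)
    also have "(if w = z then ?c ?q w * ?l (rderiv ?w F) (base_ad f G) else 0) = (if w = z then ?e1 else 0)"
      by (auto simp: minus_one_power_iff)
    also have "(if ?w = z then ?c q w * ?y * ?l (base_ad f F) (rderiv w G) else 0) = (if w = ?z then ?e2 else 0)"
      using w pair_sign_dual_gen[OF w] even_deg_dual_gen[OF w] by (auto simp: minus_one_power_iff)
    finally show ?thesis .
  qed
  let ?h = "\<lambda>k. ?s q * ?y * (?l (hessian_ad f z k F) (rderiv (P k) G) - ?p k * ?l (rderiv ?z F) (rderiv (P k) G))
    + ?p k * ?l (rderiv (P k) F) (rderiv ?z G) - ?l (rderiv (P k) F) (hessian_ad f z k G)"
  have base: "?s q * ?D (lprod (dX k F) (rderiv (P k) G)) A m - ?D (lprod (rderiv (P k) F) (dX k G)) A m =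
      ?bas ?q F (?D G) k + ?y * ?bas q (?D F) G k + ?h k"
    if k: "k < ?n" for k
  proof -
    let ?r = "rderiv (P k)" and ?u = "(-1) ^ (deg z + 1) :: real" and ?v = "(-1) ^ ((deg z + 1) * q) :: real"
    have Pz: "P k \<noteq> z" using z by auto
    have DP: "?D (?r H) = lscale ?u (?r (?D H))" if "adm_supported H" for H
      using linear_ad_rderiv[OF that z, of f "P k"] Pz by (auto simp: minus_one_power_iff)
    have D1: "?D (lprod (dX k F) (?r G)) A m = ?l (dX k F) (?D (?r G))
       + (-1) ^ ((deg z + 1) * (q + deg (P k))) * ?l (?D (dX k F)) (?r G)"
      by (rule linear_ad_lprod[OF adm_supported_xderiv[OF F(1)] graded_rderiv[OF G(1)] z])
    have D2: "?D (lprod (?r F) (dX k G)) A m = ?l (?r F) (?D (dX k G)) + ?v * ?l (?D (?r F)) (dX k G)"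
      by (rule linear_ad_lprod[OF adm_supported_rderiv[OF F(1)] graded_xderiv[OF G(1)] z])
    have s: "(-1) ^ ((deg z + 1) * (q + deg (P k))) = ?y" "?s q * ?u = ?s ?q" "?v * ?u = ?y"
      by (auto simp: minus_one_power_iff)
    have a: "?l (?D (dX k F)) (?r G) = ?l (dX k (?D F)) (?r G) - ?p k * ?l (rderiv ?z F) (?r G)
       + ?l (hessian_ad f z k F) (?r G)"
      unfolding linear_ad_xderiv[OF F(2) f k] lprod_add_left lprod_diff_left lprod_fmul_left by (simp add: fmul_apply)
    have b: "?l (?r F) (?D (dX k G)) = ?l (?r F) (dX k (?D G)) - ?p k * ?l (?r F) (rderiv ?z G)
       + ?l (?r F) (hessian_ad f z k G)"
      unfolding linear_ad_xderiv[OF G(2) f k] lprod_add_right lprod_diff_right lprod_fmul_right by (simp add: fmul_apply)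
    have "?s q * ?D (lprod (dX k F) (?r G)) A m - ?D (lprod (?r F) (dX k G)) A m =
      (?s q * ?u) * ?l (dX k F) (?r (?D G)) + ?s q * ?y * ?l (?D (dX k F)) (?r G)
      - ?l (?r F) (?D (dX k G)) - (?v * ?u) * ?l (?r (?D F)) (dX k G)"
      unfolding D1 D2 s(1) DP[OF F(1)] DP[OF Gadm] lprod_fmul_left lprod_fmul_right fmul_apply
      by (simp only: distrib_left diff_diff_eq mult_ac add_ac)
    then show ?thesis
      unfolding s a b by (simp only: ring_distribs mult_ac)
  qed
  let ?T = "\<lambda>i k. ?l (rderiv (P i) F) (lprod (rderiv (P k) G) (var z))"
  let ?T' = "\<lambda>i k. ?l (lprod (rderiv (P i) F) (var z)) (rderiv (P k) G)"
  have sy: "?s q * ?y = (-1) ^ (deg z * (q + 1))" by (auto simp: minus_one_power_iff)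
  \<comment> \<open>Moving \<open>z\<close> past \<open>rderiv (P k) G\<close> identifies the two
    triple products, so the two Hessian sums have the same summands with the indices
    \<open>i\<close> and \<open>k\<close> exchanged.\<close>
  have T: "?s q * ?y * ?T' i k = ?T i k" for i k
  proof -
    have "lprod (var z) (rderiv (P k) G) = lscale ((-1) ^ (deg z * (q + deg (P k)))) (lprod (rderiv (P k) G) (var z))"
      by (rule lprod_commute[OF graded_var graded_rderiv[OF G(1)]])
    moreover have "?s q * ?y * (-1) ^ (deg z * (q + deg (P k))) = 1"
      by (auto simp: minus_one_power_iff)
    ultimately show ?thesis by (simp add: lprod_assoc lprod_fmul_right fmul_apply flip: mult.assoc)
  qed
  have "(\<Sum>k<?n. ?s q * ?y * ?l (hessian_ad f z k F) (rderiv (P k) G)) =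
      (\<Sum>k<?n. \<Sum>i<?n. dM k (dM i f) m * (?s q * ?y * ?T' i k))"
    unfolding hessian_ad_def lprod_sum_left lprod_fmul_left
    by (simp add: sum_lfun_apply fmul_apply sum_distrib_left mult_ac)
  also have "\<dots> = (\<Sum>k<?n. \<Sum>i<?n. dM k (dM i f) m * ?T i k)"
    by (simp only: T)
  also have "\<dots> = (\<Sum>i<?n. \<Sum>k<?n. dM k (dM i f) m * ?T i k)"
    by (rule sum.swap)
  also have "\<dots> = (\<Sum>i<?n. \<Sum>k<?n. dM i (dM k f) m * ?T i k)"
    by (intro sum.cong refl) (simp add: pd_commute[OF f])
  also have "\<dots> = (\<Sum>k<?n. ?l (rderiv (P k) F) (hessian_ad f z k G))"
    unfolding hessian_ad_def lprod_sum_right lprod_fmul_right by (simp add: sum_lfun_apply fmul_apply)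
  finally have hess: "(\<Sum>k<?n. ?s q * ?y * ?l (hessian_ad f z k F) (rderiv (P k) G)) =
    (\<Sum>k<?n. ?l (rderiv (P k) F) (hessian_ad f z k G))" .
  have e1: "?e1 = (\<Sum>k<?n. ?s q * ?y * (?p k * ?l (rderiv ?z F) (rderiv (P k) G)))"
    unfolding base_ad_def lprod_sum_right lprod_fmul_right sy
    by (simp add: sum_lfun_apply fmul_apply sum_distrib_left mult_ac)
  have e2: "?e2 = - (\<Sum>k<?n. ?p k * ?l (rderiv (P k) F) (rderiv ?z G))"
    unfolding base_ad_def lprod_sum_left lprod_fmul_left
    by (simp add: sum_lfun_apply fmul_apply sum_distrib_left mult_ac)
  have cancel: "?e1 + ?e2 + (\<Sum>k<?n. ?h k) = 0"
    unfolding e1 e2 using hess by (simp add: right_diff_distrib sum.distrib sum_subtractf)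
  have "?D (brk F G) A m =
     (\<Sum>w\<in>fibre_gens \<A>. ?c q w * ?D (lprod (rderiv (dual_gen w) F) (rderiv w G)) A m) +
     (\<Sum>k<?n. ?s q * ?D (lprod (dX k F) (rderiv (P k) G)) A m - ?D (lprod (rderiv (P k) F) (dX k G)) A m)"
    unfolding lbracket_graded[OF G(1)] linear_ad_add linear_ad_sum linear_ad_lscale linear_ad_diff
    by (simp add: sum_lfun_apply fmul_apply)
  also have "(\<Sum>w\<in>fibre_gens \<A>. ?c q w * ?D (lprod (rderiv (dual_gen w) F) (rderiv w G)) A m) =
     (\<Sum>w\<in>fibre_gens \<A>. ?fib ?q F (?D G) w + ?y * ?fib q (?D F) G w
      + (if w = z then ?e1 else 0) + (if w = ?z then ?e2 else 0))"
    by (rule sum.cong[OF refl fibre])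
  also have "\<dots> = (\<Sum>w\<in>fibre_gens \<A>. ?fib ?q F (?D G) w) + ?y * (\<Sum>w\<in>fibre_gens \<A>. ?fib q (?D F) G w) + ?e1 + ?e2"
    unfolding sum.distrib sum_distrib_left[symmetric] using z by (simp add: sum.delta)
  also have "(\<Sum>k<?n. ?s q * ?D (lprod (dX k F) (rderiv (P k) G)) A m - ?D (lprod (rderiv (P k) F) (dX k G)) A m) =
     (\<Sum>k<?n. ?bas ?q F (?D G) k + ?y * ?bas q (?D F) G k + ?h k)"
    by (rule sum.cong[OF refl]) (rule base, simp)
  also have "\<dots> = (\<Sum>k<?n. ?bas ?q F (?D G) k) + ?y * (\<Sum>k<?n. ?bas q (?D F) G k) + (\<Sum>k<?n. ?h k)"
    unfolding sum.distrib[of "\<lambda>k. _ k + _ k" ?h] sum.distrib sum_distrib_left[symmetric] ..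
  finally show "?D (brk F G) A m = (brk F (?D G) + lscale ?y (brk (?D F) G)) A m"
    unfolding plus_fun_apply fmul_apply brk_apply[OF G(1)] brk_apply[OF GD] distrib_left[of ?y] using cancel by linarith
qed

section \<open>The Jacobi identity with a section as last argument\<close>

text \<open>\<open>linear_ad_lbracket\<close> is this identity with the section acting from the
  right. Antisymmetry rewrites its last term in the form with \<open>G\<close> outermost, and the
  part of the sign that depends on \<open>deg z\<close> cancels.\<close>

lemma lbracket_Jacobi_monomial:
  assumes F: "graded p F" "coef_smooth F" and G: "graded q G" "coef_smooth G"
    and f: "smooth f" and z: "z \<in> fibre_gens \<A>"
  defines "X \<equiv> fmul f (var z)"
  shows "brk F (brk G X) = brk (brk F G) X
    + lscale ((-1) ^ ((p + 1) * (q + 1))) (brk G (brk F X))"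
proof -
  note adm = graded_imp_adm_supported[OF F(1)] graded_imp_adm_supported[OF G(1)]
  have X: "brk F X = linear_ad f z F" "brk G X = linear_ad f z G"
    "brk (brk F G) X = linear_ad f z (brk F G)"
    unfolding X_def by (rule lbracket_linear[OF _ z], rule adm adm_supported_lbracket)+
  have J: "linear_ad f z (brk F G) = brk F (linear_ad f z G)
    + lscale ((-1) ^ ((deg z + 1) * (q + 1))) (brk (linear_ad f z F) G)"
    by (rule linear_ad_lbracket[OF adm(1) F(2) G f z])
  have S: "brk (linear_ad f z F) G =
      lscale (- ((-1) ^ ((p + deg z + 1 + 1) * (q + 1)))) (brk G (linear_ad f z F))"
    by (rule lbracket_antisym[OF graded_linear_ad[OF F(1) z] G(1)])
  have s: "(-1::real) ^ ((deg z + 1) * (q + 1)) * (-1) ^ ((p + deg z + 1 + 1) * (q + 1)) = (-1) ^ ((p + 1) * (q + 1))"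
    by (cases "even p"; cases "even q"; cases "even (deg z)") (auto simp: minus_one_power_iff)
  show ?thesis
    unfolding X J S
    by (intro ext) (use s in \<open>simp add: fmul_apply flip: mult.assoc\<close>)
qed

text \<open>The signs do not involve the degree of \<open>X\<close>, so the monomial case adds up to
  sections with components in both degrees.\<close>

lemma lbracket_Jacobi:
  assumes F: "graded p F" "coef_smooth F" and G: "graded q G" "coef_smooth G"
    and f: "\<And>z. z \<in> Z \<Longrightarrow> smooth (f z)" and Z: "Z \<subseteq> fibre_gens \<A>"
    and X: "X = (\<Sum>z\<in>Z. fmul (f z) (var z))"
  shows "brk F (brk G X) = brk (brk F G) X
    + lscale ((-1) ^ ((p + 1) * (q + 1))) (brk G (brk F X))"
proof -
  let ?X = "\<lambda>z. fmul (f z) (var z)"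
  have c: "coef_smooth (?X z)" if "z \<in> Z" for z
    using f[OF that] by (intro coef_smooth_fmul coef_smooth_var)
  have e: "brk H X = (\<Sum>z\<in>Z. brk H (?X z))" for H
    unfolding X by (rule lbracket_sum_right[OF c])
  have e2: "brk K (brk H X) = (\<Sum>z\<in>Z. brk K (brk H (?X z)))" if "coef_smooth H" for H K
    unfolding e by (rule lbracket_sum_right[OF coef_smooth_lbracket[OF that c]])
  have "(\<Sum>z\<in>Z. brk F (brk G (?X z))) =
    (\<Sum>z\<in>Z. brk (brk F G) (?X z)
      + lscale ((-1) ^ ((p + 1) * (q + 1))) (brk G (brk F (?X z))))"
    by (rule sum.cong[OF refl], rule lbracket_Jacobi_monomial[OF F G f]) (use Z in auto)
  then show ?thesis
    unfolding e2[OF F(2)] e2[OF G(2)] unfolding e fmul_sum sum.distrib .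
qed

end

section \<open>Bump functions and global sections\<close>

context bundle_chart
begin

lemma continuous_map_chart_inv:
  "continuous_map (subtopology (E\<^sub>x) (img))
     (subtopology (base \<A>) (dom)) (inv\<^sub>x)"
proof -
  obtain g where g: "homeomorphic_maps (subtopology (base \<A>) (dom))
     (subtopology (E\<^sub>x) (img)) (crd) g"
    using chart_homeomorphic homeomorphic_map_maps by blast
  show ?thesis
  proof (rule continuous_map_eq)
    show "continuous_map (subtopology (E\<^sub>x) (img))
        (subtopology (base \<A>) (dom)) g"
      using g unfolding homeomorphic_maps_def by blast
    fix x assume "x \<in> topspace (subtopology (E\<^sub>x) (img))"
    then obtain m where "m \<in> dom" "x = crd m" by auto
    then show "g x = inv\<^sub>x x"
      using g topspace_chart_domain unfolding homeomorphic_maps_def by auto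
  qed
qed

lemma open_chart_image_subset:
  assumes "openin (base \<A>) U" "U \<subseteq> dom"
  shows "openin (E\<^sub>x) (crd ` U)"
proof -
  have "openin (subtopology (base \<A>) (dom)) U"
    using assms openin_open_subtopology[OF open_chart_domain] by blast
  then have "openin (subtopology (E\<^sub>x) (img)) (crd ` U)"
    using chart_homeomorphic homeomorphic_imp_open_map open_map_def by blast
  then show ?thesis
    using openin_open_subtopology[OF open_chart_image] by blast
qed

lemma smooth_coordinate: "smooth (\<lambda>m. crd m k)"
proof (rule smoothI, rule C_infinity_on_cong[OF open_chart_image _ C_infinity_on_coordinate[OF open_chart_image]])
  show "crd (inv\<^sub>x x) k = x k" if "x \<in> img" for x
    using that by auto
qed

lemma pd_coordinate:
  assumes "m \<in> dom" "i < bdim \<A>"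
  shows "dM i (\<lambda>m. crd m k) m = (if i = k then 1 else 0)"
proof (rule pd_eqI[OF assms(1)])
  let ?x = "crd m"
  have "\<forall>\<^sub>F t in nhds (?x i). crd (inv\<^sub>x (?x(i := t))) k = (?x(i := t)) k"
  proof (rule eventually_mono[OF eventually_line_in_open[OF open_chart_image]])
    fix t assume "?x(i := t) \<in> img"
    then obtain m' where "m' \<in> dom" "?x(i := t) = crd m'" by auto
    then show "crd (inv\<^sub>x (?x(i := t))) k = (?x(i := t)) k" by (simp only: chart_inv_chart)
  qed (use assms in auto)
  then show "((\<lambda>t. crd (inv\<^sub>x (?x(i := t))) k) has_real_derivative (if i = k then 1 else 0)) (at (?x i))"
    by (subst DERIV_cong_ev[OF refl _ refl]) auto
qed

end

section \<open>Bump functions\<close>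

text \<open>\<open>C\<close> is closed in the whole manifold, so its complement is open and products
  with \<rho> vanish on it; vanishing outside the chart domain alone would not control the boundary.
  Smoothness is asked in every chart because the functions on the graded manifold are tested chart
  by chart.\<close>

definition bump_on :: "('i, 'm) graded_bundle \<Rightarrow> 'i \<Rightarrow> ('m \<Rightarrow> real) \<Rightarrow> bool" where
  "bump_on \<A> \<alpha> \<rho> \<longleftrightarrow>
     (\<exists>C. closedin (base \<A>) C \<and> C \<subseteq> cdom \<A> \<alpha> \<and> (\<forall>m. \<rho> m \<noteq> 0 \<longrightarrow> m \<in> C)) \<and>
     (\<forall>\<beta>\<in>idx \<A>. smooth_in \<A> \<beta> (cdom \<A> \<beta> \<inter> cdom \<A> \<alpha>) \<rho>)"

lemma flat_exp_1_mono: "0 < v \<Longrightarrow> u \<le> v \<Longrightarrow> flat_exp 1 u \<le> flat_exp 1 v"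
  by (auto simp: flat_exp_def frac_le)

lemma flat_exp_1_nonzero_iff: "flat_exp 1 u \<noteq> 0 \<longleftrightarrow> 0 < u"
  by (simp add: flat_exp_def)

text \<open>Only the first \<open>n\<close> coordinates vary, so the radius is a minimum over
  finitely many; all others are frozen at \<open>x\<close>.\<close>

lemma box_in_open:
  assumes "open T" "x \<in> T"
  obtains r where "r > 0" "\<And>y. (\<And>i::nat. i < n \<Longrightarrow> \<bar>y i - x i\<bar> \<le> r) \<Longrightarrow> (\<And>i. i \<ge> n \<Longrightarrow> y i = x i) \<Longrightarrow> y \<in> (T :: (nat \<Rightarrow> real) set)"
proof -
  have "openin (powertop_real UNIV) T"
    using assms(1) by (simp add: euclidean_product_topology)
  then obtain X where X: "x \<in> PiE UNIV X" "\<And>i. open (X i)" "PiE UNIV X \<subseteq> T"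
    using product_topology_open_contains_basis[of "\<lambda>_. euclideanreal" UNIV T x] assms(2) by auto
  have "\<exists>r>0. \<forall>t. \<bar>t - x i\<bar> \<le> r \<longrightarrow> t \<in> X i" for i
  proof -
    have "x i \<in> X i" using X(1) by auto
    then obtain e where "e > 0" "cball (x i) e \<subseteq> X i"
      using X(2)[of i] open_contains_cball by metis
    then show ?thesis by (intro exI[of _ e]) (auto simp: dist_real_def abs_minus_commute subset_iff)
  qed
  then obtain r where r: "\<And>i. r i > 0" "\<And>i t. \<bar>t - x i\<bar> \<le> r i \<Longrightarrow> t \<in> X i" by metis
  \<comment> \<open>The inserted 1 keeps the set nonempty when \<open>n = 0\<close>.\<close>
  define s where "s = Min (insert 1 (r ` {..<n}))"
  have s: "s > 0" "\<And>i. i < n \<Longrightarrow> s \<le> r i"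
    unfolding s_def using r(1) by auto
  show ?thesis
  proof (rule that[OF s(1)])
    fix y assume y: "\<And>i. i < n \<Longrightarrow> \<bar>y i - x i\<bar> \<le> s" "\<And>i. i \<ge> n \<Longrightarrow> y i = x i"
    have "y i \<in> X i" for i
      using y[of i] s(2)[of i] r(1)[of i] by (cases "i < n") (force intro: r(2))+
    then show "y \<in> T" using X(3) by auto
  qed
qed

context bundle_chart
begin

lemma other_chart: "\<beta> \<in> idx \<A> \<Longrightarrow> bundle_chart \<A> \<beta>"
  using gvb by unfold_locales

lemma open_overlap: "\<beta> \<in> idx \<A> \<Longrightarrow> openin (base \<A>) (cdom \<A> \<beta> \<inter> dom)"
  using bundle_chart.open_chart_domain[OF other_chart] open_chart_domain by blast

lemma open_overlap_image:
  "\<beta> \<in> idx \<A> \<Longrightarrow> openin (E\<^sub>x) (chart \<A> \<beta> ` (cdom \<A> \<beta> \<inter> dom))"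
  using bundle_chart.open_chart_image_subset[OF other_chart] open_overlap by blast

text \<open>The function is exp(-1/u) with u = r^2 - |x - x0|^2 in the chart, cut off where u is not
  positive. Its support lies in the preimage of a closed box, which is compact and therefore closed
  in the Hausdorff manifold. The derivative vanishes at \<open>m\<^sub>0\<close> because u is
  maximal there.\<close>

lemma bump_exists:
  assumes m\<^sub>0: "m\<^sub>0 \<in> dom"
  obtains \<rho> where "bump_on \<A> \<alpha> \<rho>" "\<rho> m\<^sub>0 \<noteq> 0" "\<And>i. i < bdim \<A> \<Longrightarrow> dM i \<rho> m\<^sub>0 = 0"
proof -
  let ?n = "bdim \<A>" and ?V = "img"
  define x where "x = crd m\<^sub>0"
  obtain T where T: "open T" "?V = {x. \<forall>i\<ge>?n. x i = 0} \<inter> T"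
    using open_chart_image unfolding Euclidean_space_top_of_set openin_open by auto
  have x: "x \<in> T" "\<And>i. i \<ge> ?n \<Longrightarrow> x i = 0" using T(2) m\<^sub>0 unfolding x_def by auto
  obtain r where r: "r > 0" "\<And>y. (\<And>i. i < ?n \<Longrightarrow> \<bar>y i - x i\<bar> \<le> r) \<Longrightarrow> (\<And>i. i \<ge> ?n \<Longrightarrow> y i = x i) \<Longrightarrow> y \<in> T"
    using box_in_open[OF T(1) x(1)] by metis
  \<comment> \<open>An infinite product of compact sets, with \<open>{0}\<close> in the coordinates
    from \<open>?n\<close> on, so that the box is compact in the product topology.\<close>
  define S where "S = (\<lambda>i. if i < ?n then {x i - r..x i + r} else {0})"
  have box: "PiE UNIV S \<subseteq> ?V"
  proof
    fix y assume y: "y \<in> PiE UNIV S"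
    then have yS: "y i \<in> S i" for i by auto
    have "\<bar>y i - x i\<bar> \<le> r" if "i < ?n" for i
      using that yS[of i] unfolding S_def by (auto simp: abs_le_iff)
    moreover have "y i = 0" if "i \<ge> ?n" for i
      using that yS[of i] unfolding S_def by auto
    ultimately show "y \<in> ?V" using r(2)[of y] x(2) T(2) by auto
  qed
  have "compactin (powertop_real UNIV) (PiE UNIV S)"
    unfolding compactin_PiE by (auto simp: S_def)
  moreover have "?V \<subseteq> {x. \<forall>i\<ge>?n. x i = 0}" using T(2) by auto
  ultimately have "compactin (subtopology (Euclidean_space ?n) ?V) (PiE UNIV S)"
    using box unfolding Euclidean_space_def subtopology_subtopology compactin_subtopology by auto
  then have "compactin (subtopology (base \<A>) (dom)) (inv\<^sub>x ` PiE UNIV S)"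
    using image_compactin continuous_map_chart_inv by blast
  then have C: "closedin (base \<A>) (inv\<^sub>x ` PiE UNIV S)" "inv\<^sub>x ` PiE UNIV S \<subseteq> dom"
    using compactin_imp_closedin gvb
    unfolding compactin_subtopology graded_vector_bundle_def smooth_manifold_def by blast+
  \<comment> \<open>Subtractions are written with \<open>- 1 *\<close> and \<open>+ -\<close> to fit
    the closure rules for constants, sums and products.\<close>
  define u where "u = (\<lambda>m. r\<^sup>2 + (\<Sum>i<?n. - 1 * ((crd m i + - x i) * (crd m i + - x i))))"
  define \<rho> where "\<rho> = (\<lambda>m. if m \<in> dom then flat_exp 1 (u m) else 0)"
  have u_le: "u m \<le> r\<^sup>2" for m
    unfolding u_def by (simp add: sum_nonneg sum_negf)
  have u0: "u m\<^sub>0 = r\<^sup>2" unfolding u_def x_def by simp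
  have supp: "m \<in> inv\<^sub>x ` PiE UNIV S" if "\<rho> m \<noteq> 0" for m
  proof -
    have m: "m \<in> dom" "0 < u m"
      using that unfolding \<rho>_def by (auto simp: flat_exp_1_nonzero_iff split: if_splits)
    have "crd m i \<in> S i" for i
    proof (cases "i < ?n")
      case True
      have "(crd m i - x i)\<^sup>2 \<le> (\<Sum>i<?n. (crd m i - x i)\<^sup>2)"
        using True by (intro member_le_sum) auto
      also have "\<dots> < r\<^sup>2" using m(2) unfolding u_def by (simp add: sum_negf power2_eq_square)
      finally have "\<bar>crd m i - x i\<bar> \<le> r"
        using r(1) abs_le_square_iff[of "crd m i - x i" r] by simp
      then show ?thesis using True unfolding S_def by (auto simp: abs_le_iff)
    next
      case False
      moreover have "crd m \<in> {x. \<forall>i\<ge>?n. x i = 0} \<inter> T" using T(2) m(1) by blast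
      ultimately show ?thesis unfolding S_def by auto
    qed
    then have "crd m \<in> PiE UNIV S" by auto
    then show ?thesis using chart_inv_chart[OF m(1)] by (metis imageI)
  qed
  have smooth_\<rho>: "smooth_in \<A> \<beta> (cdom \<A> \<beta> \<inter> dom) \<rho>" if \<beta>: "\<beta> \<in> idx \<A>" for \<beta>
  proof -
    interpret B: bundle_chart \<A> \<beta> by (rule other_chart[OF \<beta>])
    let ?W = "chart \<A> \<beta> ` (cdom \<A> \<beta> \<inter> dom)"
    note W = open_overlap_image[OF \<beta>]
    have c: "C_infinity_on ?n ?W (\<lambda>y. crd (chart_inv \<A> \<beta> y) j)" if "j < ?n" for j
      using gvb \<beta> chart_idx that unfolding graded_vector_bundle_def smooth_manifold_def smooth_in_def comp_def by blast
    have "C_infinity_on ?n ?W (\<lambda>y. flat_exp 1 (u (chart_inv \<A> \<beta> y)))"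
      unfolding u_def
      by (intro C_infinity_on_flat_exp[OF W] C_infinity_on_add[OF W] C_infinity_on_sum[OF W]
          C_infinity_on_mult[OF W] C_infinity_on_const[OF W]) (auto intro: c)
    then show ?thesis
      unfolding smooth_in_def by (rule C_infinity_on_cong[OF W, rotated]) (auto simp: \<rho>_def)
  qed
  have bump: "bump_on \<A> \<alpha> \<rho>"
    unfolding bump_on_def using C supp smooth_\<rho> by blast
  have \<rho>0: "\<rho> m\<^sub>0 \<noteq> 0"
    unfolding \<rho>_def using m\<^sub>0 u0 r(1) by (simp add: flat_exp_1_nonzero_iff)
  have max: "\<rho> m \<le> \<rho> m\<^sub>0" for m
    unfolding \<rho>_def u0 using m\<^sub>0 u_le[of m] r(1) by (auto intro: flat_exp_1_mono) (simp add: flat_exp_def u0)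
  have sm: "smooth \<rho>" using smooth_\<rho>[OF chart_idx] by simp
  \<comment> \<open>The maximum is global, so any radius will do in the criterion for local
    maxima.\<close>
  have "dM i \<rho> m\<^sub>0 = 0" if "i < ?n" for i
    by (rule DERIV_local_max[OF smooth_has_derivative[OF sm that m\<^sub>0] zero_less_one]) (use max m\<^sub>0 in simp)
  with bump \<rho>0 show ?thesis by (rule that)
qed

lemma bump_on_smooth: "bump_on \<A> \<alpha> \<rho> \<Longrightarrow> smooth \<rho>"
  unfolding bump_on_def using chart_idx by (metis inf.idem)

text \<open>With \<open>c\<close> minus the value of the coordinate at a point where \<rho> is
  nonzero, this yields a cut-off function that vanishes at the point and has a nonzero derivative
  there in direction \<open>k\<close> only.\<close>

lemma bump_on_coordinate_mult:
  assumes "bump_on \<A> \<alpha> \<rho>" "k < bdim \<A>"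
  shows "bump_on \<A> \<alpha> (\<lambda>m. (crd m k + c) * \<rho> m)"
proof -
  have "smooth_in \<A> \<beta> (cdom \<A> \<beta> \<inter> dom) (\<lambda>m. (crd m k + c) * \<rho> m)" if \<beta>: "\<beta> \<in> idx \<A>" for \<beta>
  proof -
    note W = open_overlap_image[OF \<beta>]
    have "smooth_in \<A> \<beta> (cdom \<A> \<beta> \<inter> dom) (\<lambda>m. crd m k)"
      using gvb \<beta> chart_idx assms(2) unfolding graded_vector_bundle_def smooth_manifold_def by blast
    then show ?thesis
      using assms(1) \<beta> unfolding bump_on_def smooth_in_def comp_def
      by (intro C_infinity_on_mult[OF W] C_infinity_on_add[OF W] C_infinity_on_const[OF W]) auto
  qed
  moreover obtain C where "closedin (base \<A>) C" "C \<subseteq> dom" "\<forall>m. \<rho> m \<noteq> 0 \<longrightarrow> m \<in> C"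
    using assms(1) unfolding bump_on_def by blast
  ultimately show ?thesis
    unfolding bump_on_def by (intro conjI exI[of _ C]) auto
qed

text \<open>The domain of \<beta> is covered by two open sets: the overlap, where the product of two
  smooth functions is smooth, and the complement of the closed support set, where the product is
  zero.\<close>

lemma smooth_bump_extension:
  assumes \<beta>: "\<beta> \<in> idx \<A>" and \<rho>: "bump_on \<A> \<alpha> \<rho>"
    and h: "smooth_in \<A> \<beta> (cdom \<A> \<beta> \<inter> dom) h"
  shows "smooth_in \<A> \<beta> (cdom \<A> \<beta>) (\<lambda>m. \<rho> m * h m)"
proof -
  interpret B: bundle_chart \<A> \<beta> by (rule other_chart[OF \<beta>])
  obtain C where C: "closedin (base \<A>) C" "C \<subseteq> dom" "\<And>m. \<rho> m \<noteq> 0 \<Longrightarrow> m \<in> C"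
    using \<rho> unfolding bump_on_def by blast
  note W = open_overlap_image[OF \<beta>]
  have "openin (base \<A>) (cdom \<A> \<beta> - C)" using B.open_chart_domain C(1) by blast
  then have W': "openin (E\<^sub>x) (chart \<A> \<beta> ` (cdom \<A> \<beta> - C))"
    by (rule B.open_chart_image_subset) auto
  have 1: "C_infinity_on (bdim \<A>) (chart \<A> \<beta> ` (cdom \<A> \<beta> \<inter> dom)) (\<lambda>x. \<rho> (chart_inv \<A> \<beta> x) * h (chart_inv \<A> \<beta> x))"
    using \<rho> \<beta> h unfolding bump_on_def smooth_in_def comp_def by (intro C_infinity_on_mult[OF W]) auto
  have 2: "C_infinity_on (bdim \<A>) (chart \<A> \<beta> ` (cdom \<A> \<beta> - C)) (\<lambda>x. \<rho> (chart_inv \<A> \<beta> x) * h (chart_inv \<A> \<beta> x))"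
    by (rule C_infinity_on_cong[OF W' _ C_infinity_on_const[OF W', of 0]]) (use C(3) in fastforce)
  show ?thesis
  proof (rule B.smoothI, rule C_infinity_on_local[OF B.open_chart_image])
    fix x assume "x \<in> chart \<A> \<beta> ` cdom \<A> \<beta>"
    then obtain m where m: "m \<in> cdom \<A> \<beta>" "x = chart \<A> \<beta> m" by auto
    show "\<exists>W. openin (E\<^sub>x) W \<and> x \<in> W \<and> W \<subseteq> chart \<A> \<beta> ` cdom \<A> \<beta> \<and>
        C_infinity_on (bdim \<A>) W (\<lambda>x. \<rho> (chart_inv \<A> \<beta> x) * h (chart_inv \<A> \<beta> x))"
    proof (cases "m \<in> dom")
      case True
      then show ?thesis using W 1 m by (intro exI[of _ "chart \<A> \<beta> ` (cdom \<A> \<beta> \<inter> dom)"]) auto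
    next
      case False
      then show ?thesis using W' 2 m C(2) by (intro exI[of _ "chart \<A> \<beta> ` (cdom \<A> \<beta> - C)"]) auto
    qed
  qed
qed

text \<open>The definition of a cocycle only gives smoothness of \<open>g \<alpha> \<beta>\<close> in chart \<open>\<alpha>\<close>. In chart \<open>\<beta>\<close> it is the inverse of
  the smooth matrix \<open>g \<beta> \<alpha>\<close>; this is what makes frames of the dual bundles smooth.\<close>

lemma cocycle_smooth_target:
  assumes g: "vector_bundle_cocycle \<A> r g" and \<beta>: "\<beta> \<in> idx \<A>" and jk: "j < r" "k < r"
  shows "smooth_in \<A> \<beta> (cdom \<A> \<beta> \<inter> dom) (\<lambda>m. g \<alpha> \<beta> m j k)"
proof -
  interpret B: bundle_chart \<A> \<beta> by (rule other_chart[OF \<beta>])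
  let ?U = "cdom \<A> \<beta> \<inter> dom" and ?E = "E\<^sub>x"
  note W = open_overlap_image[OF \<beta>]
  have W\<alpha>: "openin ?E (crd ` ?U)"
    by (rule open_chart_image_subset[OF open_overlap[OF \<beta>]]) auto
  have sub: "chart \<A> \<beta> ` ?U \<subseteq> topspace ?E" "crd ` ?U \<subseteq> topspace ?E"
    using openin_subset[OF W] openin_subset[OF W\<alpha>] .
  have id: "g \<beta> \<beta> m j k = (if j = k then 1 else 0)" if "m \<in> ?U" "j < r" "k < r" for m j k
    using g \<beta> that unfolding vector_bundle_cocycle_def by blast
  have comp: "g \<gamma> \<epsilon> m j k = (\<Sum>l<r. g \<gamma> \<delta> m j l * g \<delta> \<epsilon> m l k)"
    if "\<gamma> \<in> idx \<A>" "\<delta> \<in> idx \<A>" "\<epsilon> \<in> idx \<A>" "m \<in> cdom \<A> \<gamma> \<inter> cdom \<A> \<delta> \<inter> cdom \<A> \<epsilon>" "j < r" "k < r" for \<gamma> \<delta> \<epsilon> m j k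
    using g that unfolding vector_bundle_cocycle_def by blast
  have id\<alpha>: "g \<alpha> \<alpha> m j k = (if j = k then 1 else 0)" if "m \<in> ?U" "j < r" "k < r" for m j k
    using g chart_idx that unfolding vector_bundle_cocycle_def by blast
  have "C_infinity_on (bdim \<A>) (chart \<A> \<beta> ` ?U) (\<lambda>x. g \<alpha> \<beta> (chart_inv \<A> \<beta> x) j k)"
  proof (rule C_infinity_on_inverse_matrix[OF W,
        of r "\<lambda>j k x. g \<beta> \<alpha> (chart_inv \<A> \<beta> x) j k" "\<lambda>j k x. g \<alpha> \<beta> (chart_inv \<A> \<beta> x) j k"])
    fix j k assume jk: "j < r" "k < r"
    show "C_infinity_on (bdim \<A>) (chart \<A> \<beta> ` ?U) (\<lambda>x. g \<beta> \<alpha> (chart_inv \<A> \<beta> x) j k)"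
      using g \<beta> chart_idx jk unfolding vector_bundle_cocycle_def smooth_in_def comp_def by blast
    \<comment> \<open>In chart \<alpha> the entry is smooth, hence continuous. Composition with the
      change of chart gives continuity in chart \<beta>, which is what the inverse matrix lemma asks
      of the inverse.\<close>
    have "C_infinity_on (bdim \<A>) (crd ` ?U) (\<lambda>x. g \<alpha> \<beta> (inv\<^sub>x x) j k)"
      using g \<beta> chart_idx jk unfolding vector_bundle_cocycle_def smooth_in_def comp_def
      by (metis (no_types, lifting) inf_commute)
    then have "continuous_on (crd ` ?U) (\<lambda>x. g \<alpha> \<beta> (inv\<^sub>x x) j k)"
      using C_infinity_on_imp_line_differentiable[OF W\<alpha>] unfolding line_differentiable_on_def by blast
    then have c1: "continuous_map (subtopology ?E (crd ` ?U)) euclideanreal (\<lambda>x. g \<alpha> \<beta> (inv\<^sub>x x) j k)"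
      using continuous_map_Euclidean_subtopology_iff[OF sub(2)] by blast
    have "continuous_map (subtopology (base \<A>) (dom)) ?E (crd)"
      using homeomorphic_imp_continuous_map[OF chart_homeomorphic] continuous_map_in_subtopology by blast
    then have c2: "continuous_map (subtopology (base \<A>) ?U) (subtopology ?E (crd ` ?U)) (crd)"
      unfolding continuous_map_in_subtopology
      using continuous_map_from_subtopology_mono[of "base \<A>" "dom" ?E "crd" ?U]
      by auto
    have "continuous_map (subtopology ?E (chart \<A> \<beta> ` cdom \<A> \<beta>)) (base \<A>) (chart_inv \<A> \<beta>)"
      using B.continuous_map_chart_inv continuous_map_in_subtopology by blast
    then have c3: "continuous_map (subtopology ?E (chart \<A> \<beta> ` ?U)) (subtopology (base \<A>) ?U) (chart_inv \<A> \<beta>)"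
      unfolding continuous_map_in_subtopology
      using continuous_map_from_subtopology_mono[of ?E "chart \<A> \<beta> ` cdom \<A> \<beta>" "base \<A>" "chart_inv \<A> \<beta>" "chart \<A> \<beta> ` ?U"]
      by auto
    have "continuous_map (subtopology ?E (chart \<A> \<beta> ` ?U)) euclideanreal
        ((\<lambda>x. g \<alpha> \<beta> (inv\<^sub>x x) j k) \<circ> (crd \<circ> chart_inv \<A> \<beta>))"
      by (rule continuous_map_compose[OF continuous_map_compose[OF c3 c2] c1])
    then have "continuous_on (chart \<A> \<beta> ` ?U) ((\<lambda>x. g \<alpha> \<beta> (inv\<^sub>x x) j k) \<circ> (crd \<circ> chart_inv \<A> \<beta>))"
      using continuous_map_Euclidean_subtopology_iff[OF sub(1)] by blast
    then show "continuous_on (chart \<A> \<beta> ` ?U) (\<lambda>x. g \<alpha> \<beta> (chart_inv \<A> \<beta> x) j k)"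
      by (rule continuous_on_eq) auto
  next
    fix x j k assume x: "x \<in> chart \<A> \<beta> ` ?U" and jk: "j < r" "k < r"
    then obtain m where m: "m \<in> ?U" "chart_inv \<A> \<beta> x = m" by auto
    show "(\<Sum>l<r. g \<beta> \<alpha> (chart_inv \<A> \<beta> x) j l * g \<alpha> \<beta> (chart_inv \<A> \<beta> x) l k) = (if j = k then 1 else 0)"
      using comp[OF \<beta> chart_idx \<beta> _ jk, of m] id[OF m(1) jk] m by auto
    show "(\<Sum>l<r. g \<alpha> \<beta> (chart_inv \<A> \<beta> x) j l * g \<beta> \<alpha> (chart_inv \<A> \<beta> x) l k) = (if j = k then 1 else 0)"
      using comp[OF chart_idx \<beta> chart_idx _ jk, of m] id\<alpha>[OF m(1) jk] m by auto
  qed (use jk in auto)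
  then show ?thesis unfolding smooth_in_def comp_def .
qed

end

section \<open>Global sections from local frames\<close>

primrec gen_kind :: "gen \<Rightarrow> gen set" where
  "gen_kind (Xi _) = range Xi"
| "gen_kind (Th _) = range Th"
| "gen_kind (P _) = range P"
| "gen_kind (Xid _) = range Xid"
| "gen_kind (Thd _) = range Thd"

lemma adm_supported_var: "adm_supported (var z)"
  by (auto simp: adm_supported_def var_def)

context bundle_chart
begin

text \<open>A uniform treatment of the four subbundles: \<open>T\<close> is the law by which the
  coordinates \<open>c k\<close> change, and \<open>h\<close> \<beta> lists the components in chart
  \<beta> of a section over the domain of \<alpha>. Those components need to be compatible only
  inside that domain, since \<rho> vanishes elsewhere.\<close>

lemma bump_frame_in_gfuns:
  fixes c :: "nat \<Rightarrow> gen" and h :: "'i \<Rightarrow> 'm \<Rightarrow> nat \<Rightarrow> real" and T :: "'i \<Rightarrow> 'i \<Rightarrow> 'm \<Rightarrow> nat \<Rightarrow> nat \<Rightarrow> real"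
  assumes \<rho>: "bump_on \<A> \<alpha> \<rho>" and inj: "inj c" and c: "\<And>k. k < r \<Longrightarrow> c k \<in> gens \<A>"
    and change: "\<And>\<beta> \<gamma> k. k < r \<Longrightarrow>
      coord_change \<A> \<beta> \<gamma> (c k) = (\<Sum>l<r. fmul (\<lambda>m. T \<beta> \<gamma> m k l) (var (c l)))"
    and h: "\<And>\<beta> \<gamma> m l. \<beta> \<in> idx \<A> \<Longrightarrow> \<gamma> \<in> idx \<A> \<Longrightarrow> m \<in> cdom \<A> \<beta> \<Longrightarrow> m \<in> cdom \<A> \<gamma> \<Longrightarrow>
      m \<in> dom \<Longrightarrow> l < r \<Longrightarrow> h \<beta> m l = (\<Sum>k<r. h \<gamma> m k * T \<beta> \<gamma> m k l)"
    and smooth_h: "\<And>\<beta> k. \<beta> \<in> idx \<A> \<Longrightarrow> k < r \<Longrightarrow>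
      smooth_in \<A> \<beta> (cdom \<A> \<beta> \<inter> dom) (\<lambda>m. h \<beta> m k)"
  shows "(\<lambda>\<beta> A m. if \<beta> \<in> idx \<A> \<and> m \<in> cdom \<A> \<beta> then \<Sum>k<r. \<rho> m * h \<beta> m k * var (c k) A m else 0) \<in> gfuns \<A>"
    (is "?X \<in> _")
proof -
  have \<rho>0: "m \<notin> dom \<Longrightarrow> \<rho> m = 0" for m
    using \<rho> unfolding bump_on_def by blast
  have single: "?X \<beta> {#c k#} m = \<rho> m * h \<beta> m k" if "\<beta> \<in> idx \<A>" "m \<in> cdom \<A> \<beta>" "k < r" for \<beta> m k
  proof -
    have "(\<Sum>l<r. \<rho> m * h \<beta> m l * var (c l) {#c k#} m) = (\<Sum>l<r. if l = k then \<rho> m * h \<beta> m k else 0)"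
      using inj by (intro sum.cong) (auto simp: var_def inj_eq)
    then show ?thesis using that by simp
  qed
  have supp: "\<beta> \<in> idx \<A> \<and> m \<in> cdom \<A> \<beta> \<and> (\<exists>k<r. A = {#c k#})" if "?X \<beta> A m \<noteq> 0" for \<beta> A m
  proof -
    have 1: "\<beta> \<in> idx \<A>" "m \<in> cdom \<A> \<beta>" using that by (auto split: if_splits)
    then have "(\<Sum>k<r. \<rho> m * h \<beta> m k * var (c k) A m) \<noteq> 0" using that by simp
    then obtain k where "k < r" "var (c k) A m \<noteq> 0"
      by (metis (no_types, lifting) lessThan_iff mult_zero_right sum.neutral)
    then show ?thesis using 1 by (auto simp: var_def split: if_splits)
  qed
  have smooth_X: "smooth_in \<A> \<beta> (cdom \<A> \<beta>) (?X \<beta> A)" if \<beta>: "\<beta> \<in> idx \<A>" for \<beta> A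
  proof -
    interpret B: bundle_chart \<A> \<beta> by (rule other_chart[OF \<beta>])
    have "smooth_in \<A> \<beta> (cdom \<A> \<beta>) (\<lambda>m. \<Sum>k<r. \<rho> m * h \<beta> m k * var (c k) A m)"
    proof (intro B.smooth_sum B.smooth_mult[of "\<lambda>m. \<rho> m * h \<beta> m _"])
      show "smooth_in \<A> \<beta> (cdom \<A> \<beta>) (\<lambda>m. \<rho> m * h \<beta> m k)" if "k \<in> {..<r}" for k
        using that by (intro smooth_bump_extension[OF \<beta> \<rho>] smooth_h[OF \<beta>]) auto
      show "smooth_in \<A> \<beta> (cdom \<A> \<beta>) (var (c k) A)" for k
        using B.coef_smooth_var unfolding B.coef_smooth_def by blast
    qed auto
    then show ?thesis
      unfolding smooth_in_def
      by (rule C_infinity_on_cong[OF B.open_chart_image, rotated]) (auto simp: \<beta>)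
  qed
  have pull_X: "?X \<beta> A m = pull \<A> \<beta> \<gamma> (?X \<gamma>) A m"
    if \<beta>: "\<beta> \<in> idx \<A>" and \<gamma>: "\<gamma> \<in> idx \<A>" and m: "m \<in> cdom \<A> \<beta> \<inter> cdom \<A> \<gamma>" for \<beta> \<gamma> A m
  proof -
    define Y where "Y = ?X \<gamma>"
    let ?t = "\<lambda>B. Y B m * foldr lprod (map (coord_change \<A> \<beta> \<gamma>) (sorted_list_of_multiset B)) lone A m"
    have adm: "adm_supported (coord_change \<A> \<beta> \<gamma> (c k))" if "k < r" for k
      unfolding change[OF that] by (intro adm_supported_sum adm_supported_fmul adm_supported_var)
    have "pull \<A> \<beta> \<gamma> Y A m = (\<Sum>B | Y B m \<noteq> 0. ?t B)"
      unfolding pull_def ..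
    \<comment> \<open>\<open>pull\<close> sums over the monomials with nonzero coefficient at the
      point; padding with zeros gives an index set independent of the point.\<close>
    also have "\<dots> = (\<Sum>B\<in>(\<lambda>k. {#c k#}) ` {..<r}. ?t B)"
    proof (rule sum.mono_neutral_left)
      show "{B. Y B m \<noteq> 0} \<subseteq> (\<lambda>k. {#c k#}) ` {..<r}"
        using supp unfolding Y_def by fast
      show "\<forall>B\<in>(\<lambda>k. {#c k#}) ` {..<r} - {B. Y B m \<noteq> 0}. ?t B = 0" by simp
    qed simp
    also have "\<dots> = (\<Sum>k<r. ?t {#c k#})"
    proof (rule sum.reindex[unfolded comp_def])
      show "inj_on (\<lambda>k. {#c k#}) {..<r}" using inj by (simp add: inj_on_def)
    qed
    also have "\<dots> = (\<Sum>k<r. \<rho> m * h \<gamma> m k * (\<Sum>l<r. T \<beta> \<gamma> m k l * var (c l) A m))"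
    proof (rule sum.cong[OF refl])
      fix k assume "k \<in> {..<r}"
      then have k: "k < r" by simp
      have "foldr lprod (map (coord_change \<A> \<beta> \<gamma>) (sorted_list_of_multiset {#c k#})) lone
          = coord_change \<A> \<beta> \<gamma> (c k)"
        using lprod_lone_right[OF adm[OF k]] by simp
      moreover have "coord_change \<A> \<beta> \<gamma> (c k) A m = (\<Sum>l<r. T \<beta> \<gamma> m k l * var (c l) A m)"
        unfolding change[OF k] sum_lfun_apply fmul_apply ..
      moreover have "Y {#c k#} m = \<rho> m * h \<gamma> m k" using single[OF \<gamma> _ k] m unfolding Y_def by simp
      ultimately show "?t {#c k#} = \<rho> m * h \<gamma> m k * (\<Sum>l<r. T \<beta> \<gamma> m k l * var (c l) A m)"
        by (simp only:)
    qed
    also have "\<dots> = (\<Sum>l<r. \<rho> m * (\<Sum>k<r. h \<gamma> m k * T \<beta> \<gamma> m k l) * var (c l) A m)"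
      unfolding sum_distrib_left sum_distrib_right by (subst sum.swap) (simp only: mult_ac)
    also have "\<dots> = (\<Sum>l<r. \<rho> m * h \<beta> m l * var (c l) A m)"
    proof (cases "m \<in> dom")
      case True
      then show ?thesis using h[OF \<beta> \<gamma> _ _ True] m by simp
    qed (simp add: \<rho>0)
    finally show ?thesis using \<beta> m unfolding Y_def by simp
  qed
  have deg_le: "deg z \<le> 3" for z by (cases z) auto
  have "\<forall>\<beta> A m. ?X \<beta> A m \<noteq> 0 \<longrightarrow> (\<Sum>z\<in>#A. deg z) \<le> 3"
    using supp deg_le by fastforce
  moreover have "\<forall>\<beta> A m. ?X \<beta> A m \<noteq> 0 \<longrightarrow> \<beta> \<in> idx \<A> \<and> m \<in> cdom \<A> \<beta> \<and> set_mset A \<subseteq> gens \<A> \<and> admissible A"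
    using supp c by fastforce
  ultimately show ?thesis
    unfolding gfuns_def mem_Collect_eq using smooth_X pull_X by blast
qed

text \<open>A coordinate \<open>Xi j\<close> or \<open>Th j\<close> of chart \<alpha> has as
  components in chart \<beta> a row of the matrix from \<beta> to \<alpha>, and its smoothness in
  chart \<beta> is \<open>cocycle_smooth_target\<close>. A frame element \<open>Xid j\<close> or
  \<open>Thd j\<close> gives a column of the opposite matrix, smooth in chart \<beta> by the cocycle
  definition. Compatibility is the cocycle identity in both cases.\<close>

lemma frame_section:
  assumes \<rho>: "bump_on \<A> \<alpha> \<rho>" and z: "z \<in> fibre_gens \<A>"
  shows "\<exists>X\<in>linear_funs \<A> (gen_kind z). X \<alpha> = fmul \<rho> (var z) \<and> homogeneous (deg z) X"
proof -
  have sections: ?thesis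
    if inj: "inj c" and c: "\<And>k. k < r \<Longrightarrow> c k \<in> gens \<A>" and z: "z = c j" "j < r"
      and kind: "gen_kind z = range c" and deg: "\<And>k. deg (c k) = deg z"
      and change: "\<And>\<beta> \<gamma> k. k < r \<Longrightarrow>
        coord_change \<A> \<beta> \<gamma> (c k) = (\<Sum>l<r. fmul (\<lambda>m. T \<beta> \<gamma> m k l) (var (c l)))"
      and h: "\<And>\<beta> \<gamma> m l. \<beta> \<in> idx \<A> \<Longrightarrow> \<gamma> \<in> idx \<A> \<Longrightarrow> m \<in> cdom \<A> \<beta> \<Longrightarrow> m \<in> cdom \<A> \<gamma> \<Longrightarrow>
        m \<in> dom \<Longrightarrow> l < r \<Longrightarrow> h \<beta> m l = (\<Sum>k<r. h \<gamma> m k * T \<beta> \<gamma> m k l)"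
      and smooth_h: "\<And>\<beta> k. \<beta> \<in> idx \<A> \<Longrightarrow> k < r \<Longrightarrow>
        smooth_in \<A> \<beta> (cdom \<A> \<beta> \<inter> dom) (\<lambda>m. h \<beta> m k)"
      and h\<alpha>: "\<And>m k. m \<in> dom \<Longrightarrow> k < r \<Longrightarrow> h \<alpha> m k = (if k = j then 1 else 0)"
    for c :: "nat \<Rightarrow> gen" and r j T h
  proof -
    define X where "X = (\<lambda>\<beta> A m. if \<beta> \<in> idx \<A> \<and> m \<in> cdom \<A> \<beta> then \<Sum>k<r. \<rho> m * h \<beta> m k * var (c k) A m else 0)"
    have X: "X \<in> gfuns \<A>"
      unfolding X_def by (rule bump_frame_in_gfuns[where T = T]) (fact \<rho> inj c change h smooth_h)+
    have supp: "\<exists>k<r. A = {#c k#}" if "X \<beta> A m \<noteq> 0" for \<beta> A m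
    proof -
      have "(\<Sum>k<r. \<rho> m * h \<beta> m k * var (c k) A m) \<noteq> 0" using that unfolding X_def by (auto split: if_splits)
      then obtain k where "k < r" "var (c k) A m \<noteq> 0"
        by (metis (no_types, lifting) lessThan_iff mult_zero_right sum.neutral)
      then show ?thesis by (auto simp: var_def split: if_splits)
    qed
    have "X \<alpha> = fmul \<rho> (var z)"
    proof (intro ext)
      fix A m
      show "X \<alpha> A m = fmul \<rho> (var z) A m"
      proof (cases "m \<in> dom")
        case True
        have "(\<Sum>k<r. \<rho> m * h \<alpha> m k * var (c k) A m) = (\<Sum>k<r. if k = j then \<rho> m * var (c j) A m else 0)"
          using h\<alpha>[OF True] by (intro sum.cong) auto
        then show ?thesis using True chart_idx z unfolding X_def fmul_apply by simp
      next
        case False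
        then have "\<rho> m = 0" using \<rho> unfolding bump_on_def by blast
        then show ?thesis using False unfolding X_def fmul_apply by simp
      qed
    qed
    moreover have "X \<in> linear_funs \<A> (gen_kind z)"
      unfolding linear_funs_def kind using X supp by blast
    moreover have "homogeneous (deg z) X"
      unfolding homogeneous_def using supp deg by fastforce
    ultimately show ?thesis by blast
  qed
  have g1: "vector_bundle_cocycle \<A> (rk\<^sub>1 \<A>) (tr\<^sub>1 \<A>)" and g2: "vector_bundle_cocycle \<A> (rk\<^sub>2 \<A>) (tr\<^sub>2 \<A>)"
    using gvb unfolding graded_vector_bundle_def by auto
  have cocycle: "g \<beta> \<epsilon> m j k = (\<Sum>l<r. g \<beta> \<gamma> m j l * g \<gamma> \<epsilon> m l k)"
    if "vector_bundle_cocycle \<A> r g" "\<beta> \<in> idx \<A>" "\<gamma> \<in> idx \<A>" "\<epsilon> \<in> idx \<A>"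
      "m \<in> cdom \<A> \<beta>" "m \<in> cdom \<A> \<gamma>" "m \<in> cdom \<A> \<epsilon>" "j < r" "k < r" for r g \<beta> \<gamma> \<epsilon> m j k
    using that unfolding vector_bundle_cocycle_def by blast
  have cocycle_id: "g \<alpha> \<alpha> m j k = (if j = k then 1 else 0)"
    if "vector_bundle_cocycle \<A> r g" "m \<in> dom" "j < r" "k < r" for r g m j k
    using that chart_idx unfolding vector_bundle_cocycle_def by blast
  have cocycle_smooth: "smooth_in \<A> \<beta> (cdom \<A> \<beta> \<inter> dom) (\<lambda>m. g \<beta> \<alpha> m j k)"
    if "vector_bundle_cocycle \<A> r g" "\<beta> \<in> idx \<A>" "j < r" "k < r" for r g \<beta> j k
    using that chart_idx unfolding vector_bundle_cocycle_def by blast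
  consider j where "z = Xi j" "j < rk\<^sub>1 \<A>" | j where "z = Th j" "j < rk\<^sub>2 \<A>"
    | j where "z = Xid j" "j < rk\<^sub>1 \<A>" | j where "z = Thd j" "j < rk\<^sub>2 \<A>"
    using z unfolding fibre_gens_def by auto
  then show ?thesis
  proof cases
    case 1
    show ?thesis
      by (rule sections[where c = Xi and r = "rk\<^sub>1 \<A>" and j = j and T = "\<lambda>\<beta> \<gamma> m k l. tr\<^sub>1 \<A> \<gamma> \<beta> m k l"
            and h = "\<lambda>\<beta> m k. tr\<^sub>1 \<A> \<alpha> \<beta> m j k"])
        (use 1 chart_idx in \<open>auto simp: gens_def inj_def cocycle_id[OF g1] intro: cocycle_smooth_target[OF g1] cocycle[OF g1]\<close>)
  next
    case 2
    show ?thesis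
      by (rule sections[where c = Th and r = "rk\<^sub>2 \<A>" and j = j and T = "\<lambda>\<beta> \<gamma> m k l. tr\<^sub>2 \<A> \<gamma> \<beta> m k l"
            and h = "\<lambda>\<beta> m k. tr\<^sub>2 \<A> \<alpha> \<beta> m j k"])
        (use 2 chart_idx in \<open>auto simp: gens_def inj_def cocycle_id[OF g2] intro: cocycle_smooth_target[OF g2] cocycle[OF g2]\<close>)
  next
    case 3
    show ?thesis
      by (rule sections[where c = Xid and r = "rk\<^sub>1 \<A>" and j = j and T = "\<lambda>\<beta> \<gamma> m k l. tr\<^sub>1 \<A> \<beta> \<gamma> m l k"
            and h = "\<lambda>\<beta> m k. tr\<^sub>1 \<A> \<beta> \<alpha> m k j"])
        (use 3 chart_idx in \<open>auto simp: gens_def inj_def Xid_change_def cocycle_id[OF g1] mult.commute[of "tr\<^sub>1 \<A> _ \<alpha> _ _ _"]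
          intro: cocycle_smooth[OF g1] cocycle[OF g1]\<close>)
  next
    case 4
    show ?thesis
      by (rule sections[where c = Thd and r = "rk\<^sub>2 \<A>" and j = j and T = "\<lambda>\<beta> \<gamma> m k l. tr\<^sub>2 \<A> \<beta> \<gamma> m l k"
            and h = "\<lambda>\<beta> m k. tr\<^sub>2 \<A> \<beta> \<alpha> m k j"])
        (use 4 chart_idx in \<open>auto simp: gens_def inj_def Thd_change_def cocycle_id[OF g2] mult.commute[of "tr\<^sub>2 \<A> _ \<alpha> _ _ _"]
          intro: cocycle_smooth[OF g2] cocycle[OF g2]\<close>)
  qed
qed

end

section \<open>Tridegrees and nondegeneracy\<close>

definition mtdeg :: "gen multiset \<Rightarrow> nat \<times> nat \<times> nat" where "mtdeg A = (\<Sum>z\<in>#A. tdeg z)"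

lemma mtdeg_simps [simp]:
  "mtdeg {#} = 0" "mtdeg (add_mset z A) = tdeg z + mtdeg A" "mtdeg (A + B) = mtdeg A + mtdeg B"
  by (simp_all add: mtdeg_def)

lemma mdeg_mtdeg: "mdeg A = fst (mtdeg A) + fst (snd (mtdeg A)) + snd (snd (mtdeg A))"
proof (induction A)
  case (add z A)
  then show ?case by (cases z) (simp_all add: fst_add snd_add)
qed simp

lemma tdeg_dual_gen: "w \<in> fibre_gens \<A> \<Longrightarrow> tdeg (dual_gen w) + tdeg w = (1, 1, 1)"
  by (auto simp: fibre_gens_def)

lemma lprod_nonzeroE:
  assumes "lprod F G A m \<noteq> 0"
  obtains B C where "A = B + C" "F B m \<noteq> 0" "G C m \<noteq> 0"
proof -
  have "(\<Sum>(B, C)\<in>splits A. koszul B C * F B m * G C m) \<noteq> 0"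
    using assms by (auto simp: lprod_splits split: if_splits)
  then obtain B C where "(B, C) \<in> splits A" "koszul B C * F B m * G C m \<noteq> 0"
    by (auto elim: sum.not_neutral_contains_not_neutral)
  then show ?thesis using that by (auto simp: splits_def)
qed

lemma xderiv_nonzeroE:
  assumes "xderiv \<A> \<alpha> i F B m \<noteq> 0"
  obtains m' where "F B m' \<noteq> 0"
  using assms pd_const[of \<A> \<alpha> i 0] unfolding xderiv_def by (metis ext)

text \<open>Each summand of the bracket removes one Darboux pair, of total tridegree (1, 1, 1); a
  base coordinate counts as (0, 0, 0). The points \<open>m\<^sub>1\<close> and
  \<open>m\<^sub>2\<close> may differ from \<open>m\<close>, since a derivative of a coefficient can
  be nonzero where the coefficient vanishes.\<close>

lemma lbracket_nonzeroE:
  assumes nz: "lbracket \<A> \<alpha> F G A m \<noteq> 0"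
  obtains B C m\<^sub>1 m\<^sub>2 where "F B m\<^sub>1 \<noteq> 0" "G C m\<^sub>2 \<noteq> 0" "mtdeg A + (1, 1, 1) = mtdeg B + mtdeg C"
    "set_mset A \<subseteq> set_mset B \<union> set_mset C"
proof -
  have r: "F (add_mset w B) m \<noteq> 0" if "rderiv w F B m \<noteq> 0" for w B using that by (auto simp: rderiv_def)
  have l: "G (add_mset w B) m \<noteq> 0" if "lderiv w G B m \<noteq> 0" for w B using that by (auto simp: lderiv_def)
  have "(\<exists>w\<in>fibre_gens \<A>. lprod (rderiv (dual_gen w) F) (lderiv w G) A m \<noteq> 0) \<or>
    (\<exists>i. lprod (xderiv \<A> \<alpha> i F) (lderiv (P i) G) A m \<noteq> 0) \<or> (\<exists>i. lprod (rderiv (P i) F) (xderiv \<A> \<alpha> i G) A m \<noteq> 0)"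
  proof (rule ccontr)
    assume "\<not> ?thesis"
    then have "lbracket \<A> \<alpha> F G A m = 0"
      unfolding lbracket_fibre_gens by (simp add: sum_lfun_apply fmul_apply)
    with nz show False by simp
  qed
  then show thesis
  proof (elim disjE bexE exE)
    fix w assume w: "w \<in> fibre_gens \<A>" "lprod (rderiv (dual_gen w) F) (lderiv w G) A m \<noteq> 0"
    from w(2) obtain B C where A: "A = B + C" and BC: "rderiv (dual_gen w) F B m \<noteq> 0" "lderiv w G C m \<noteq> 0"
      by (rule lprod_nonzeroE)
    show thesis
      by (rule that[OF r[OF BC(1)] l[OF BC(2)]])
        (auto simp only: A tdeg_dual_gen[OF w(1), symmetric] mtdeg_simps ac_simps set_mset_union
          set_mset_add_mset_insert)
  next
    fix i assume "lprod (xderiv \<A> \<alpha> i F) (lderiv (P i) G) A m \<noteq> 0"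
    then obtain B C where A: "A = B + C" and BC: "xderiv \<A> \<alpha> i F B m \<noteq> 0" "lderiv (P i) G C m \<noteq> 0"
      by (rule lprod_nonzeroE)
    from BC(1) obtain m' where "F B m' \<noteq> 0" by (rule xderiv_nonzeroE)
    then show thesis
      by (rule that[OF _ l[OF BC(2)]]) (use A in \<open>auto simp: ac_simps\<close>)
  next
    fix i assume "lprod (rderiv (P i) F) (xderiv \<A> \<alpha> i G) A m \<noteq> 0"
    then obtain B C where A: "A = B + C" and BC: "rderiv (P i) F B m \<noteq> 0" "xderiv \<A> \<alpha> i G C m \<noteq> 0"
      by (rule lprod_nonzeroE)
    from BC(2) obtain m' where "G C m' \<noteq> 0" by (rule xderiv_nonzeroE)
    then show thesis
      by (rule that[OF r[OF BC(1)]]) (use A in \<open>auto simp: ac_simps\<close>)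
  qed
qed

definition tri_supported :: "nat \<times> nat \<times> nat \<Rightarrow> 'm lfun \<Rightarrow> bool" where
  "tri_supported t F \<longleftrightarrow> (\<forall>A m. F A m \<noteq> 0 \<longrightarrow> mtdeg A = t)"

lemma tri_supported_lbracket:
  assumes "tri_supported s F" "tri_supported t G" "lbracket \<A> \<alpha> F G A m \<noteq> 0"
  shows "mtdeg A + (1, 1, 1) = s + t"
  using assms lbracket_nonzeroE[OF assms(3)] unfolding tri_supported_def by metis

lemma multiset_component_split:
  fixes c :: "nat \<times> nat \<times> nat \<Rightarrow> nat"
  assumes c: "\<And>s t. c (s + t) = c s + c t" "c 0 = 0" and "c (mtdeg A) \<noteq> 0"
  obtains z B where "A = add_mset z B" "c (tdeg z) \<noteq> 0"
proof -
  have "\<exists>z\<in>#A. c (tdeg z) \<noteq> 0"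
    using assms(3) by (induction A) (auto simp: c)
  then show ?thesis using that by (meson multi_member_split)
qed

section \<open>The shape of the monomials in the mixed brackets\<close>

text \<open>The second component is 2, and the coordinates contributing to it, each with 1, are
  \<open>Xi\<close>, \<open>Th\<close> and \<open>P\<close>; hence two of these occur. A
  \<open>P\<close> uses up the first component, so its companion is an \<open>Xi j\<close>, and no
  \<open>Xid\<close> is left in the rest.\<close>

lemma mtdeg_two_lower:
  assumes "mtdeg A = (1, 2, 2) \<or> mtdeg A = (0, 2, 3)"
  shows "(\<exists>w\<^sub>1 w\<^sub>2 B. A = add_mset w\<^sub>1 (add_mset w\<^sub>2 B) \<and> {dual_gen w\<^sub>1, dual_gen w\<^sub>2} \<subseteq> range Xid \<union> range Thd) \<or>
    (\<exists>k w B. A = add_mset (P k) (add_mset w B) \<and> dual_gen w \<in> range Xid \<union> range Thd \<and> dual_gen w \<notin># B)"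
proof -
  have split: "\<exists>z B. A = add_mset z B \<and> fst (snd (tdeg z)) \<noteq> 0" if "fst (snd (mtdeg A)) \<noteq> 0" for A
    using multiset_component_split[of "\<lambda>t. fst (snd t)" A] that by (metis fst_add fst_zero snd_add snd_zero)
  obtain a A' where A: "A = add_mset a A'" "fst (snd (tdeg a)) \<noteq> 0" using split[of A] assms by auto
  have "fst (snd (mtdeg A')) \<noteq> 0" using A assms by (cases a) (auto simp: plus_prod_def)
  then obtain b B where A': "A' = add_mset b B" "fst (snd (tdeg b)) \<noteq> 0" using split[of A'] by auto
  have nb: "fst (mtdeg B) = 0 \<Longrightarrow> Xid j \<notin># B" for j
    by (auto simp: fst_add dest!: multi_member_split)
  consider "{dual_gen a, dual_gen b} \<subseteq> range Xid \<union> range Thd" | k where "a = P k" | k where "b = P k"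
    using A(2) A'(2) by (cases a; cases b) auto
  then show ?thesis
  proof cases
    case 1
    with A(1) A'(1) show ?thesis by (intro disjI1 exI conjI) simp_all
  next
    case 2
    then obtain j where "b = Xi j" "fst (mtdeg B) = 0"
      using A A' assms by (cases b) (auto simp: plus_prod_def)
    then show ?thesis
      using 2 A(1) A'(1) nb by (intro disjI2 exI[of _ k] exI[of _ b] exI[of _ B]) simp
  next
    case 3
    then obtain j where "a = Xi j" "fst (mtdeg B) = 0"
      using A A' assms by (cases a) (auto simp: plus_prod_def)
    then show ?thesis
      using 3 A(1) A'(1) nb by (intro disjI2 exI[of _ k] exI[of _ a] exI[of _ B]) (simp add: add_mset_commute)
  qed
qed

text \<open>The mirror image with the third component, carried by \<open>Xid\<close>,
  \<open>Thd\<close> and \<open>P\<close>. Next to a \<open>P\<close> only a \<open>Thd j\<close> is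
  possible, and the rest contains no \<open>Th\<close>.\<close>

lemma mtdeg_two_upper:
  assumes "mtdeg A = (1, 2, 2) \<or> mtdeg A = (0, 3, 2)"
  shows "(\<exists>w\<^sub>1 w\<^sub>2 B. A = add_mset w\<^sub>1 (add_mset w\<^sub>2 B) \<and> {dual_gen w\<^sub>1, dual_gen w\<^sub>2} \<subseteq> range Xi \<union> range Th) \<or>
    (\<exists>k w B. A = add_mset (P k) (add_mset w B) \<and> dual_gen w \<in> range Xi \<union> range Th \<and> dual_gen w \<notin># B)"
proof -
  have split: "\<exists>z B. A = add_mset z B \<and> snd (snd (tdeg z)) \<noteq> 0" if "snd (snd (mtdeg A)) \<noteq> 0" for A
    using multiset_component_split[of "\<lambda>t. snd (snd t)" A] that by (metis snd_add snd_zero)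
  obtain a A' where A: "A = add_mset a A'" "snd (snd (tdeg a)) \<noteq> 0" using split[of A] assms by auto
  have "snd (snd (mtdeg A')) \<noteq> 0" using A assms by (cases a) (auto simp: plus_prod_def)
  then obtain b B where A': "A' = add_mset b B" "snd (snd (tdeg b)) \<noteq> 0" using split[of A'] by auto
  have nb: "fst (mtdeg B) = 0 \<Longrightarrow> Th j \<notin># B" for j
    by (auto simp: fst_add dest!: multi_member_split)
  consider "{dual_gen a, dual_gen b} \<subseteq> range Xi \<union> range Th" | k where "a = P k" | k where "b = P k"
    using A(2) A'(2) by (cases a; cases b) auto
  then show ?thesis
  proof cases
    case 1
    with A(1) A'(1) show ?thesis by (intro disjI1 exI conjI) simp_all
  next
    case 2
    then obtain j where "b = Thd j" "fst (mtdeg B) = 0"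
      using A A' assms by (cases b) (auto simp: plus_prod_def)
    then show ?thesis
      using 2 A(1) A'(1) nb by (intro disjI2 exI[of _ k] exI[of _ b] exI[of _ B]) simp
  next
    case 3
    then obtain j where "a = Thd j" "fst (mtdeg B) = 0"
      using A A' assms by (cases a) (auto simp: plus_prod_def)
    then show ?thesis
      using 3 A(1) A'(1) nb by (intro disjI2 exI[of _ k] exI[of _ a] exI[of _ B]) (simp add: add_mset_commute)
  qed
qed

context bundle_chart
begin

section \<open>Recovering coefficients at a point\<close>

text \<open>With the derivative of \<rho> zero at \<open>m\<^sub>0\<close>, bracketing with a frame
  element cut off by \<rho> is there a nonzero multiple of the derivative in the dual coordinate;
  doing it twice reads off the first coefficient. In the second part \<open>z\<^sub>2\<close> is
  left over as a factor, and \<open>z\<^sub>2 \<notin># B\<close> ensures that its product with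
  \<open>B\<close> survives whatever its parity.\<close>

lemma iterated_linear_bracket_eq_0D:
  assumes H: "adm_supported H" and m: "m\<^sub>0 \<in> dom"
    and z: "z\<^sub>1 \<in> fibre_gens \<A>" "z\<^sub>2 \<in> fibre_gens \<A>"
    and zero: "\<And>X Y A. X \<in> linear_funs \<A> (gen_kind z\<^sub>1) \<Longrightarrow> homogeneous (deg z\<^sub>1) X \<Longrightarrow>
      Y \<in> linear_funs \<A> (gen_kind z\<^sub>2) \<Longrightarrow> brk (brk H (X \<alpha>)) (Y \<alpha>) A m\<^sub>0 = 0"
  shows "H (add_mset (dual_gen z\<^sub>1) (add_mset (dual_gen z\<^sub>2) B)) m\<^sub>0 = 0"
    "k < bdim \<A> \<Longrightarrow> z\<^sub>2 \<notin># B \<Longrightarrow> H (add_mset (P k) (add_mset (dual_gen z\<^sub>1) B)) m\<^sub>0 = 0"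
proof -
  obtain \<rho> where \<rho>: "bump_on \<A> \<alpha> \<rho>" "\<rho> m\<^sub>0 \<noteq> 0" "\<And>i. i < bdim \<A> \<Longrightarrow> dM i \<rho> m\<^sub>0 = 0"
    using bump_exists[OF m] by blast
  define H\<^sub>1 where "H\<^sub>1 = linear_ad \<rho> z\<^sub>1 H"
  have sign: "pair_sign z\<^sub>1 \<noteq> 0" "pair_sign z\<^sub>2 \<noteq> 0" using z by (auto simp: fibre_gens_def)
  have H1: "H\<^sub>1 A m\<^sub>0 = pair_sign z\<^sub>1 * \<rho> m\<^sub>0 * rderiv (dual_gen z\<^sub>1) H A m\<^sub>0" for A
    unfolding H\<^sub>1_def linear_ad_apply using \<rho>(3) by simp
  have H1_zero: "H (add_mset (dual_gen z\<^sub>1) A) m\<^sub>0 = 0" if "H\<^sub>1 A m\<^sub>0 = 0" for A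
    using that H1[of A] \<rho>(2) sign(1) by (auto simp: rderiv_def add_pos_nonneg)
  have bracket: "linear_ad \<sigma> z\<^sub>2 H\<^sub>1 A m\<^sub>0 = 0" if \<sigma>: "bump_on \<A> \<alpha> \<sigma>" for \<sigma> A
  proof -
    obtain X where X: "X \<in> linear_funs \<A> (gen_kind z\<^sub>1)" "X \<alpha> = fmul \<rho> (var z\<^sub>1)" "homogeneous (deg z\<^sub>1) X"
      using frame_section[OF \<rho>(1) z(1)] by blast
    obtain Y where Y: "Y \<in> linear_funs \<A> (gen_kind z\<^sub>2)" "Y \<alpha> = fmul \<sigma> (var z\<^sub>2)"
      using frame_section[OF \<sigma> z(2)] by blast
    have "brk (brk H (X \<alpha>)) (Y \<alpha>) = linear_ad \<sigma> z\<^sub>2 H\<^sub>1"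
      unfolding X(2) Y(2) lbracket_linear[OF H z(1)] H\<^sub>1_def
      by (rule lbracket_linear[OF adm_supported_linear_ad[OF H] z(2)])
    then show ?thesis using zero[OF X(1,3) Y(1)] by simp
  qed
  have "rderiv (dual_gen z\<^sub>2) H\<^sub>1 B m\<^sub>0 = 0" for B
    using bracket[OF \<rho>(1), of B] \<rho>(2,3) sign(2) unfolding linear_ad_apply by simp
  then have "H\<^sub>1 (add_mset (dual_gen z\<^sub>2) B) m\<^sub>0 = 0"
    by (auto simp: rderiv_def add_pos_nonneg)
  then show "H (add_mset (dual_gen z\<^sub>1) (add_mset (dual_gen z\<^sub>2) B)) m\<^sub>0 = 0"
    by (rule H1_zero)
  assume k: "k < bdim \<A>" and z2: "z\<^sub>2 \<notin># B"
  \<comment> \<open>Since \<open>x\<close> vanishes at \<open>m\<^sub>0\<close>, the derivative in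
    the dual of \<open>z\<^sub>2\<close> drops out; since its gradient there points in direction
    \<open>k\<close>, what remains is the derivative in \<open>P k\<close> times
    \<open>z\<^sub>2\<close>.\<close>
  define x where "x = (\<lambda>m. crd m k + - crd m\<^sub>0 k)"
  have \<sigma>: "bump_on \<A> \<alpha> (\<lambda>m. x m * \<rho> m)"
    unfolding x_def by (rule bump_on_coordinate_mult[OF \<rho>(1) k])
  have x: "smooth x" "x m\<^sub>0 = 0"
    unfolding x_def by (rule smooth_add[OF smooth_coordinate smooth_const]) simp
  have "dM i x m\<^sub>0 = (if i = k then 1 else 0)" if "i < bdim \<A>" for i
    unfolding x_def pd_add[OF smooth_coordinate smooth_const that]
    using pd_coordinate[OF m that] by simp
  then have pd_\<sigma>: "dM i (\<lambda>m. x m * \<rho> m) m\<^sub>0 = (if i = k then \<rho> m\<^sub>0 else 0)" if "i < bdim \<A>" for i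
    using pd_mult[OF x(1) bump_on_smooth[OF \<rho>(1)] that] x(2) that by simp
  have "(\<Sum>i<bdim \<A>. dM i (\<lambda>m. x m * \<rho> m) m\<^sub>0 * lprod (rderiv (P i) H\<^sub>1) (var z\<^sub>2) (add_mset z\<^sub>2 B) m\<^sub>0) =
     (\<Sum>i<bdim \<A>. if i = k then \<rho> m\<^sub>0 * lprod (rderiv (P i) H\<^sub>1) (var z\<^sub>2) (add_mset z\<^sub>2 B) m\<^sub>0 else 0)"
    by (rule sum.cong) (auto simp: pd_\<sigma>)
  then have "lprod (rderiv (P k) H\<^sub>1) (var z\<^sub>2) (add_mset z\<^sub>2 B) m\<^sub>0 = 0"
    using bracket[OF \<sigma>, of "add_mset z\<^sub>2 B"] x(2) \<rho>(2) k unfolding linear_ad_apply by simp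
  then have or: "\<not> admissible (add_mset z\<^sub>2 B) \<or> H\<^sub>1 (add_mset (P k) B) m\<^sub>0 = 0"
    unfolding lprod_var_right by (auto simp: rderiv_def add_pos_nonneg split: if_splits)
  show "H (add_mset (P k) (add_mset (dual_gen z\<^sub>1) B)) m\<^sub>0 = 0"
  proof (rule ccontr)
    assume nz: "H (add_mset (P k) (add_mset (dual_gen z\<^sub>1) B)) m\<^sub>0 \<noteq> 0"
    then have "admissible B"
      using H admissible_add_msetD(1) unfolding adm_supported_def by blast
    then have "admissible (add_mset z\<^sub>2 B)" using z2 by (simp add: admissible_add_mset_iff)
    with or have "H\<^sub>1 (add_mset (P k) B) m\<^sub>0 = 0" by simp
    then show False using nz H1_zero[of "add_mset (P k) B"] by (simp add: add_mset_commute)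
  qed
qed

lemma lbracket_commute:
  assumes "graded 0 F" "graded 0 G"
  shows "brk F G = brk G F"
  using lbracket_antisym[OF assms] by (simp add: fmul_def)

lemma linear_funs_local:
  assumes X: "X \<in> linear_funs \<A> K" and K: "K \<inter> range P = {}"
  shows "X \<alpha> = (\<Sum>z\<in>fibre_gens \<A>. fmul (X \<alpha> {#z#}) (var z))" "\<And>z. smooth (X \<alpha> {#z#})"
proof -
  have G: "X \<in> gfuns \<A>" and lin: "\<And>A m. X \<alpha> A m \<noteq> 0 \<Longrightarrow> \<exists>z\<in>K. A = {#z#}"
    using X unfolding linear_funs_def by auto
  have gen: "set_mset A \<subseteq> gens \<A>" if "X \<alpha> A m \<noteq> 0" for A m
    using G that unfolding gfuns_def by blast
  show "smooth (X \<alpha> {#z#})" for z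
    using G chart_idx unfolding gfuns_def by blast
  show "X \<alpha> = (\<Sum>z\<in>fibre_gens \<A>. fmul (X \<alpha> {#z#}) (var z))"
  proof (intro ext)
    fix A m
    have "(\<Sum>z\<in>fibre_gens \<A>. X \<alpha> {#z#} m * var z A m) = X \<alpha> A m"
    proof (cases "X \<alpha> A m = 0")
      case True
      then show ?thesis by (auto simp: var_def intro!: sum.neutral)
    next
      case False
      then obtain z where z: "z \<in> K" "A = {#z#}" using lin by blast
      have "z \<in> fibre_gens \<A>" using gen[OF False] z K by (auto simp: gens_def fibre_gens_def)
      moreover have "(\<Sum>w\<in>fibre_gens \<A>. X \<alpha> {#w#} m * var w A m) = (\<Sum>w\<in>fibre_gens \<A>. if w = z then X \<alpha> {#z#} m else 0)"
        using z by (intro sum.cong) (auto simp: var_def)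
      ultimately show ?thesis using z by simp
    qed
    then show "X \<alpha> A m = (\<Sum>z\<in>fibre_gens \<A>. fmul (X \<alpha> {#z#}) (var z)) A m"
      by (simp add: sum_lfun_apply fmul_apply)
  qed
qed

lemma gfuns_coef_smooth: "F \<in> gfuns \<A> \<Longrightarrow> coef_smooth (F \<alpha>)"
  using chart_idx unfolding gfuns_def coef_smooth_def by blast

text \<open>The Jacobi identity for \<open>X\<close>, then for \<open>Y\<close> with
  \<open>b M (X \<alpha>)\<close> as middle argument. That argument has parity \<open>d + 1\<close>,
  which becomes \<open>d + 2\<close> after the shift and gives the sign
  \<open>(-1) ^ d\<close>.\<close>

lemma lbracket_derivation_defect:
  assumes C: "graded 0 C" "coef_smooth C" and M: "graded 0 M" "coef_smooth M"
    and X: "X \<in> linear_funs \<A> K" and Y: "Y \<in> linear_funs \<A> K" and K: "K \<inter> range P = {}"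
    and d: "graded d (X \<alpha>)"
  defines "b \<equiv> brk"
  shows "b C (b (b M (X \<alpha>)) (Y \<alpha>)) = b (b (b C M) (X \<alpha>)) (Y \<alpha>) - b (b M (b C (X \<alpha>))) (Y \<alpha>)
    + lscale ((-1) ^ d) (b (b M (X \<alpha>)) (b C (Y \<alpha>)))"
proof -
  note J = lbracket_Jacobi[OF _ _ _ _ linear_funs_local(2)[OF X K] subset_refl linear_funs_local(1)[OF X K], folded b_def]
    lbracket_Jacobi[OF _ _ _ _ linear_funs_local(2)[OF Y K] subset_refl linear_funs_local(1)[OF Y K], folded b_def]
  have Xs: "coef_smooth (X \<alpha>)" using X gfuns_coef_smooth unfolding linear_funs_def by blast
  have MX: "graded (0 + d + 1) (b M (X \<alpha>))" "coef_smooth (b M (X \<alpha>))"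
    unfolding b_def by (rule graded_lbracket[OF M(1) d], rule coef_smooth_lbracket[OF M(2) Xs])
  have "b C (b M (X \<alpha>)) = b (b C M) (X \<alpha>) + lscale (-1) (b M (b C (X \<alpha>)))"
    using J(1)[OF C M] by simp
  then have "b (b C (b M (X \<alpha>))) (Y \<alpha>) = b (b (b C M) (X \<alpha>)) (Y \<alpha>) + lscale (-1) (b (b M (b C (X \<alpha>))) (Y \<alpha>))"
    unfolding b_def
    by (simp only: lbracket_add_left lbracket_lscale_left coef_smooth_lbracket coef_smooth_fmul smooth_const C M Xs)
  moreover have "(-1::real) ^ ((0 + 1) * (0 + d + 1 + 1)) = (-1) ^ d" by simp
  ultimately have "b C (b (b M (X \<alpha>)) (Y \<alpha>)) = b (b (b C M) (X \<alpha>)) (Y \<alpha>) + lscale (-1) (b (b M (b C (X \<alpha>))) (Y \<alpha>))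
      + lscale ((-1) ^ d) (b (b M (X \<alpha>)) (b C (Y \<alpha>)))"
    using J(2)[OF C MX] by (simp only:)
  then show ?thesis by (auto simp: fun_eq_iff fmul_def)
qed

end

section \<open>Structure functions\<close>

lemma gfuns_outside_idx: "F \<in> gfuns \<A> \<Longrightarrow> \<alpha> \<notin> idx \<A> \<Longrightarrow> F \<alpha> = 0"
  unfolding gfuns_def by (auto simp: fun_eq_iff)

lemma tcomp_outside_idx: "F \<in> gfuns \<A> \<Longrightarrow> \<alpha> \<notin> idx \<A> \<Longrightarrow> tcomp t F \<alpha> = 0"
  using gfuns_outside_idx[of F \<A> \<alpha>] by (auto simp: tcomp_def fun_eq_iff)

context bundle_chart
begin

lemma lbracket_outside:
  assumes m: "m \<notin> dom" and F: "\<And>B. F B m = 0"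
  shows "brk F G A m = 0"
proof -
  have "lprod (rderiv w F) H A m = 0" for w H
    by (rule ccontr, erule lprod_nonzeroE) (simp add: rderiv_def F)
  moreover have "lprod (dX i F) H A m = 0" for i H
    by (rule ccontr, erule lprod_nonzeroE) (simp add: xderiv_def pd_outside[OF m])
  ultimately show ?thesis
    unfolding lbracket_fibre_gens by (simp add: sum_lfun_apply fmul_apply)
qed

lemma tcomp_local:
  assumes F: "F \<in> gfuns \<A>"
  shows "coef_smooth (tcomp t F \<alpha>)" "tri_supported t (tcomp t F \<alpha>)" "adm_supported (tcomp t F \<alpha>)"
    "even (fst t + fst (snd t) + snd (snd t)) \<Longrightarrow> graded 0 (tcomp t F \<alpha>)"
    "tcomp t F \<alpha> A m \<noteq> 0 \<Longrightarrow> set_mset A \<subseteq> gens \<A>"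
    "m \<notin> dom \<Longrightarrow> tcomp t F \<alpha> A m = 0"
proof -
  have supp: "admissible A \<and> set_mset A \<subseteq> gens \<A> \<and> m \<in> dom" if "F \<alpha> A m \<noteq> 0" for A m
    using F that unfolding gfuns_def by blast
  show "coef_smooth (tcomp t F \<alpha>)"
    unfolding coef_smooth_def
  proof
    fix A
    have "tcomp t F \<alpha> A = (if mtdeg A = t then F \<alpha> A else (\<lambda>_. 0))"
      by (auto simp: tcomp_def mtdeg_def)
    then show "smooth (tcomp t F \<alpha> A)"
      using gfuns_coef_smooth[OF F] smooth_const unfolding coef_smooth_def by simp
  qed
  show tri: "tri_supported t (tcomp t F \<alpha>)"
    unfolding tri_supported_def tcomp_def mtdeg_def by auto
  show adm: "adm_supported (tcomp t F \<alpha>)"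
    unfolding adm_supported_def tcomp_def using supp by auto
  show "graded 0 (tcomp t F \<alpha>)" if "even (fst t + fst (snd t) + snd (snd t))"
    using that tri adm unfolding graded_def tri_supported_def adm_supported_def mdeg_mtdeg by simp
  show "tcomp t F \<alpha> A m \<noteq> 0 \<Longrightarrow> set_mset A \<subseteq> gens \<A>" "m \<notin> dom \<Longrightarrow> tcomp t F \<alpha> A m = 0"
    using supp[of A m] by (auto simp: tcomp_def split: if_splits)
qed

section \<open>Brackets of the components of the structure functions\<close>

text \<open>A bracket of components sits in the sum of their tridegrees minus (1, 1, 1). In the
  equation \<mu> only the brackets of \<open>m\<^sub>1\<close> with \<open>m\<^sub>3\<close> and of
  \<open>m\<^sub>2\<close> with itself can share a tridegree, so those of \<open>m\<^sub>1\<close>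
  with itself and with \<open>m\<^sub>2\<close> vanish separately; in \<gamma> the same holds for
  \<open>m\<^sub>1\<close> and \<open>g\<^sub>2\<close>. The bracket of \<open>m\<^sub>3\<close> and
  \<open>g\<^sub>3\<close> would need a negative first component.\<close>

lemma structure_bracket_components:
  assumes g: "graded 0 m\<^sub>1" "graded 0 m\<^sub>2" "graded 0 m\<^sub>3" "graded 0 g\<^sub>2" "graded 0 g\<^sub>3"
    and s: "coef_smooth m\<^sub>1" "coef_smooth m\<^sub>2" "coef_smooth m\<^sub>3" "coef_smooth g\<^sub>2" "coef_smooth g\<^sub>3"
    and t: "tri_supported (2, 1, 1) m\<^sub>1" "tri_supported (1, 2, 1) m\<^sub>2" "tri_supported (0, 3, 1) m\<^sub>3"
      "tri_supported (1, 1, 2) g\<^sub>2" "tri_supported (0, 1, 3) g\<^sub>3"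
    and \<mu>: "brk (m\<^sub>1 + m\<^sub>2 + m\<^sub>3) (m\<^sub>1 + m\<^sub>2 + m\<^sub>3) = 0"
    and \<gamma>: "brk (m\<^sub>1 + g\<^sub>2 + g\<^sub>3) (m\<^sub>1 + g\<^sub>2 + g\<^sub>3) = 0"
  shows "brk (m\<^sub>1 + g\<^sub>2 + g\<^sub>3) m\<^sub>2 = brk m\<^sub>2 g\<^sub>2 + brk m\<^sub>2 g\<^sub>3" (is ?H)
    and "brk (m\<^sub>1 + m\<^sub>2 + m\<^sub>3) g\<^sub>2 = brk m\<^sub>2 g\<^sub>2 + brk m\<^sub>3 g\<^sub>2" (is ?K)
    and "brk (m\<^sub>1 + m\<^sub>2 + m\<^sub>3 + g\<^sub>2 + g\<^sub>3) (m\<^sub>1 + m\<^sub>2 + m\<^sub>3 + g\<^sub>2 + g\<^sub>3) = 0 \<longleftrightarrow>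
      brk m\<^sub>2 g\<^sub>2 = 0 \<and> brk m\<^sub>2 g\<^sub>3 = 0 \<and> brk m\<^sub>3 g\<^sub>2 = 0" (is ?N)
proof -
  let ?b = "brk"
  note cm = lbracket_commute[OF g(2) g(1)] lbracket_commute[OF g(3) g(1)] lbracket_commute[OF g(3) g(2)]
    lbracket_commute[OF g(4) g(1)] lbracket_commute[OF g(5) g(1)] lbracket_commute[OF g(5) g(4)]
    lbracket_commute[OF g(4) g(2)] lbracket_commute[OF g(5) g(2)] lbracket_commute[OF g(4) g(3)] lbracket_commute[OF g(5) g(3)]
  note expand = lbracket_add_left lbracket_add_right coef_smooth_add s cm plus_fun_apply
  have Z: "?b x y A m = 0"
    if "tri_supported p x" "tri_supported q y" "mtdeg A + (1, 1, 1) \<noteq> p + q" for x y A m p q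
    using tri_supported_lbracket[OF that(1,2), of \<A> \<alpha> A m] that(3) by blast
  \<comment> \<open>Tridegrees are compared after adding (1, 1, 1), since subtraction on
    \<open>nat\<close> truncates.\<close>
  have mt: "mtdeg A = (i, j, k) \<longleftrightarrow> mtdeg A + (1, 1, 1) = (i + 1, j + 1, k + 1)" for A i j k
    by (cases "mtdeg A") simp
  have M: "?b m\<^sub>1 m\<^sub>1 A m + 2 * ?b m\<^sub>1 m\<^sub>2 A m + 2 * ?b m\<^sub>1 m\<^sub>3 A m + ?b m\<^sub>2 m\<^sub>2 A m + 2 * ?b m\<^sub>2 m\<^sub>3 A m + ?b m\<^sub>3 m\<^sub>3 A m = 0" for A m
  proof -
    have "?b (m\<^sub>1 + m\<^sub>2 + m\<^sub>3) (m\<^sub>1 + m\<^sub>2 + m\<^sub>3) A m = 0" unfolding \<mu> by simp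
    then show ?thesis by (simp only: expand)
  qed
  have G: "?b m\<^sub>1 m\<^sub>1 A m + 2 * ?b m\<^sub>1 g\<^sub>2 A m + 2 * ?b m\<^sub>1 g\<^sub>3 A m + ?b g\<^sub>2 g\<^sub>2 A m + 2 * ?b g\<^sub>2 g\<^sub>3 A m + ?b g\<^sub>3 g\<^sub>3 A m = 0" for A m
  proof -
    have "?b (m\<^sub>1 + g\<^sub>2 + g\<^sub>3) (m\<^sub>1 + g\<^sub>2 + g\<^sub>3) A m = 0" unfolding \<gamma> by simp
    then show ?thesis by (simp only: expand)
  qed
  have b11: "?b m\<^sub>1 m\<^sub>1 A m = 0" for A m
    using M[of A m] Z[OF t(1) t(1), of A m]
    by (cases "mtdeg A = (3, 1, 1)") (auto simp: mt numeral_eq_Suc Z[OF t(1) t(2)] Z[OF t(1) t(3)] Z[OF t(2) t(2)] Z[OF t(2) t(3)] Z[OF t(3) t(3)])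
  have b12: "?b m\<^sub>1 m\<^sub>2 A m = 0" for A m
    using M[of A m] Z[OF t(1) t(2), of A m]
    by (cases "mtdeg A = (2, 2, 1)") (auto simp: mt numeral_eq_Suc Z[OF t(1) t(1)] Z[OF t(1) t(3)] Z[OF t(2) t(2)] Z[OF t(2) t(3)] Z[OF t(3) t(3)])
  have c12: "?b m\<^sub>1 g\<^sub>2 A m = 0" for A m
    using G[of A m] Z[OF t(1) t(4), of A m]
    by (cases "mtdeg A = (2, 1, 2)") (auto simp: mt numeral_eq_Suc Z[OF t(1) t(1)] Z[OF t(1) t(5)] Z[OF t(4) t(4)] Z[OF t(4) t(5)] Z[OF t(5) t(5)])
  have v33: "?b m\<^sub>3 g\<^sub>3 A m = 0" for A m
    by (rule Z[OF t(3) t(5)]) (cases "mtdeg A", simp)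
  show ?H
    by (intro ext) (simp only: expand b12 add_0)
  show ?K
    by (intro ext) (simp only: expand c12 add_0)
  \<comment> \<open>The terms within \<mu> and those within \<gamma> are the two given equations;
    the bracket of \<open>m\<^sub>1\<close> with itself occurs in both and is subtracted
    once.\<close>
  have N: "?b (m\<^sub>1 + m\<^sub>2 + m\<^sub>3 + g\<^sub>2 + g\<^sub>3) (m\<^sub>1 + m\<^sub>2 + m\<^sub>3 + g\<^sub>2 + g\<^sub>3) A m =
     2 * (?b m\<^sub>2 g\<^sub>2 A m + ?b m\<^sub>2 g\<^sub>3 A m + ?b m\<^sub>3 g\<^sub>2 A m)" for A m
  proof -
    have "?b (m\<^sub>1 + m\<^sub>2 + m\<^sub>3 + g\<^sub>2 + g\<^sub>3) (m\<^sub>1 + m\<^sub>2 + m\<^sub>3 + g\<^sub>2 + g\<^sub>3) A m =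
      (?b m\<^sub>1 m\<^sub>1 A m + 2 * ?b m\<^sub>1 m\<^sub>2 A m + 2 * ?b m\<^sub>1 m\<^sub>3 A m + ?b m\<^sub>2 m\<^sub>2 A m + 2 * ?b m\<^sub>2 m\<^sub>3 A m + ?b m\<^sub>3 m\<^sub>3 A m)
      + (?b m\<^sub>1 m\<^sub>1 A m + 2 * ?b m\<^sub>1 g\<^sub>2 A m + 2 * ?b m\<^sub>1 g\<^sub>3 A m + ?b g\<^sub>2 g\<^sub>2 A m + 2 * ?b g\<^sub>2 g\<^sub>3 A m + ?b g\<^sub>3 g\<^sub>3 A m)
      - ?b m\<^sub>1 m\<^sub>1 A m + 2 * (?b m\<^sub>2 g\<^sub>2 A m + ?b m\<^sub>2 g\<^sub>3 A m + ?b m\<^sub>3 g\<^sub>2 A m + ?b m\<^sub>3 g\<^sub>3 A m)"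
      by (simp only: expand) (simp only: algebra_simps mult_2 mult_2_right)
    then show ?thesis unfolding M G unfolding b11 v33 by simp
  qed
  show ?N
  proof
    assume 0: "?b (m\<^sub>1 + m\<^sub>2 + m\<^sub>3 + g\<^sub>2 + g\<^sub>3) (m\<^sub>1 + m\<^sub>2 + m\<^sub>3 + g\<^sub>2 + g\<^sub>3) = 0"
    have "?b m\<^sub>2 g\<^sub>2 A m = 0 \<and> ?b m\<^sub>2 g\<^sub>3 A m = 0 \<and> ?b m\<^sub>3 g\<^sub>2 A m = 0" for A m
      using N[of A m, unfolded 0] Z[OF t(2) t(4), of A m] Z[OF t(2) t(5), of A m] Z[OF t(3) t(4), of A m] by fastforce
    then show "?b m\<^sub>2 g\<^sub>2 = 0 \<and> ?b m\<^sub>2 g\<^sub>3 = 0 \<and> ?b m\<^sub>3 g\<^sub>2 = 0" by (auto simp: fun_eq_iff)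
  next
    assume "?b m\<^sub>2 g\<^sub>2 = 0 \<and> ?b m\<^sub>2 g\<^sub>3 = 0 \<and> ?b m\<^sub>3 g\<^sub>2 = 0"
    then show "?b (m\<^sub>1 + m\<^sub>2 + m\<^sub>3 + g\<^sub>2 + g\<^sub>3) (m\<^sub>1 + m\<^sub>2 + m\<^sub>3 + g\<^sub>2 + g\<^sub>3) = 0"
      using N by (intro ext) simp
  qed
qed

end

section \<open>From charts to global functions\<close>

lemma linear_funs_mono: "K \<subseteq> L \<Longrightarrow> linear_funs \<A> K \<subseteq> linear_funs \<A> L"
  unfolding linear_funs_def by blast

lemma graded_homogeneous:
  assumes "X \<in> gfuns \<A>" "homogeneous d X"
  shows "graded d (X \<alpha>)"
  unfolding graded_def
proof (intro allI impI)
  fix A m assume "X \<alpha> A m \<noteq> 0"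
  then have "admissible A" "mdeg A = d"
    using assms unfolding gfuns_def homogeneous_def mdeg_def by blast+
  then show "admissible A \<and> even (mdeg A + d)" by simp
qed

lemma derivation_iff:
  assumes gvb: "graded_vector_bundle \<A>" and C: "C \<in> gfuns \<A>" "\<And>\<alpha>. \<alpha> \<in> idx \<A> \<Longrightarrow> graded 0 (C \<alpha>)"
    and M: "M \<in> gfuns \<A>" "even (fst t + fst (snd t) + snd (snd t))"
    and X: "X \<in> linear_funs \<A> K" and Y: "Y \<in> linear_funs \<A> K" and K: "K \<inter> range P = {}"
    and d: "homogeneous d X"
  defines "b \<equiv> big_bracket \<A>"
  shows "b C (- b (b (tcomp t M) X) Y) = - (- b (b (tcomp t M) (b C X)) Y) + gscale ((-1) ^ d) (- b (b (tcomp t M) X) (b C Y))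
    \<longleftrightarrow> b (b (b C (tcomp t M)) X) Y = 0"
proof -
  have local: "b C (- b (b (tcomp t M) X) Y) \<alpha> = (- (- b (b (tcomp t M) (b C X)) Y) + gscale ((-1) ^ d) (- b (b (tcomp t M) X) (b C Y))) \<alpha>
      \<longleftrightarrow> b (b (b C (tcomp t M)) X) Y \<alpha> = 0" for \<alpha>
  proof (cases "\<alpha> \<in> idx \<A>")
    case True
    interpret bundle_chart \<A> \<alpha> using gvb True by unfold_locales
    let ?b = "lbracket \<A> \<alpha>" and ?M = "tcomp t M \<alpha>"
    have XG: "X \<in> gfuns \<A>" "Y \<in> gfuns \<A>" using X Y unfolding linear_funs_def by auto
    note sm = gfuns_coef_smooth[OF C(1)] tcomp_local(1)[OF M(1)] gfuns_coef_smooth[OF XG(1)] gfuns_coef_smooth[OF XG(2)]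
    have D: "?b (C \<alpha>) (?b (?b ?M (X \<alpha>)) (Y \<alpha>)) = ?b (?b (?b (C \<alpha>) ?M) (X \<alpha>)) (Y \<alpha>) - ?b (?b ?M (?b (C \<alpha>) (X \<alpha>))) (Y \<alpha>)
        + lscale ((-1) ^ d) (?b (?b ?M (X \<alpha>)) (?b (C \<alpha>) (Y \<alpha>)))"
      by (rule lbracket_derivation_defect[OF C(2)[OF True] sm(1) tcomp_local(4)[OF M] sm(2) X Y K graded_homogeneous[OF XG(1) d]])
    have "- ?b (?b ?M (X \<alpha>)) (Y \<alpha>) = lscale (-1) (?b (?b ?M (X \<alpha>)) (Y \<alpha>))"
      by (simp add: fmul_def fun_eq_iff)
    then have "?b (C \<alpha>) (- ?b (?b ?M (X \<alpha>)) (Y \<alpha>)) = lscale (-1) (?b (C \<alpha>) (?b (?b ?M (X \<alpha>)) (Y \<alpha>)))"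
      by (simp only: lbracket_lscale_right coef_smooth_lbracket sm)
    then show ?thesis
      unfolding b_def big_bracket_def by (auto simp: D fun_eq_iff fmul_def gscale_def)
  next
    \<comment> \<open>Equality of global functions is equality at every index, including those
      without a chart, where all arguments are extended by 0.\<close>
    case False
    have "X \<in> gfuns \<A>" "Y \<in> gfuns \<A>" using X Y unfolding linear_funs_def by auto
    then have z: "C \<alpha> = 0" "X \<alpha> = 0" "Y \<alpha> = 0" "tcomp t M \<alpha> = 0"
      using gfuns_outside_idx[OF _ False] tcomp_outside_idx[OF _ False] C(1) M(1) by blast+
    have "(- (- b (b (tcomp t M) (b C X)) Y) + gscale ((-1) ^ d) (- b (b (tcomp t M) X) (b C Y))) \<alpha> = 0"
      unfolding b_def big_bracket_def by (intro ext) (simp add: gscale_def z)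
    moreover have "b C (- b (b (tcomp t M) X) Y) \<alpha> = 0" "b (b (b C (tcomp t M)) X) Y \<alpha> = 0"
      unfolding b_def big_bracket_def z lbracket_zero by (rule refl)+
    ultimately show ?thesis by (simp only: simp_thms)
  qed
  show ?thesis
  proof
    assume "b C (- b (b (tcomp t M) X) Y) = - (- b (b (tcomp t M) (b C X)) Y) + gscale ((-1) ^ d) (- b (b (tcomp t M) X) (b C Y))"
    then show "b (b (b C (tcomp t M)) X) Y = 0" using local by (intro ext) simp
  next
    assume "b (b (b C (tcomp t M)) X) Y = 0"
    then show "b C (- b (b (tcomp t M) X) Y) = - (- b (b (tcomp t M) (b C X)) Y) + gscale ((-1) ^ d) (- b (b (tcomp t M) X) (b C Y))"
      by (intro ext) (metis local zero_fun_apply)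
  qed
qed

text \<open>\<open>K\<close> holds the coordinates that span the test sections. A global frame
  section is linear in all coordinates of one kind, so \<open>K\<close> consists of full kinds.
  Excluding the \<open>P i\<close> makes each \<open>dual_gen w\<close> in \<open>K\<close> a fibre
  coordinate, hence the dual of a frame element that can be tested against.\<close>

lemma big_bracket_eq_0_if_iterated_eq_0:
  assumes gvb: "graded_vector_bundle \<A>" and C: "C \<in> gfuns \<A>" and M: "M \<in> gfuns \<A>"
    and zero: "\<And>X Y d. X \<in> linear_funs \<A> K \<Longrightarrow> Y \<in> linear_funs \<A> K \<Longrightarrow> homogeneous d X \<Longrightarrow>
      big_bracket \<A> (big_bracket \<A> (big_bracket \<A> C (tcomp t M)) X) Y = 0"
    and K: "\<And>z. z \<in> K \<Longrightarrow> gen_kind z \<subseteq> K" "K \<inter> range P = {}"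
    and split: "\<And>\<alpha> A m. \<alpha> \<in> idx \<A> \<Longrightarrow> big_bracket \<A> C (tcomp t M) \<alpha> A m \<noteq> 0 \<Longrightarrow>
      (\<exists>w\<^sub>1 w\<^sub>2 B. A = add_mset w\<^sub>1 (add_mset w\<^sub>2 B) \<and> {dual_gen w\<^sub>1, dual_gen w\<^sub>2} \<subseteq> K) \<or>
      (\<exists>k w B. A = add_mset (P k) (add_mset w B) \<and> dual_gen w \<in> K \<and> dual_gen w \<notin># B)"
  shows "big_bracket \<A> C (tcomp t M) = 0"
proof (intro ext)
  fix \<alpha> A m
  let ?H = "lbracket \<A> \<alpha> (C \<alpha>) (tcomp t M \<alpha>)"
  have "?H A m = 0"
  proof (rule ccontr)
    assume nz: "?H A m \<noteq> 0"
    have \<alpha>: "\<alpha> \<in> idx \<A>"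
    proof (rule ccontr)
      assume "\<alpha> \<notin> idx \<A>"
      then have "C \<alpha> = 0" by (rule gfuns_outside_idx[OF C])
      with nz show False by simp
    qed
    interpret bundle_chart \<A> \<alpha> using gvb \<alpha> by unfold_locales
    have m: "m \<in> cdom \<A> \<alpha>"
    proof (rule ccontr)
      assume m: "m \<notin> cdom \<A> \<alpha>"
      then have "C \<alpha> B m = 0" for B using C unfolding gfuns_def by blast
      then show False using lbracket_outside[OF m] nz by simp
    qed
    have gens: "set_mset A \<subseteq> gens \<A>"
    proof -
      obtain B D m\<^sub>1 m\<^sub>2 where "C \<alpha> B m\<^sub>1 \<noteq> 0" "tcomp t M \<alpha> D m\<^sub>2 \<noteq> 0" "set_mset A \<subseteq> set_mset B \<union> set_mset D"
        using lbracket_nonzeroE[OF nz] by metis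
      moreover from this have "set_mset B \<subseteq> gens \<A>" "set_mset D \<subseteq> gens \<A>"
        using C tcomp_local(5)[OF M] unfolding gfuns_def by blast+
      ultimately show ?thesis by blast
    qed
    have fibre: "dual_gen w \<in> fibre_gens \<A>" if "w \<in># A" "dual_gen w \<in> K" for w
      using that gens K(2) by (cases w) (auto simp: gens_def fibre_gens_def)
    have H0: "lbracket \<A> \<alpha> (lbracket \<A> \<alpha> ?H (X \<alpha>)) (Y \<alpha>) A m = 0"
      if "X \<in> linear_funs \<A> (gen_kind z\<^sub>1)" "homogeneous (deg z\<^sub>1) X" "Y \<in> linear_funs \<A> (gen_kind z\<^sub>2)" "z\<^sub>1 \<in> K" "z\<^sub>2 \<in> K" for X Y A z\<^sub>1 z\<^sub>2
    proof -
      have "X \<in> linear_funs \<A> K" "Y \<in> linear_funs \<A> K"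
        using that linear_funs_mono K(1) by blast+
      then have "big_bracket \<A> (big_bracket \<A> (big_bracket \<A> C (tcomp t M)) X) Y \<alpha> A m = 0"
        using zero that(2) by simp
      then show ?thesis by (simp add: big_bracket_def)
    qed
    note vanish = iterated_linear_bracket_eq_0D[OF adm_supported_lbracket m, of _ _ \<A> \<alpha> "C \<alpha>" "tcomp t M \<alpha>"]
    from split[OF \<alpha>, of A m] nz consider
      w\<^sub>1 w\<^sub>2 B where "A = add_mset w\<^sub>1 (add_mset w\<^sub>2 B)" "dual_gen w\<^sub>1 \<in> K" "dual_gen w\<^sub>2 \<in> K"
      | k w B where "A = add_mset (P k) (add_mset w B)" "dual_gen w \<in> K" "dual_gen w \<notin># B"
      unfolding big_bracket_def by force
    then show False
    proof cases
      case 1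
      have "?H (add_mset (dual_gen (dual_gen w\<^sub>1)) (add_mset (dual_gen (dual_gen w\<^sub>2)) B)) m = 0"
        by (rule vanish(1)) (use 1 fibre H0 in auto)
      then show False using nz 1 by simp
    next
      case 2
      have "k < bdim \<A>" using gens 2 by (auto simp: gens_def)
      \<comment> \<open>The same frame element serves for both test sections: the first one removes
        \<open>w\<close>, the second one supplies the factor next to the derivative in
        \<open>P k\<close>.\<close>
      then have "?H (add_mset (P k) (add_mset (dual_gen (dual_gen w)) B)) m = 0"
        by (intro vanish(2)[where z\<^sub>2 = "dual_gen w"]) (use 2 fibre H0 in auto)
      then show False using nz 2 by simp
    qed
  qed
  then show "big_bracket \<A> C (tcomp t M) \<alpha> A m = 0 \<alpha> A m" by (simp add: big_bracket_def)
qed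

section \<open>The equivalence\<close>

theorem theorem4p9:
  fixes \<A> :: "('i, 'm) graded_bundle"
    and \<mu> \<gamma> :: "('i, 'm) gfun"
    and l\<^sub>1 k\<^sub>1 :: "('i, 'm) gfun \<Rightarrow> ('i, 'm) gfun"
    and l\<^sub>2 k\<^sub>2 a b :: "('i, 'm) gfun \<Rightarrow> ('i, 'm) gfun \<Rightarrow> ('i, 'm) gfun"
    and l\<^sub>3 k\<^sub>3 :: "('i, 'm) gfun \<Rightarrow> ('i, 'm) gfun \<Rightarrow> ('i, 'm) gfun \<Rightarrow> ('i, 'm) gfun"
  assumes "graded_vector_bundle \<A>"
    and "Lie_2_algebroid_on_A \<A> l\<^sub>1 l\<^sub>2 l\<^sub>3 a \<mu>"
    and "Lie_2_algebroid_on_dual \<A> k\<^sub>1 k\<^sub>2 k\<^sub>3 b \<gamma>"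
    and "tcomp (2, 1, 1) \<mu> = tcomp (2, 1, 1) \<gamma>"
  shows "split_Lie_2_bialgebroid \<A> \<mu> \<gamma> \<longleftrightarrow>
    (\<forall>X\<in>\<Gamma>A \<A>. \<forall>Y\<in>\<Gamma>A \<A>. \<forall>d. homogeneous d X \<longrightarrow>
       big_bracket \<A> \<gamma> (bracket_S \<A> \<mu> X Y) =
         - bracket_S \<A> \<mu> (big_bracket \<A> \<gamma> X) Y + gscale ((-1) ^ d) (bracket_S \<A> \<mu> X (big_bracket \<A> \<gamma> Y))) \<and>
    (\<forall>\<alpha>\<in>\<Gamma>A_dual \<A>. \<forall>\<beta>\<in>\<Gamma>A_dual \<A>. \<forall>d. homogeneous d \<alpha> \<longrightarrow>
       big_bracket \<A> \<mu> (bracket_S_dual \<A> \<gamma> \<alpha> \<beta>) =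
         - bracket_S_dual \<A> \<gamma> (big_bracket \<A> \<mu> \<alpha>) \<beta> + gscale ((-1) ^ d) (bracket_S_dual \<A> \<gamma> \<alpha> (big_bracket \<A> \<mu> \<beta>)))"
proof -
  let ?b = "big_bracket \<A>" and ?\<mu>\<^sub>2 = "tcomp (1, 2, 1) \<mu>" and ?\<gamma>\<^sub>2 = "tcomp (1, 1, 2) \<gamma>"
  let ?K = "range Xid \<union> range Thd" and ?L = "range Xi \<union> range Th"
  note gvb = assms(1)
  have \<mu>: "\<mu> \<in> gfuns \<A>" "\<mu> = tcomp (2, 1, 1) \<mu> + ?\<mu>\<^sub>2 + tcomp (0, 3, 1) \<mu>" "?b \<mu> \<mu> = 0"
    using assms(2) unfolding Lie_2_algebroid_on_A_def structure_function_def by blast+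
  have \<gamma>: "\<gamma> \<in> gfuns \<A>" "\<gamma> = tcomp (2, 1, 1) \<gamma> + ?\<gamma>\<^sub>2 + tcomp (0, 1, 3) \<gamma>" "?b \<gamma> \<gamma> = 0"
    using assms(3) unfolding Lie_2_algebroid_on_dual_def structure_function_def by blast+
  have \<mu>\<alpha>: "\<mu> \<alpha> = tcomp (2, 1, 1) \<mu> \<alpha> + ?\<mu>\<^sub>2 \<alpha> + tcomp (0, 3, 1) \<mu> \<alpha>" for \<alpha>
    by (subst \<mu>(2)) simp
  have \<gamma>\<alpha>: "\<gamma> \<alpha> = tcomp (2, 1, 1) \<mu> \<alpha> + ?\<gamma>\<^sub>2 \<alpha> + tcomp (0, 1, 3) \<gamma> \<alpha>" for \<alpha>
    by (subst \<gamma>(2)) (simp only: plus_fun_apply assms(4))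
  have components:
    "?b \<gamma> ?\<mu>\<^sub>2 \<alpha> = lbracket \<A> \<alpha> (?\<mu>\<^sub>2 \<alpha>) (?\<gamma>\<^sub>2 \<alpha>) + lbracket \<A> \<alpha> (?\<mu>\<^sub>2 \<alpha>) (tcomp (0, 1, 3) \<gamma> \<alpha>)"
    "?b \<mu> ?\<gamma>\<^sub>2 \<alpha> = lbracket \<A> \<alpha> (?\<mu>\<^sub>2 \<alpha>) (?\<gamma>\<^sub>2 \<alpha>) + lbracket \<A> \<alpha> (tcomp (0, 3, 1) \<mu> \<alpha>) (?\<gamma>\<^sub>2 \<alpha>)"
    "?b (\<mu> + \<gamma> - tcomp (2, 1, 1) \<mu>) (\<mu> + \<gamma> - tcomp (2, 1, 1) \<mu>) \<alpha> = 0 \<longleftrightarrow>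
      lbracket \<A> \<alpha> (?\<mu>\<^sub>2 \<alpha>) (?\<gamma>\<^sub>2 \<alpha>) = 0 \<and> lbracket \<A> \<alpha> (?\<mu>\<^sub>2 \<alpha>) (tcomp (0, 1, 3) \<gamma> \<alpha>) = 0 \<and>
      lbracket \<A> \<alpha> (tcomp (0, 3, 1) \<mu> \<alpha>) (?\<gamma>\<^sub>2 \<alpha>) = 0"
    if \<alpha>: "\<alpha> \<in> idx \<A>" for \<alpha>
  proof -
    interpret bundle_chart \<A> \<alpha> using gvb \<alpha> by unfold_locales
    have g: "graded 0 (tcomp (2, 1, 1) \<mu> \<alpha>)" "graded 0 (?\<mu>\<^sub>2 \<alpha>)" "graded 0 (tcomp (0, 3, 1) \<mu> \<alpha>)"
      "graded 0 (?\<gamma>\<^sub>2 \<alpha>)" "graded 0 (tcomp (0, 1, 3) \<gamma> \<alpha>)"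
      using tcomp_local(4)[OF \<mu>(1)] tcomp_local(4)[OF \<gamma>(1)] by simp_all
    let ?m = "tcomp (2, 1, 1) \<mu> \<alpha> + ?\<mu>\<^sub>2 \<alpha> + tcomp (0, 3, 1) \<mu> \<alpha>" and ?g = "tcomp (2, 1, 1) \<mu> \<alpha> + ?\<gamma>\<^sub>2 \<alpha> + tcomp (0, 1, 3) \<gamma> \<alpha>"
    have b: "?b F G \<alpha> = lbracket \<A> \<alpha> (F \<alpha>) (G \<alpha>)" for F G by (simp add: big_bracket_def)
    have "lbracket \<A> \<alpha> (\<mu> \<alpha>) (\<mu> \<alpha>) = 0" "lbracket \<A> \<alpha> (\<gamma> \<alpha>) (\<gamma> \<alpha>) = 0"
      using b[of \<mu> \<mu>] b[of \<gamma> \<gamma>] \<mu>(3) \<gamma>(3) by (metis zero_fun_apply)+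
    then have z: "lbracket \<A> \<alpha> ?m ?m = 0" "lbracket \<A> \<alpha> ?g ?g = 0"
      using arg_cong[OF \<mu>\<alpha>[of \<alpha>], of "\<lambda>F. lbracket \<A> \<alpha> F F"] arg_cong[OF \<gamma>\<alpha>[of \<alpha>], of "\<lambda>F. lbracket \<A> \<alpha> F F"]
      by (metis (no_types, lifting))+
    have \<nu>: "(\<mu> + \<gamma> - tcomp (2, 1, 1) \<mu>) \<alpha> = tcomp (2, 1, 1) \<mu> \<alpha> + ?\<mu>\<^sub>2 \<alpha> + tcomp (0, 3, 1) \<mu> \<alpha> + ?\<gamma>\<^sub>2 \<alpha> + tcomp (0, 1, 3) \<gamma> \<alpha>"
    proof -
      have "(x + y + z + (x + u + v) - x) = x + y + z + u + v" for x y z u v :: "'m lfun"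
        by (intro ext) simp
      then have "\<mu> \<alpha> + \<gamma> \<alpha> - tcomp (2, 1, 1) \<mu> \<alpha> = tcomp (2, 1, 1) \<mu> \<alpha> + ?\<mu>\<^sub>2 \<alpha> + tcomp (0, 3, 1) \<mu> \<alpha> + ?\<gamma>\<^sub>2 \<alpha> + tcomp (0, 1, 3) \<gamma> \<alpha>"
        by (subst \<mu>\<alpha>, subst \<gamma>\<alpha>)
      then show ?thesis by (simp only: minus_apply plus_fun_apply)
    qed
    note S = structure_bracket_components[OF g tcomp_local(1)[OF \<mu>(1)] tcomp_local(1)[OF \<mu>(1)] tcomp_local(1)[OF \<mu>(1)]
        tcomp_local(1)[OF \<gamma>(1)] tcomp_local(1)[OF \<gamma>(1)] tcomp_local(2)[OF \<mu>(1)] tcomp_local(2)[OF \<mu>(1)] tcomp_local(2)[OF \<mu>(1)]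
        tcomp_local(2)[OF \<gamma>(1)] tcomp_local(2)[OF \<gamma>(1)] z]
    show "?b \<gamma> ?\<mu>\<^sub>2 \<alpha> = lbracket \<A> \<alpha> (?\<mu>\<^sub>2 \<alpha>) (?\<gamma>\<^sub>2 \<alpha>) + lbracket \<A> \<alpha> (?\<mu>\<^sub>2 \<alpha>) (tcomp (0, 1, 3) \<gamma> \<alpha>)"
      unfolding b by (subst \<gamma>\<alpha>) (rule S(1))
    show "?b \<mu> ?\<gamma>\<^sub>2 \<alpha> = lbracket \<A> \<alpha> (?\<mu>\<^sub>2 \<alpha>) (?\<gamma>\<^sub>2 \<alpha>) + lbracket \<A> \<alpha> (tcomp (0, 3, 1) \<mu> \<alpha>) (?\<gamma>\<^sub>2 \<alpha>)"
      unfolding b by (subst \<mu>\<alpha>) (rule S(2))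
    show "?b (\<mu> + \<gamma> - tcomp (2, 1, 1) \<mu>) (\<mu> + \<gamma> - tcomp (2, 1, 1) \<mu>) \<alpha> = 0 \<longleftrightarrow>
      lbracket \<A> \<alpha> (?\<mu>\<^sub>2 \<alpha>) (?\<gamma>\<^sub>2 \<alpha>) = 0 \<and> lbracket \<A> \<alpha> (?\<mu>\<^sub>2 \<alpha>) (tcomp (0, 1, 3) \<gamma> \<alpha>) = 0 \<and>
      lbracket \<A> \<alpha> (tcomp (0, 3, 1) \<mu> \<alpha>) (?\<gamma>\<^sub>2 \<alpha>) = 0"
      unfolding b \<nu> by (rule S(3))
  qed
  have tri: "tri_supported t (tcomp t F \<alpha>)" for t and F :: "('i, 'm) gfun" and \<alpha>
    unfolding tri_supported_def tcomp_def mtdeg_def by auto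
  have v22: "mtdeg A = (1, 2, 2)" if "lbracket \<A> \<alpha> (?\<mu>\<^sub>2 \<alpha>) (?\<gamma>\<^sub>2 \<alpha>) A m \<noteq> 0" for \<alpha> A m
    using tri_supported_lbracket[OF tri tri that] by (cases "mtdeg A") simp
  have v23: "mtdeg A = (0, 2, 3)" if "lbracket \<A> \<alpha> (?\<mu>\<^sub>2 \<alpha>) (tcomp (0, 1, 3) \<gamma> \<alpha>) A m \<noteq> 0" for \<alpha> A m
    using tri_supported_lbracket[OF tri tri that] by (cases "mtdeg A") simp
  have v32: "mtdeg A = (0, 3, 2)" if "lbracket \<A> \<alpha> (tcomp (0, 3, 1) \<mu> \<alpha>) (?\<gamma>\<^sub>2 \<alpha>) A m \<noteq> 0" for \<alpha> A m
    using tri_supported_lbracket[OF tri tri that] by (cases "mtdeg A") simp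
  have mt_H: "mtdeg A = (1, 2, 2) \<or> mtdeg A = (0, 2, 3)" if "\<alpha> \<in> idx \<A>" "?b \<gamma> ?\<mu>\<^sub>2 \<alpha> A m \<noteq> 0" for \<alpha> A m
    using that(2) v22[of \<alpha> A m] v23[of \<alpha> A m] unfolding components(1)[OF that(1)] plus_fun_apply by linarith
  have mt_K: "mtdeg A = (1, 2, 2) \<or> mtdeg A = (0, 3, 2)" if "\<alpha> \<in> idx \<A>" "?b \<mu> ?\<gamma>\<^sub>2 \<alpha> A m \<noteq> 0" for \<alpha> A m
    using that(2) v22[of \<alpha> A m] v32[of \<alpha> A m] unfolding components(2)[OF that(1)] plus_fun_apply by linarith
  have bialgebroid: "split_Lie_2_bialgebroid \<A> \<mu> \<gamma> \<longleftrightarrow> ?b \<gamma> ?\<mu>\<^sub>2 = 0 \<and> ?b \<mu> ?\<gamma>\<^sub>2 = 0"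
  proof -
    have "?b (\<mu> + \<gamma> - tcomp (2, 1, 1) \<mu>) (\<mu> + \<gamma> - tcomp (2, 1, 1) \<mu>) \<alpha> = 0 \<longleftrightarrow> ?b \<gamma> ?\<mu>\<^sub>2 \<alpha> = 0 \<and> ?b \<mu> ?\<gamma>\<^sub>2 \<alpha> = 0" for \<alpha>
    proof (cases "\<alpha> \<in> idx \<A>")
      case True
      let ?x = "lbracket \<A> \<alpha> (?\<mu>\<^sub>2 \<alpha>) (?\<gamma>\<^sub>2 \<alpha>)" and ?y = "lbracket \<A> \<alpha> (?\<mu>\<^sub>2 \<alpha>) (tcomp (0, 1, 3) \<gamma> \<alpha>)"
        and ?z = "lbracket \<A> \<alpha> (tcomp (0, 3, 1) \<mu> \<alpha>) (?\<gamma>\<^sub>2 \<alpha>)"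
      \<comment> \<open>\<open>?x\<close> occurs in both sums, but at each monomial at most one of
        the three brackets is nonzero, because their tridegrees are (1, 2, 2), (0, 2, 3) and (0, 3,
        2).\<close>
      have "?x = 0 \<and> ?y = 0 \<and> ?z = 0" if "?x + ?y = 0" "?x + ?z = 0"
      proof -
        have xy: "?x A m + ?y A m = 0" "?x A m + ?z A m = 0" for A m
          using that[THEN fun_cong, THEN fun_cong, of A m] by (simp_all only: plus_fun_apply zero_fun_apply)
        have "?x A m = 0 \<and> ?y A m = 0 \<and> ?z A m = 0" for A m
          using xy[of A m] v22[of \<alpha> A m] v23[of \<alpha> A m] v32[of \<alpha> A m] by fastforce
        then show ?thesis by (auto simp: fun_eq_iff)
      qed
      then show ?thesis unfolding components[OF True] by auto
    next
      case False
      have 0: "\<mu> \<alpha> = 0" "\<gamma> \<alpha> = 0" "tcomp (2, 1, 1) \<mu> \<alpha> = 0"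
        by (fact gfuns_outside_idx[OF \<mu>(1) False] gfuns_outside_idx[OF \<gamma>(1) False] tcomp_outside_idx[OF \<mu>(1) False])+
      then have "(\<mu> + \<gamma> - tcomp (2, 1, 1) \<mu>) \<alpha> = 0"
        by (simp only: minus_apply plus_fun_apply add_0 diff_self)
      with 0 show ?thesis by (simp only: big_bracket_def lbracket_zero simp_thms)
    qed
    then show ?thesis
      unfolding split_Lie_2_bialgebroid_def fun_eq_iff[of _ 0] zero_fun_apply using assms(4) by blast
  qed
  \<comment> \<open>Every component of a structure function has tridegree of total 4, which is even,
    so both enter the Jacobi identity with parity 0.\<close>
  have even: "graded 0 (\<mu> \<alpha>)" "graded 0 (\<gamma> \<alpha>)" if "\<alpha> \<in> idx \<A>" for \<alpha>
  proof -
    interpret bundle_chart \<A> \<alpha> using gvb that by unfold_locales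
    show "graded 0 (\<mu> \<alpha>)"
      by (subst \<mu>\<alpha>) (intro graded_add tcomp_local(4)[OF \<mu>(1)]; simp)
    show "graded 0 (\<gamma> \<alpha>)"
      by (subst \<gamma>\<alpha>) (intro graded_add tcomp_local(4)[OF \<mu>(1)] tcomp_local(4)[OF \<gamma>(1)]; simp)
  qed
  have KP: "?K \<inter> range P = {}" "?L \<inter> range P = {}" by auto
  have cond1: "?b \<gamma> (bracket_S \<A> \<mu> X Y) = - bracket_S \<A> \<mu> (?b \<gamma> X) Y + gscale ((-1) ^ d) (bracket_S \<A> \<mu> X (?b \<gamma> Y))
      \<longleftrightarrow> ?b (?b (?b \<gamma> ?\<mu>\<^sub>2) X) Y = 0"
    if "X \<in> \<Gamma>A \<A>" "Y \<in> \<Gamma>A \<A>" "homogeneous d X" for X Y d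
    unfolding bracket_S_def
    by (rule derivation_iff[OF gvb \<gamma>(1) even(2) \<mu>(1) _ _ _ KP(1)]) (use that in \<open>auto simp: \<Gamma>A_def\<close>)
  have cond2: "?b \<mu> (bracket_S_dual \<A> \<gamma> X Y) = - bracket_S_dual \<A> \<gamma> (?b \<mu> X) Y + gscale ((-1) ^ d) (bracket_S_dual \<A> \<gamma> X (?b \<mu> Y))
      \<longleftrightarrow> ?b (?b (?b \<mu> ?\<gamma>\<^sub>2) X) Y = 0"
    if "X \<in> \<Gamma>A_dual \<A>" "Y \<in> \<Gamma>A_dual \<A>" "homogeneous d X" for X Y d
    unfolding bracket_S_dual_def
    by (rule derivation_iff[OF gvb \<mu>(1) even(1) \<gamma>(1) _ _ _ KP(2)]) (use that in \<open>auto simp: \<Gamma>A_dual_def\<close>)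
  have zero: "?b 0 G = 0" for G by (intro ext) (simp add: big_bracket_def)
  have H: "?b \<gamma> ?\<mu>\<^sub>2 = 0 \<longleftrightarrow> (\<forall>X\<in>\<Gamma>A \<A>. \<forall>Y\<in>\<Gamma>A \<A>. \<forall>d. homogeneous d X \<longrightarrow> ?b (?b (?b \<gamma> ?\<mu>\<^sub>2) X) Y = 0)"
  proof
    assume iter: "\<forall>X\<in>\<Gamma>A \<A>. \<forall>Y\<in>\<Gamma>A \<A>. \<forall>d. homogeneous d X \<longrightarrow> ?b (?b (?b \<gamma> ?\<mu>\<^sub>2) X) Y = 0"
    show "?b \<gamma> ?\<mu>\<^sub>2 = 0"
    proof (rule big_bracket_eq_0_if_iterated_eq_0[OF gvb \<gamma>(1) \<mu>(1) _ _ KP(1) mtdeg_two_lower[OF mt_H]])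
      show "?b (?b (?b \<gamma> ?\<mu>\<^sub>2) X) Y = 0" if "X \<in> linear_funs \<A> ?K" "Y \<in> linear_funs \<A> ?K" "homogeneous d X" for X Y d
        using iter that unfolding \<Gamma>A_def by blast
      show "gen_kind z \<subseteq> ?K" if "z \<in> ?K" for z using that by auto
    qed
  qed (simp add: zero)
  have K: "?b \<mu> ?\<gamma>\<^sub>2 = 0 \<longleftrightarrow> (\<forall>X\<in>\<Gamma>A_dual \<A>. \<forall>Y\<in>\<Gamma>A_dual \<A>. \<forall>d. homogeneous d X \<longrightarrow> ?b (?b (?b \<mu> ?\<gamma>\<^sub>2) X) Y = 0)"
  proof
    assume iter: "\<forall>X\<in>\<Gamma>A_dual \<A>. \<forall>Y\<in>\<Gamma>A_dual \<A>. \<forall>d. homogeneous d X \<longrightarrow> ?b (?b (?b \<mu> ?\<gamma>\<^sub>2) X) Y = 0"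
    show "?b \<mu> ?\<gamma>\<^sub>2 = 0"
    proof (rule big_bracket_eq_0_if_iterated_eq_0[OF gvb \<mu>(1) \<gamma>(1) _ _ KP(2) mtdeg_two_upper[OF mt_K]])
      show "?b (?b (?b \<mu> ?\<gamma>\<^sub>2) X) Y = 0" if "X \<in> linear_funs \<A> ?L" "Y \<in> linear_funs \<A> ?L" "homogeneous d X" for X Y d
        using iter that unfolding \<Gamma>A_dual_def by blast
      show "gen_kind z \<subseteq> ?L" if "z \<in> ?L" for z using that by auto
    qed
  qed (simp add: zero)
  show ?thesis
    unfolding bialgebroid H K using cond1 cond2 by simp
qed

end
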